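(* Let $V$, $\Phi$, $\Delta=\{\alpha_1,\dots,\alpha_n\}$, $\Phi^+=\{\beta_1,\dots,\beta_m\}$, $W_a$, $\iota$, $X_{W_a}$, $X_{W_a}[\lambda]$ be as in the context. 1) The map $\iota: W_a\to X_{W_a}(\mathbb{Z})$, $w\mapsto (k(w,\alpha))_{\alpha\in\Phi^+}$, is well defined and injective, and by corestriction it induces a bijection from $W_a$ onto the set $\widehat{X}_{W_a}(\mathbb{Z})$ of integral points of the subvariety $$\widehat{X}_{W_a}:=\bigsqcup_{\lambda\ \text{admitted}} X_{W_a}[\lambda]\subseteq X_{W_a}$$ (called the Shi variety of $W_a$). 2) Let $\widetilde{\alpha}=\sum_{i=1}^n c_i\alpha_i$ be the highest root of $\Phi$. Then the number of irreducible components of $\widehat{X}_{W_a}$ is $n!\prod_{i=1}^n c_i$.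
   Context: Let $V$ be a Euclidean space with inner product $(\cdot,\cdot)$ and $\Phi\subset V$ an irreducible crystallographic root system spanning $V$, normalized so that short roots have norm $1$. Let $\Delta=\{\alpha_1,\dots,\alpha_n\}$ be a simple system, $\Phi^+=\{\beta_1,\dots,\beta_m\}$ the positive roots, $W$ the Weyl group. For $\alpha\in\Phi$ put $\alpha^\vee=2\alpha/(\alpha,\alpha)$; for $k\in\mathbb{Z}$ let $s_{\alpha,k}(x)=x-\big(\tfrac{2(\alpha,x)}{(\alpha,\alpha)}-k\big)\alpha$, and let $W_a=\langle s_{\alpha,k}:\alpha\in\Phi,k\in\mathbb{Z}\rangle\subset\mathrm{Aff}(V)$ (so $W_a\cong\mathbb{Z}\Phi\rtimes W$). For $\alpha\in\Phi^+$, $k\in\mathbb{Z}$ let $H^1_{\alpha,k}=\{x\in V: k<(x,\alpha^\vee)<k+1\}$. Alcoves are the connected components of $V$ minus all hyperplanes $\{(x,\alpha^\vee)=k\}$; $A_e=\bigcap_{\alpha\in\Phi^+}H^1_{\alpha,0}$, and $w\mapsto A_w:=w(A_e)$ is a bijection from $W_a$ to alcoves. For each $w\in W_a$ there are unique integers $k(w,\alpha)$ ($\alpha\in\Phi^+$) with $A_w=\bigcap_{\alpha\in\Phi^+}H^1_{\alpha,k(w,\alpha)}$. Let $\iota(w)=(k(w,\alpha))_{\alpha\in\Phi^+}\in\mathbb{Z}^m\subset\mathbb{R}^m$ (coordinates indexed by $\Phi^+$). The height $h(\theta^\vee)$ of a coroot $\theta^\vee=\sum_i c_i\alpha_i^\vee$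 is $\sum_i c_i$. For $\theta\in\Phi^+$ with $\theta^\vee=\sum_i c_i\alpha_i^\vee$ let $P_\theta=\sum_i c_iX_{\alpha_i}\in\mathbb{Z}[X_{\alpha_1},\dots,X_{\alpha_n}]\subset\mathbb{Z}[X_{\beta_1},\dots,X_{\beta_m}]$ (so $P_{\alpha_i}=X_{\alpha_i}$). Let $I_\theta=\{0,1,\dots,h(\theta^\vee)-1\}$ and for $\lambda_\theta\in I_\theta$ let $P_\theta[\lambda_\theta]=P_\theta+\lambda_\theta-X_\theta$. Define the ideal $J_{W_a}=\sum_{\alpha\in\Phi^+}\langle\prod_{\lambda\in I_\alpha}P_\alpha[\lambda]\rangle$ of $\mathbb{Z}[X_{\beta_1},\dots,X_{\beta_m}]$ and $X_{W_a}=\{x\in\mathbb{R}^m: P(x)=0\ \forall P\in J_{W_a}\}$. A vector $\lambda=(\lambda_\alpha)_{\alpha\in\Phi^+}\in\mathbb{N}^m$ is admissible if $\lambda_\alpha\in I_\alpha$ for all $\alpha$; for such $\lambda$, $X_{W_a}[\lambda]$ is the common zero set in $\mathbb{R}^m$ of the $P_\alpha[\lambda_\alpha]$, $\alpha\in\Phi^+$. $S[W_a]$ denotes the system of conditions on a tuple $(k_\alpha)_{\alpha\in\Phi^+}$: $k_\alpha+k_\beta\le k_\gamma\le k_\alpha+k_\beta+1$ for all $\alpha,\beta\in\Phi^+$ such that $\alpha^\vee+\beta^\vee$ is a coroot $\gamma^\vee$ with $\gamma\in\Phi^+$ (by Shi, an integer tuple equals $\iota(w)$ for some $w\in W_a$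 iff it satisfies $S[W_a]$). An admissible vector is admitted if it satisfies $S[W_a]$. For $Y\subseteq\mathbb{R}^m$, $Y(\mathbb{Z})=Y\cap\mathbb{Z}^m$. *)

theory Defs
  imports
    "HOL-Analysis.Analysis"
    "HOL-Algebra.Generated_Groups"
    "HOL-Algebra.Bij"
    "HOL-Library.Poly_Mapping"
begin

section \<open>Root systems and affine Weyl groups\<close>

definition coroot :: "'v::euclidean_space \<Rightarrow> 'v" where
  "coroot \<alpha> = (2 / (\<alpha> \<bullet> \<alpha>)) *\<^sub>R \<alpha>"

definition affine_reflection :: "'v::euclidean_space \<Rightarrow> int \<Rightarrow> 'v \<Rightarrow> 'v" where
  "affine_reflection \<alpha> k x = x - (2 * (\<alpha> \<bullet> x) / (\<alpha> \<bullet> \<alpha>) - of_int k) *\<^sub>R \<alpha>"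

text \<open>Root systems are reduced: the only multiples of a root that are roots are itself and its
  negative.\<close>

definition crystallographic_root_system :: "'v::euclidean_space set \<Rightarrow> bool" where
  "crystallographic_root_system \<Phi> \<longleftrightarrow>
     finite \<Phi> \<and> 0 \<notin> \<Phi> \<and> span \<Phi> = UNIV \<and>
     (\<forall>\<alpha>\<in>\<Phi>. \<forall>c. c *\<^sub>R \<alpha> \<in> \<Phi> \<longleftrightarrow> c = 1 \<or> c = - 1) \<and>
     (\<forall>\<alpha>\<in>\<Phi>. affine_reflection \<alpha> 0 ` \<Phi> = \<Phi>) \<and>
     (\<forall>\<alpha>\<in>\<Phi>. \<forall>\<beta>\<in>\<Phi>. 2 * (\<alpha> \<bullet> \<beta>) / (\<alpha> \<bullet> \<alpha>) \<in> \<int>)"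

definition irreducible_roots :: "'v::euclidean_space set \<Rightarrow> bool" where
  "irreducible_roots \<Phi> \<longleftrightarrow> \<Phi> \<noteq> {} \<and>
     \<not> (\<exists>\<Phi>1 \<Phi>2. \<Phi>1 \<noteq> {} \<and> \<Phi>2 \<noteq> {} \<and> \<Phi> = \<Phi>1 \<union> \<Phi>2 \<and> (\<forall>\<alpha>\<in>\<Phi>1. \<forall>\<beta>\<in>\<Phi>2. \<alpha> \<bullet> \<beta> = 0))"

text \<open>The short roots are the roots of minimal norm; if all roots have the same length, all of
  them are short.\<close>

definition short_roots_normalized :: "'v::euclidean_space set \<Rightarrow> bool" where
  "short_roots_normalized \<Phi> \<longleftrightarrow> Min (norm ` \<Phi>) = 1"

definition simple_system :: "'v::euclidean_space set \<Rightarrow> 'v set \<Rightarrow> bool" where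
  "simple_system \<Phi> \<Delta> \<longleftrightarrow>
     \<Delta> \<subseteq> \<Phi> \<and> independent \<Delta> \<and> span \<Delta> = UNIV \<and>
     (\<forall>\<alpha>\<in>\<Phi>. (\<forall>\<delta>\<in>\<Delta>. 0 \<le> representation \<Delta> \<alpha> \<delta>) \<or> (\<forall>\<delta>\<in>\<Delta>. representation \<Delta> \<alpha> \<delta> \<le> 0))"

definition positive_roots :: "'v::euclidean_space set \<Rightarrow> 'v set \<Rightarrow> 'v set" where
  "positive_roots \<Phi> \<Delta> = {\<alpha> \<in> \<Phi>. \<forall>\<delta>\<in>\<Delta>. 0 \<le> representation \<Delta> \<alpha> \<delta>}"

definition highest_root :: "'v::euclidean_space set \<Rightarrow> 'v set \<Rightarrow> 'v \<Rightarrow> bool" where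
  "highest_root \<Phi> \<Delta> \<theta> \<longleftrightarrow>
     \<theta> \<in> \<Phi> \<and> (\<forall>\<beta>\<in>\<Phi>. \<forall>\<delta>\<in>\<Delta>. representation \<Delta> \<beta> \<delta> \<le> representation \<Delta> \<theta> \<delta>)"

definition affine_weyl_group :: "'v::euclidean_space set \<Rightarrow> ('v \<Rightarrow> 'v) set" where
  "affine_weyl_group \<Phi> =
     generate (BijGroup UNIV) {affine_reflection \<alpha> k | \<alpha> k. \<alpha> \<in> \<Phi>}"


section \<open>Alcoves and the Shi parametrization\<close>

definition strip :: "'v::euclidean_space \<Rightarrow> int \<Rightarrow> 'v set" where
  "strip \<alpha> k = {x. of_int k < x \<bullet> coroot \<alpha> \<and> x \<bullet> coroot \<alpha> < of_int k + 1}"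

definition fundamental_alcove :: "'v::euclidean_space set \<Rightarrow> 'v set \<Rightarrow> 'v set" where
  "fundamental_alcove \<Phi> \<Delta> = (\<Inter>\<alpha>\<in>positive_roots \<Phi> \<Delta>. strip \<alpha> 0)"

text \<open>Tuples indexed by the positive roots are extensional functions (elements of \<open>\<rightarrow>\<^sub>E\<close>), so that
  a tuple is determined by its entries at positive roots.\<close>

definition alcove_coordinates ::
    "'v::euclidean_space set \<Rightarrow> 'v set \<Rightarrow> ('v \<Rightarrow> 'v) \<Rightarrow> ('v \<Rightarrow> int) \<Rightarrow> bool" where
  "alcove_coordinates \<Phi> \<Delta> w k \<longleftrightarrow>
     k \<in> positive_roots \<Phi> \<Delta> \<rightarrow>\<^sub>E UNIV \<and>
     w ` fundamental_alcove \<Phi> \<Delta> = (\<Inter>\<alpha>\<in>positive_roots \<Phi> \<Delta>. strip \<alpha> (k \<alpha>))"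

definition shi_coordinates :: "'v::euclidean_space set \<Rightarrow> 'v set \<Rightarrow> ('v \<Rightarrow> 'v) \<Rightarrow> 'v \<Rightarrow> int" where
  "shi_coordinates \<Phi> \<Delta> w = (THE k. alcove_coordinates \<Phi> \<Delta> w k)"

definition iota :: "'v::euclidean_space set \<Rightarrow> 'v set \<Rightarrow> ('v \<Rightarrow> 'v) \<Rightarrow> 'v \<Rightarrow> real" where
  "iota \<Phi> \<Delta> w = (\<lambda>\<alpha>\<in>positive_roots \<Phi> \<Delta>. real_of_int (shi_coordinates \<Phi> \<Delta> w \<alpha>))"

definition shi_system :: "'v::euclidean_space set \<Rightarrow> 'v set \<Rightarrow> ('v \<Rightarrow> int) \<Rightarrow> bool" where
  "shi_system \<Phi> \<Delta> k \<longleftrightarrow>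
     (\<forall>\<alpha>\<in>positive_roots \<Phi> \<Delta>. \<forall>\<beta>\<in>positive_roots \<Phi> \<Delta>. \<forall>\<gamma>\<in>positive_roots \<Phi> \<Delta>.
        coroot \<alpha> + coroot \<beta> = coroot \<gamma> \<longrightarrow> k \<alpha> + k \<beta> \<le> k \<gamma> \<and> k \<gamma> \<le> k \<alpha> + k \<beta> + 1)"


section \<open>Polynomials and real affine varieties\<close>

text \<open>A polynomial in variables from \<^typ>\<open>'x\<close> maps monomials (finitely supported exponent
  vectors) to coefficients; its ring operations are those of \<^theory>\<open>HOL-Library.Poly_Mapping\<close>.
  The ring of polynomials in the variables \<open>A\<close> is the subset \<open>polys_in A\<close>.\<close>

type_synonym ('x, 'c) mpoly = "('x \<Rightarrow>\<^sub>0 nat) \<Rightarrow>\<^sub>0 'c"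

definition var :: "'x \<Rightarrow> ('x, 'c::comm_ring_1) mpoly" where
  "var x = Poly_Mapping.single (Poly_Mapping.single x 1) 1"

definition polys_in :: "'x set \<Rightarrow> ('x, 'c::comm_ring_1) mpoly set" where
  "polys_in A = {p. \<forall>m\<in>Poly_Mapping.keys p. Poly_Mapping.keys m \<subseteq> A}"

definition eval_mpoly :: "('x \<Rightarrow> real) \<Rightarrow> ('x, real) mpoly \<Rightarrow> real" where
  "eval_mpoly x p =
     (\<Sum>m\<in>Poly_Mapping.keys p. Poly_Mapping.lookup p m *
        (\<Prod>i\<in>Poly_Mapping.keys m. x i ^ Poly_Mapping.lookup m i))"

definition real_mpoly :: "('x, int) mpoly \<Rightarrow> ('x, real) mpoly" where
  "real_mpoly p = Poly_Mapping.map real_of_int p"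

definition zero_locus :: "'x set \<Rightarrow> ('x, real) mpoly set \<Rightarrow> ('x \<Rightarrow> real) set" where
  "zero_locus A S = {x \<in> A \<rightarrow>\<^sub>E UNIV. \<forall>p\<in>S. eval_mpoly x p = 0}"

definition algebraic_set :: "'x set \<Rightarrow> ('x \<Rightarrow> real) set \<Rightarrow> bool" where
  "algebraic_set A Z \<longleftrightarrow> (\<exists>S. S \<subseteq> polys_in A \<and> Z = zero_locus A S)"

definition irreducible_algebraic_set :: "'x set \<Rightarrow> ('x \<Rightarrow> real) set \<Rightarrow> bool" where
  "irreducible_algebraic_set A Z \<longleftrightarrow>
     algebraic_set A Z \<and> Z \<noteq> {} \<and>
     (\<forall>Y1 Y2. algebraic_set A Y1 \<and> algebraic_set A Y2 \<and> Z = Y1 \<union> Y2 \<longrightarrow> Z = Y1 \<or> Z = Y2)"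

definition irreducible_components :: "'x set \<Rightarrow> ('x \<Rightarrow> real) set \<Rightarrow> ('x \<Rightarrow> real) set set" where
  "irreducible_components A X =
     {Z. irreducible_algebraic_set A Z \<and> Z \<subseteq> X \<and>
         (\<forall>Z'. irreducible_algebraic_set A Z' \<and> Z \<subseteq> Z' \<and> Z' \<subseteq> X \<longrightarrow> Z' = Z)}"

definition integral_points :: "'x set \<Rightarrow> ('x \<Rightarrow> real) set \<Rightarrow> ('x \<Rightarrow> real) set" where
  "integral_points A Y = {x \<in> Y. \<forall>i\<in>A. x i \<in> \<int>}"

definition principal_ideal_in :: "'x set \<Rightarrow> ('x, 'c::comm_ring_1) mpoly \<Rightarrow> ('x, 'c) mpoly set" where
  "principal_ideal_in A p = {q * p | q. q \<in> polys_in A}"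


section \<open>The Shi variety\<close>

text \<open>For a root \<open>\<theta>\<close> of a crystallographic root system the coefficients of the coroot of \<open>\<theta>\<close> in
  the basis of simple coroots are integers, so rounding down only changes the type.\<close>

definition coroot_coeff :: "'v::euclidean_space set \<Rightarrow> 'v \<Rightarrow> 'v \<Rightarrow> int" where
  "coroot_coeff \<Delta> \<theta> \<alpha> = \<lfloor>representation (coroot ` \<Delta>) (coroot \<theta>) (coroot \<alpha>)\<rfloor>"

definition coroot_height :: "'v::euclidean_space set \<Rightarrow> 'v \<Rightarrow> int" where
  "coroot_height \<Delta> \<theta> = (\<Sum>\<alpha>\<in>\<Delta>. coroot_coeff \<Delta> \<theta> \<alpha>)"

definition I_set :: "'v::euclidean_space set \<Rightarrow> 'v \<Rightarrow> nat set" where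
  "I_set \<Delta> \<theta> = {i. int i < coroot_height \<Delta> \<theta>}"

definition P_poly :: "'v::euclidean_space set \<Rightarrow> 'v \<Rightarrow> ('v, int) mpoly" where
  "P_poly \<Delta> \<theta> = (\<Sum>\<alpha>\<in>\<Delta>. of_int (coroot_coeff \<Delta> \<theta> \<alpha>) * var \<alpha>)"

definition P_shifted :: "'v::euclidean_space set \<Rightarrow> 'v \<Rightarrow> nat \<Rightarrow> ('v, int) mpoly" where
  "P_shifted \<Delta> \<theta> l = P_poly \<Delta> \<theta> + of_nat l - var \<theta>"

definition J_ideal :: "'v::euclidean_space set \<Rightarrow> 'v set \<Rightarrow> ('v, int) mpoly set" where
  "J_ideal \<Phi> \<Delta> =
     {\<Sum>\<alpha>\<in>positive_roots \<Phi> \<Delta>. f \<alpha> | f.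
        \<forall>\<alpha>\<in>positive_roots \<Phi> \<Delta>.
          f \<alpha> \<in> principal_ideal_in (positive_roots \<Phi> \<Delta>) (\<Prod>l\<in>I_set \<Delta> \<alpha>. P_shifted \<Delta> \<alpha> l)}"

definition X_variety :: "'v::euclidean_space set \<Rightarrow> 'v set \<Rightarrow> ('v \<Rightarrow> real) set" where
  "X_variety \<Phi> \<Delta> = zero_locus (positive_roots \<Phi> \<Delta>) (real_mpoly ` J_ideal \<Phi> \<Delta>)"

definition admissible_vectors :: "'v::euclidean_space set \<Rightarrow> 'v set \<Rightarrow> ('v \<Rightarrow> nat) set" where
  "admissible_vectors \<Phi> \<Delta> = (\<Pi>\<^sub>E \<alpha>\<in>positive_roots \<Phi> \<Delta>. I_set \<Delta> \<alpha>)"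

definition admitted_vectors :: "'v::euclidean_space set \<Rightarrow> 'v set \<Rightarrow> ('v \<Rightarrow> nat) set" where
  "admitted_vectors \<Phi> \<Delta> = {l \<in> admissible_vectors \<Phi> \<Delta>. shi_system \<Phi> \<Delta> (\<lambda>\<alpha>. int (l \<alpha>))}"

definition X_component :: "'v::euclidean_space set \<Rightarrow> 'v set \<Rightarrow> ('v \<Rightarrow> nat) \<Rightarrow> ('v \<Rightarrow> real) set" where
  "X_component \<Phi> \<Delta> l =
     zero_locus (positive_roots \<Phi> \<Delta>)
       {real_mpoly (P_shifted \<Delta> \<alpha> (l \<alpha>)) | \<alpha>. \<alpha> \<in> positive_roots \<Phi> \<Delta>}"

definition shi_variety :: "'v::euclidean_space set \<Rightarrow> 'v set \<Rightarrow> ('v \<Rightarrow> real) set" where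
  "shi_variety \<Phi> \<Delta> = (\<Union>l\<in>admitted_vectors \<Phi> \<Delta>. X_component \<Phi> \<Delta> l)"

end

theory Submission
  imports Defs
begin

text \<open>The coroots form a root system of their own, and the reflections generating \<open>W\<^sub>a\<close> are those in
  the hyperplanes \<open>(x, \<gamma>) = m\<close> for coroots \<open>\<gamma>\<close> and integers \<open>m\<close>. A reflection in a simple
  affine root permutes the other positive affine roots. Hence a tuple satisfying Shi's inequalities
  can be moved to the zero tuple by successive simple reflections, and an element of \<open>W\<^sub>a\<close> fixing
  the fundamental alcove is trivial, so \<open>W\<^sub>a\<close> corresponds to the integral solutions of Shi's system.
  Subtracting the value of \<open>P\<^sub>\<theta>\<close> from an integral solution leaves an admitted vector, and each
  \<open>X[\<lambda>]\<close> is an affine space, hence irreducible.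

  The number \<open>N\<close> of admitted vectors is the number of alcoves in a parallelepiped spanned by the
  fundamental weights. Comparing volumes, \<open>N\<close> and the order of the Weyl group are two parallelepiped
  volumes divided by that of an alcove. Their ratio does not change when roots and coroots are
  exchanged, since this only rescales basis vectors, so \<open>N\<close> may be computed with the roots in place
  of the coroots. There the fundamental alcove is the simplex cut out by the simple roots and the
  highest root, whose volume gives \<open>N = n! \<Prod> c\<^sub>i\<close>.\<close>

section \<open>Roots and coroots\<close>

text \<open>The alcoves of the theorem are cut out by the hyperplanes of the coroots, so their
  fundamental alcove is bounded by the highest root of the dual system, whose coefficients are in
  general not the \<open>c\<close> of the statement. This blocks a direct volume computation and is
  why the general development is a locale used twice, for a root system and for its coroots. Let
  \<kappa> be the volume of the box \<open>0 < y \<bullet> b < 1\<close> over the simple roots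
  \<open>b\<close>, \<mu> that of the box \<open>0 \<le> y \<bullet> \<omega> b < 1\<close> over the
  fundamental weights, C the product of n! and the coefficients of the highest root, and p the
  product of the numbers \<open>(b \<bullet> b) / 2\<close>. For the roots, an alcove has volume
  \<kappa>/C and |W| alcoves fill \<mu>. For the coroots, N alcoves fill \<kappa>p and |W| alcoves
  of the same volume fill \<mu>p. Hence N/|W| = \<kappa>/\<mu> = C/|W|, so N = C. No determinant, no
  value of |W| and no volume of a dual alcove has to be computed.\<close>

definition reflect :: "'v::euclidean_space \<Rightarrow> 'v \<Rightarrow> 'v" where
  "reflect \<alpha> x = x - (x \<bullet> coroot \<alpha>) *\<^sub>R \<alpha>"

lemma inner_coroot: "\<beta> \<bullet> coroot \<alpha> = 2 * (\<alpha> \<bullet> \<beta>) / (\<alpha> \<bullet> \<alpha>)"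
  by (simp add: coroot_def inner_commute)

lemma inner_coroot_self: "\<alpha> \<noteq> 0 \<Longrightarrow> \<alpha> \<bullet> coroot \<alpha> = 2"
  by (simp add: coroot_def)

lemma coroot_coroot [simp]: "coroot (coroot \<alpha>) = \<alpha>"
  by (cases "\<alpha> = 0") (simp_all add: coroot_def)

lemma coroot_minus [simp]: "coroot (- \<alpha>) = - coroot \<alpha>"
  by (simp add: coroot_def)

lemma coroot_0 [simp]: "coroot 0 = 0"
  by (simp add: coroot_def)

lemma coroot_eq_0_iff [simp]: "coroot \<alpha> = 0 \<longleftrightarrow> \<alpha> = 0"
  by (metis coroot_coroot coroot_0)

lemma inj_coroot: "inj_on coroot A"
  by (metis coroot_coroot inj_onI)

lemma coroot_eq_iff [simp]: "coroot \<alpha> = coroot \<beta> \<longleftrightarrow> \<alpha> = \<beta>"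
  by (metis coroot_coroot)

lemma reflect_alt: "reflect \<alpha> x = x - (x \<bullet> \<alpha>) *\<^sub>R coroot \<alpha>"
  by (simp add: reflect_def coroot_def)

lemma reflect_eq_affine_reflection: "reflect \<alpha> = affine_reflection \<alpha> 0"
  by (simp add: fun_eq_iff reflect_def affine_reflection_def inner_coroot)

text \<open>\<open>reflect_def\<close> and \<open>reflect_alt\<close> differ only in which of
  \<alpha> and \<open>coroot \<alpha>\<close> is paired with the argument. Hence a root system and
  its dual share their Weyl group.\<close>

lemma reflect_coroot: "reflect (coroot \<alpha>) = reflect \<alpha>"
  by (metis coroot_coroot ext reflect_alt reflect_def)

lemma linear_reflect: "linear (reflect \<alpha>)"
  unfolding reflect_def
  by (intro linearI) (simp_all add: algebra_simps)

lemma inner_reflect: "reflect \<alpha> x \<bullet> y = x \<bullet> reflect \<alpha> y"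
  by (simp add: reflect_def coroot_def inner_diff_left inner_diff_right inner_commute)

lemma reflect_reflect [simp]: "reflect \<alpha> (reflect \<alpha> x) = x"
proof (cases "\<alpha> = 0")
  case False
  then show ?thesis
    by (simp add: reflect_def inner_diff_left inner_coroot_self)
qed (simp add: reflect_def)

lemma reflect_isometry: "reflect \<alpha> x \<bullet> reflect \<alpha> y = x \<bullet> y"
  by (simp add: inner_reflect)

lemma reflect_self: "\<alpha> \<noteq> 0 \<Longrightarrow> reflect \<alpha> \<alpha> = - \<alpha>"
  by (simp add: reflect_def inner_coroot_self scaleR_2)

lemma reflect_minus [simp]: "reflect \<alpha> (- x) = - reflect \<alpha> x"
  by (simp add: reflect_def)

lemma reflect_uminus [simp]: "reflect (- \<alpha>) = reflect \<alpha>"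
  by (simp add: fun_eq_iff reflect_def)

lemma reflect_add: "reflect \<alpha> (x + y) = reflect \<alpha> x + reflect \<alpha> y"
  and reflect_scaleR: "reflect \<alpha> (c *\<^sub>R x) = c *\<^sub>R reflect \<alpha> x"
  by (simp_all add: reflect_def algebra_simps)

lemma coroot_reflect: "coroot (reflect \<beta> \<alpha>) = reflect \<beta> (coroot \<alpha>)"
  by (simp add: coroot_def reflect_isometry reflect_scaleR)

text \<open>A functional with prescribed values on a basis is represented by the vector
  \<open>adjoint f 1\<close>. This supplies both \<open>rho\<close> and the fundamental
  weights.\<close>

lemma dual_vector_exists:
  fixes B :: "'v::euclidean_space set"
  assumes "independent B"
  shows "\<exists>v. \<forall>b\<in>B. b \<bullet> v = g b"
proof -
  obtain f where f: "linear f" "\<And>b. b \<in> B \<Longrightarrow> f b = g b"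
    using linear_independent_extend[OF assms, of g] by blast
  have "b \<bullet> adjoint f (1::real) = g b" if "b \<in> B" for b
    using adjoint_works[OF f(1), of b 1] f(2)[OF that] by (simp add: inner_commute)
  then show ?thesis by blast
qed

section \<open>Root systems with a simple system: positivity and height\<close>

locale root_system =
  fixes R B :: "'v::euclidean_space set"
  assumes crystallographic: "crystallographic_root_system R"
    and simple: "simple_system R B"
begin

abbreviation P :: "'v set" where "P \<equiv> positive_roots R B"

lemma finite_R: "finite R"
  and zero_notin: "0 \<notin> R"
  and span_R: "span R = UNIV"
  and multiples: "\<alpha> \<in> R \<Longrightarrow> c *\<^sub>R \<alpha> \<in> R \<longleftrightarrow> c = 1 \<or> c = - 1"
  and reflect_image: "\<alpha> \<in> R \<Longrightarrow> reflect \<alpha> ` R = R"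
  and inner_coroot_Ints: "\<alpha> \<in> R \<Longrightarrow> \<beta> \<in> R \<Longrightarrow> \<beta> \<bullet> coroot \<alpha> \<in> \<int>"
  using crystallographic
  unfolding crystallographic_root_system_def reflect_eq_affine_reflection inner_coroot by blast+

lemma reflect_in_R: "\<alpha> \<in> R \<Longrightarrow> \<beta> \<in> R \<Longrightarrow> reflect \<alpha> \<beta> \<in> R"
  using reflect_image by blast

lemma R_nonzero: "\<alpha> \<in> R \<Longrightarrow> \<alpha> \<noteq> 0"
  using zero_notin by auto

lemma R_uminus [simp]: "- \<alpha> \<in> R \<longleftrightarrow> \<alpha> \<in> R"
  using multiples[of \<alpha> "-1"] multiples[of "- \<alpha>" "-1"] by auto

lemma B_R: "b \<in> B \<Longrightarrow> b \<in> R"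
  and indep_B: "independent B"
  and span_B: "span B = UNIV"
  using simple unfolding simple_system_def by blast+

lemma finite_B: "finite B"
  using B_R finite_R by (meson finite_subset subsetI)

lemma card_B: "card B = DIM('v)"
  using indep_B span_B by (metis dim_UNIV dim_eq_card_independent dim_span)

lemma expand_B: "(\<Sum>b\<in>B. representation B x b *\<^sub>R b) = x"
  using real_vector.sum_representation_eq[OF indep_B, of x B] finite_B span_B by auto

lemma representation_sum: "representation B (\<Sum>b\<in>B. c b *\<^sub>R b) b = (if b \<in> B then c b else 0)"
proof -
  have "representation B (\<Sum>b\<in>B. c b *\<^sub>R b) b = (\<Sum>b'\<in>B. c b' * representation B b' b)"
    using indep_B span_B by (simp add: real_vector.representation_sum real_vector.representation_scale)
  also have "\<dots> = (\<Sum>b'\<in>B. if b' = b then c b' else 0)"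
    using indep_B by (intro sum.cong) (auto simp: real_vector.representation_basis)
  finally show ?thesis using finite_B by simp
qed

lemma representation_cases:
  assumes "\<alpha> \<in> R"
  obtains "\<And>b. b \<in> B \<Longrightarrow> representation B \<alpha> b \<ge> 0" | "\<And>b. b \<in> B \<Longrightarrow> representation B \<alpha> b \<le> 0"
  using assms simple unfolding simple_system_def by blast

lemma B_P: "b \<in> B \<Longrightarrow> b \<in> P"
  using indep_B by (simp add: positive_roots_def B_R real_vector.representation_basis)

lemma P_R: "\<alpha> \<in> P \<Longrightarrow> \<alpha> \<in> R"
  by (simp add: positive_roots_def)

lemma finite_P: "finite P"
  using finite_R by (simp add: positive_roots_def)

text \<open>Pairing with this vector is the height function; classically it is half the sum of the
  positive coroots.\<close>

definition rho :: 'v where "rho = (SOME r. \<forall>b\<in>B. b \<bullet> r = 1)"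

lemma inner_rho: "b \<in> B \<Longrightarrow> b \<bullet> rho = 1"
  using someI_ex[OF dual_vector_exists[OF indep_B, of "\<lambda>_. 1"]] unfolding rho_def by blast

lemma height_sum: "x \<bullet> rho = (\<Sum>b\<in>B. representation B x b)"
proof -
  have "x \<bullet> rho = (\<Sum>b\<in>B. representation B x b *\<^sub>R b) \<bullet> rho"
    by (simp add: expand_B)
  also have "\<dots> = (\<Sum>b\<in>B. representation B x b)"
    by (simp add: inner_sum_left inner_rho)
  finally show ?thesis .
qed

text \<open>All coefficients of a root have the same sign, so the sign of their sum decides.
  Positivity becomes one linear inequality, which makes closure under sums immediate.\<close>

lemma P_iff: 
  assumes "\<alpha> \<in> R" shows "\<alpha> \<in> P \<longleftrightarrow> \<alpha> \<bullet> rho > 0"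
proof -
  have ne: "\<exists>b\<in>B. representation B \<alpha> b \<noteq> 0"
  proof (rule ccontr)
    assume "\<not> ?thesis"
    then have "(\<Sum>b\<in>B. representation B \<alpha> b *\<^sub>R b) = 0" by (intro sum.neutral) auto
    then show False using assms R_nonzero by (simp add: expand_B)
  qed
  show ?thesis
  proof
    assume "\<alpha> \<in> P"
    then have "\<And>b. b \<in> B \<Longrightarrow> representation B \<alpha> b \<ge> 0" by (simp add: positive_roots_def)
    with ne have "(\<Sum>b\<in>B. representation B \<alpha> b) > 0"
      by (metis finite_B less_eq_real_def sum_pos2)
    then show "\<alpha> \<bullet> rho > 0" by (simp add: height_sum)
  next
    assume h: "\<alpha> \<bullet> rho > 0"
    from assms show "\<alpha> \<in> P"
    proof (cases rule: representation_cases)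
      case 1 then show ?thesis using assms by (simp add: positive_roots_def)
    next
      case 2
      then have "\<alpha> \<bullet> rho \<le> 0" by (simp add: height_sum sum_nonpos)
      with h show ?thesis by simp
    qed
  qed
qed

lemma height_nonzero: "\<alpha> \<in> R \<Longrightarrow> \<alpha> \<bullet> rho \<noteq> 0"
proof (cases "\<alpha> \<in> P")
  case False
  assume a: "\<alpha> \<in> R"
  have neg: "representation B (- \<alpha>) b = - representation B \<alpha> b" for b
    by (simp add: span_B indep_B real_vector.representation_neg)
  from a have "- \<alpha> \<in> P"
    by (cases rule: representation_cases) (use False a neg in \<open>auto simp: positive_roots_def\<close>)
  then show ?thesis using P_iff[of "- \<alpha>"] a by simp
next
  case True
  assume "\<alpha> \<in> R" 
  then show ?thesis using P_iff True by force
qed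

lemma uminus_P_iff: "\<alpha> \<in> R \<Longrightarrow> - \<alpha> \<in> P \<longleftrightarrow> \<alpha> \<notin> P"
  using P_iff[of \<alpha>] P_iff[of "- \<alpha>"] height_nonzero[of \<alpha>] by auto

lemma P_add: "\<alpha> \<in> P \<Longrightarrow> \<beta> \<in> P \<Longrightarrow> \<alpha> + \<beta> \<in> R \<Longrightarrow> \<alpha> + \<beta> \<in> P"
  using P_iff[of \<alpha>] P_iff[of \<beta>] P_iff[of "\<alpha> + \<beta>"] P_R by (simp add: inner_add_left)

section \<open>Angles between roots and sums of roots\<close>

lemma R_parallel:
  assumes "\<alpha> \<in> R" "\<beta> \<in> R" "\<beta> = c *\<^sub>R \<alpha>" shows "\<beta> = \<alpha> \<or> \<beta> = - \<alpha>"
  using multiples[OF assms(1), of c] assms by auto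

text \<open>The two Cartan integers are negative and their product is 4 times the squared cosine of
  the angle, hence below 4. So one of them is -1, and the corresponding reflection sends one root to
  the sum.\<close>

lemma add_root:
  assumes a: "\<alpha> \<in> R" and b: "\<beta> \<in> R" and neg: "\<alpha> \<bullet> \<beta> < 0" and ne: "\<beta> \<noteq> - \<alpha>"
  shows "\<alpha> + \<beta> \<in> R"
proof -
  have pa: "\<alpha> \<bullet> \<alpha> > 0" and pb: "\<beta> \<bullet> \<beta> > 0" using a b R_nonzero by auto
  obtain m n where m: "\<beta> \<bullet> coroot \<alpha> = of_int m" and n: "\<alpha> \<bullet> coroot \<beta> = of_int n"
    using inner_coroot_Ints[OF a b] inner_coroot_Ints[OF b a] by (auto elim!: Ints_cases)
  have mneg: "m < 0" and nneg: "n < 0"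
  proof -
    have "\<beta> \<bullet> coroot \<alpha> < 0" "\<alpha> \<bullet> coroot \<beta> < 0"
      using neg pa pb by (simp_all only: inner_coroot inner_commute[of \<beta> \<alpha>] divide_less_0_iff) auto
    then show "m < 0" "n < 0" using m n by simp_all
  qed
  \<comment> \<open>Equality in Cauchy-Schwarz would make the roots proportional, hence equal or
    opposite; equal roots contradict the negative pairing.\<close>
  have "(\<alpha> \<bullet> \<beta>)^2 < (\<alpha> \<bullet> \<alpha>) * (\<beta> \<bullet> \<beta>)"
  proof (rule ccontr)
    assume "\<not> ?thesis"
    then have "(\<alpha> \<bullet> \<beta>)^2 = (\<alpha> \<bullet> \<alpha>) * (\<beta> \<bullet> \<beta>)"
      using Cauchy_Schwarz_ineq[of \<alpha> \<beta>] by simp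
    then have "\<bar>\<alpha> \<bullet> \<beta>\<bar>\<^sup>2 = (norm \<alpha> * norm \<beta>)\<^sup>2"
      by (simp add: power_mult_distrib power2_norm_eq_inner)
    then have "\<bar>\<alpha> \<bullet> \<beta>\<bar> = norm \<alpha> * norm \<beta>"
      by (rule power2_eq_imp_eq) simp_all
    then have "norm \<alpha> *\<^sub>R \<beta> = norm \<beta> *\<^sub>R \<alpha> \<or> norm \<alpha> *\<^sub>R \<beta> = - norm \<beta> *\<^sub>R \<alpha>"
      by (simp add: norm_cauchy_schwarz_abs_eq)
    then have "\<exists>c. \<beta> = c *\<^sub>R \<alpha>"
    proof
      assume h: "norm \<alpha> *\<^sub>R \<beta> = norm \<beta> *\<^sub>R \<alpha>"
      have "\<beta> = (1 / norm \<alpha>) *\<^sub>R (norm \<alpha> *\<^sub>R \<beta>)" using R_nonzero[OF a] by simp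
      then show ?thesis unfolding h scaleR_scaleR by blast
    next
      assume h: "norm \<alpha> *\<^sub>R \<beta> = - norm \<beta> *\<^sub>R \<alpha>"
      have "\<beta> = (1 / norm \<alpha>) *\<^sub>R (norm \<alpha> *\<^sub>R \<beta>)" using R_nonzero[OF a] by simp
      then show ?thesis unfolding h scaleR_scaleR by blast
    qed
    then have "\<beta> = \<alpha>" using R_parallel[OF a b] ne by blast
    with neg pa show False by simp
  qed
  moreover have "of_int (m * n) * ((\<alpha> \<bullet> \<alpha>) * (\<beta> \<bullet> \<beta>)) = 4 * (\<alpha> \<bullet> \<beta>)^2"
    using pa pb by (simp flip: m n add: inner_coroot power2_eq_square inner_commute)
  ultimately have "of_int (m * n) * ((\<alpha> \<bullet> \<alpha>) * (\<beta> \<bullet> \<beta>)) < 4 * ((\<alpha> \<bullet> \<alpha>) * (\<beta> \<bullet> \<beta>))"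
    by linarith
  then have "m * n < 4" using pa pb
    by (metis mult_less_cancel_right_pos mult_pos_pos of_int_less_numeral_iff)
  have "m = -1 \<or> n = -1"
  proof (rule ccontr)
    assume "\<not> ?thesis"
    then have "m \<le> -2" "n \<le> -2" using mneg nneg by auto
    then have "(-m) * (-n) \<ge> 2 * 2" by (intro mult_mono) auto
    with \<open>m * n < 4\<close> show False by simp
  qed
  then show ?thesis
    using reflect_in_R[OF a b] reflect_in_R[OF b a] m n by (auto simp: reflect_def add.commute)
qed

lemma diff_root:
  assumes "\<alpha> \<in> R" "\<beta> \<in> R" "\<alpha> \<bullet> \<beta> > 0" "\<beta> \<noteq> \<alpha>"
  shows "\<alpha> - \<beta> \<in> R"
  using add_root[of \<alpha> "- \<beta>"] assms by simp

section \<open>Simple reflections and induction on positive roots\<close>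

lemma positive_coeff_P: 
  assumes "\<alpha> \<in> R" "b \<in> B" "representation B \<alpha> b > 0" shows "\<alpha> \<in> P"
  using assms(1) by (cases rule: representation_cases)
    (use assms in \<open>auto simp: positive_roots_def intro: order.strict_trans2\<close>, fastforce)

lemma other_coeff:
  assumes a: "\<alpha> \<in> P" and b: "b \<in> B" and ne: "\<alpha> \<noteq> b"
  obtains b' where "b' \<in> B" "b' \<noteq> b" "representation B \<alpha> b' > 0"
proof -
  have "\<exists>b'\<in>B. b' \<noteq> b \<and> representation B \<alpha> b' \<noteq> 0"
  proof (rule ccontr)
    assume "\<not> ?thesis"
    then have "(\<Sum>b'\<in>B. representation B \<alpha> b' *\<^sub>R b') = (\<Sum>b'\<in>B. if b' = b then representation B \<alpha> b *\<^sub>R b else 0)"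
      by (intro sum.cong) auto
    then have "\<alpha> = representation B \<alpha> b *\<^sub>R b" using b finite_B by (simp add: expand_B)
    then have "\<alpha> = - b" using R_parallel[of b \<alpha>] a b ne P_R B_R by blast
    then show False using a b uminus_P_iff[of b] B_P B_R by blast
  qed
  then show ?thesis using that a by (force simp: positive_roots_def)
qed

lemma representation_diff_basis:
  assumes "b \<in> B" "b' \<in> B" "b' \<noteq> b"
  shows "representation B (\<alpha> - c *\<^sub>R b) b' = representation B \<alpha> b'"
  using assms indep_B span_B
  by (simp add: real_vector.representation_diff real_vector.representation_scale real_vector.representation_basis)

text \<open>The reflection changes only the coefficient at \<open>b\<close>. A positive root other
  than \<open>b\<close> has a further positive coefficient, which survives and forces
  positivity.\<close>

lemma reflect_simple_P:
  assumes "b \<in> B" "\<alpha> \<in> P" "\<alpha> \<noteq> b"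
  shows "reflect b \<alpha> \<in> P"
proof -
  obtain b' where b': "b' \<in> B" "b' \<noteq> b" "representation B \<alpha> b' > 0"
    using other_coeff[of \<alpha> b] assms by blast
  show ?thesis
    using b' assms P_R B_R reflect_in_R[of b \<alpha>]
    by (intro positive_coeff_P[of _ b']) (auto simp: reflect_def representation_diff_basis)
qed

text \<open>If \<alpha> had no positive pairing with a simple root, then \<alpha> \<bullet>
  \<alpha>, a nonnegative combination of these pairings, would not be positive.\<close>

lemma sub_simple:
  assumes a: "\<alpha> \<in> P" and nb: "\<alpha> \<notin> B"
  obtains b where "b \<in> B" "\<alpha> - b \<in> P"
proof -
  have "\<alpha> \<bullet> \<alpha> > 0" using a P_R R_nonzero by auto
  have "\<exists>b\<in>B. \<alpha> \<bullet> b > 0"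
  proof (rule ccontr)
    assume n: "\<not> ?thesis"
    have "\<alpha> \<bullet> \<alpha> = \<alpha> \<bullet> (\<Sum>b\<in>B. representation B \<alpha> b *\<^sub>R b)" by (simp add: expand_B)
    also have "\<dots> = (\<Sum>b\<in>B. representation B \<alpha> b * (\<alpha> \<bullet> b))" by (simp add: inner_sum_right)
    also have "\<dots> \<le> 0" using n a
      by (intro sum_nonpos mult_nonneg_nonpos) (auto simp: positive_roots_def not_less)
    finally show False using \<open>\<alpha> \<bullet> \<alpha> > 0\<close> by simp
  qed
  then obtain b where b: "b \<in> B" "\<alpha> \<bullet> b > 0" by blast
  then have "\<alpha> - b \<in> R" using diff_root[of \<alpha> b] a nb P_R B_R by blast
  obtain b' where b': "b' \<in> B" "b' \<noteq> b" "representation B \<alpha> b' > 0"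
    using other_coeff[OF a b(1)] nb b by blast
  have "\<alpha> - b \<in> P"
    using b' representation_diff_basis[OF b(1) b'(1,2), of \<alpha> 1] \<open>\<alpha> - b \<in> R\<close>
    by (intro positive_coeff_P[of _ b']) auto
  with b that show ?thesis by blast
qed

lemma P_induct [consumes 1, case_names simple step]:
  assumes "\<alpha> \<in> P" and "\<And>b. b \<in> B \<Longrightarrow> Q b"
    and step: "\<And>\<alpha> b. \<alpha> \<in> P \<Longrightarrow> b \<in> B \<Longrightarrow> \<alpha> + b \<in> P \<Longrightarrow> Q \<alpha> \<Longrightarrow> Q (\<alpha> + b)"
  shows "Q \<alpha>"
  using assms(1)
\<comment> \<open>Heights are not yet known to be integers, since that is derived from this very
  induction. Counting the lower positive roots gives a natural number as measure.\<close>
proof (induction "card {\<beta> \<in> P. \<beta> \<bullet> rho < \<alpha> \<bullet> rho}" arbitrary: \<alpha> rule: less_induct)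
  case less
  show ?case
  proof (cases "\<alpha> \<in> B")
    case False
    then obtain b where b: "b \<in> B" "\<alpha> - b \<in> P" using sub_simple less.prems by blast
    have lt: "(\<alpha> - b) \<bullet> rho < \<alpha> \<bullet> rho" using b by (simp add: inner_diff_left inner_rho)
    have "card {\<beta> \<in> P. \<beta> \<bullet> rho < (\<alpha> - b) \<bullet> rho} < card {\<beta> \<in> P. \<beta> \<bullet> rho < \<alpha> \<bullet> rho}"
      by (rule psubset_card_mono) (use finite_P b lt in auto)
    then have "Q (\<alpha> - b)" using less.hyps b by blast
    then show ?thesis using step[of "\<alpha> - b" b] b less.prems by simp
  qed (use assms in blast)
qed

lemma P_representation_Nats: "\<alpha> \<in> P \<Longrightarrow> b \<in> B \<Longrightarrow> representation B \<alpha> b \<in> \<nat>"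
proof (induction arbitrary: b rule: P_induct)
  case (simple a)
  then show ?case using indep_B by (simp add: real_vector.representation_basis)
next
  case (step a c)
  then show ?case using indep_B span_B
    by (simp add: real_vector.representation_add real_vector.representation_basis)
qed

lemma representation_Ints: "\<alpha> \<in> R \<Longrightarrow> b \<in> B \<Longrightarrow> representation B \<alpha> b \<in> \<int>"
proof (cases "\<alpha> \<in> P")
  case False
  assume "\<alpha> \<in> R" "b \<in> B"
  then have "- \<alpha> \<in> P" using uminus_P_iff False by blast
  then have "representation B (- \<alpha>) b \<in> \<int>" using P_representation_Nats \<open>b \<in> B\<close> Nats_subset_Ints by blast
  then show ?thesis using span_B indep_B by (simp add: real_vector.representation_neg)
qed (use P_representation_Nats Nats_subset_Ints in blast)

lemma height_Ints: "\<alpha> \<in> R \<Longrightarrow> \<alpha> \<bullet> rho \<in> \<int>"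
  unfolding height_sum by (intro Ints_sum representation_Ints)

text \<open>For irreducible \<open>R\<close> the only maximal root is the highest root; the argument below needs
  neither irreducibility nor uniqueness.\<close>

definition maximal_roots :: "'v set" where
  "maximal_roots = {\<gamma> \<in> P. \<forall>\<alpha>\<in>P. \<gamma> + \<alpha> \<notin> R}"

lemma maximal_P: "\<gamma> \<in> maximal_roots \<Longrightarrow> \<gamma> \<in> P"
  by (simp add: maximal_roots_def)

text \<open>A negative pairing would make \<gamma> + \<beta> a root. A pairing of 2 or more would
  make \<gamma> + \<delta> a root for the positive root \<delta> = \<gamma> - \<beta>. Maximality
  excludes both.\<close>

lemma maximal_pairing:
  assumes g: "\<gamma> \<in> maximal_roots" and b: "\<beta> \<in> P" and ne: "\<beta> \<noteq> \<gamma>"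
  shows "\<beta> \<bullet> coroot \<gamma> = 0 \<or> \<beta> \<bullet> coroot \<gamma> = 1 \<and> \<gamma> - \<beta> \<in> P"
proof -
  have gR: "\<gamma> \<in> R" "\<gamma> \<in> P" and bR: "\<beta> \<in> R" using g b by (auto simp: maximal_roots_def P_R)
  have mx: "\<gamma> + \<alpha> \<notin> R" if "\<alpha> \<in> P" for \<alpha> using g that by (simp add: maximal_roots_def)
  have gg: "\<gamma> \<bullet> \<gamma> > 0" using gR R_nonzero by auto
  obtain c where c: "\<beta> \<bullet> coroot \<gamma> = of_int c" using inner_coroot_Ints[OF gR(1) bR] by (auto elim: Ints_cases)
  have ip: "2 * (\<beta> \<bullet> \<gamma>) = of_int c * (\<gamma> \<bullet> \<gamma>)"
    using c gg by (simp add: inner_coroot inner_commute field_simps)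
  have pos_iff: "\<beta> \<bullet> \<gamma> > 0 \<longleftrightarrow> c > 0" "\<beta> \<bullet> \<gamma> < 0 \<longleftrightarrow> c < 0"
  proof -
    have "2 * (\<beta> \<bullet> \<gamma>) > 0 \<longleftrightarrow> c > 0" "2 * (\<beta> \<bullet> \<gamma>) < 0 \<longleftrightarrow> c < 0"
      unfolding ip using gg by (simp_all add: zero_less_mult_iff mult_less_0_iff del: inner_gt_zero_iff)
    then show "\<beta> \<bullet> \<gamma> > 0 \<longleftrightarrow> c > 0" "\<beta> \<bullet> \<gamma> < 0 \<longleftrightarrow> c < 0" by simp_all
  qed
  have nm: "\<beta> \<noteq> - \<gamma>" using b gR uminus_P_iff by blast
  have "c \<ge> 0"
  proof (rule ccontr)
    assume "\<not> ?thesis"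
    then have "\<gamma> \<bullet> \<beta> < 0" using pos_iff by (simp add: inner_commute)
    then show False using add_root[OF gR(1) bR] nm mx b by blast
  qed
  moreover have "\<gamma> - \<beta> \<in> P" if "c > 0"
  proof -
    have "\<gamma> - \<beta> \<in> R" using diff_root[OF gR(1) bR] ne pos_iff that by (simp add: inner_commute)
    moreover have "\<beta> - \<gamma> \<notin> P" using mx[of "\<beta> - \<gamma>"] bR by auto
    ultimately show ?thesis using uminus_P_iff[of "\<gamma> - \<beta>"] by simp
  qed
  moreover have "c < 2"
  proof (rule ccontr)
    assume "\<not> ?thesis"
    then have c2: "c \<ge> 2" by simp
    define \<delta> where "\<delta> = \<gamma> - \<beta>"
    have d: "\<delta> \<in> P" using \<open>c > 0 \<Longrightarrow> \<gamma> - \<beta> \<in> P\<close> c2 by (simp add: \<delta>_def)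
    then have dR: "\<delta> \<in> R" by (simp add: P_R)
    have dc: "2 * (\<gamma> \<bullet> \<delta>) = of_int (2 - c) * (\<gamma> \<bullet> \<gamma>)"
      using ip by (simp add: \<delta>_def inner_diff_right inner_commute algebra_simps)
    \<comment> \<open>For c = 2, the reflection of \<beta> in \<gamma> is \<beta> - 2\<gamma> =
      -(\<gamma> + \<delta>). For larger c, \<gamma> and \<delta> form an obtuse angle and
      \<open>add_root\<close> applies.\<close>
    show False
    proof (cases "c = 2")
      case True
      have "reflect \<gamma> \<beta> = \<beta> - 2 *\<^sub>R \<gamma>" by (simp add: reflect_def c True)
      then have "\<beta> - 2 *\<^sub>R \<gamma> \<in> R" using reflect_in_R[OF gR(1) bR] by simp
      then have "- (\<beta> - 2 *\<^sub>R \<gamma>) \<in> R" by (simp only: R_uminus)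
      then have "\<gamma> + \<delta> \<in> R" by (simp add: \<delta>_def scaleR_2 algebra_simps)
      with mx d show False by blast
    next
      case False
      then have "2 - c < 0" using c2 by simp
      then have "of_int (2 - c) * (\<gamma> \<bullet> \<gamma>) < 0" using gg by (intro mult_neg_pos) (simp_all del: of_int_diff)
      then have "\<gamma> \<bullet> \<delta> < 0" using dc by linarith
      moreover have "\<delta> \<noteq> - \<gamma>" using d gR uminus_P_iff by blast
      ultimately show False using add_root[OF gR(1) dR] mx d by blast
    qed
  qed
  ultimately show ?thesis using c by (cases "c = 0") auto
qed

section \<open>Duality between roots and coroots\<close>

lemma inner_self_pos: "\<alpha> \<in> R \<Longrightarrow> \<alpha> \<bullet> \<alpha> > 0"
  using R_nonzero by auto

lemma span_coroot:
  assumes "S \<subseteq> R" "span S = UNIV" shows "span (coroot ` S) = UNIV"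
proof -
  have "x \<in> span (coroot ` S)" if "x \<in> S" for x
  proof -
    have "x = ((x \<bullet> x) / 2) *\<^sub>R coroot x" using inner_self_pos \<open>S \<subseteq> R\<close> that by (auto simp: coroot_def)
    then show ?thesis using that by (metis image_eqI span_base span_scale)
  qed
  then show ?thesis by (metis \<open>span S = UNIV\<close> span_minimal subsetI subspace_span top.extremum_unique)
qed

lemma span_coroot_B: "span (coroot ` B) = UNIV"
  using span_coroot[of B] B_R span_B by blast

lemma independent_coroot_B: "independent (coroot ` B)"
proof -
  have "card (coroot ` B) = DIM('v)" using card_B by (simp add: card_image inj_coroot)
  then show ?thesis
    using span_coroot_B by (metis card_le_dim_spanning dim_UNIV finite_B finite_imageI order_refl subset_UNIV)
qed

text \<open>Each coefficient is multiplied by a positive ratio of squared lengths. Hence signs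
  agree, and the coroots of simple (positive) roots are the simple (positive) roots of the dual
  system.\<close>

lemma representation_coroot:
  assumes "b \<in> B"
  shows "representation (coroot ` B) (coroot \<alpha>) (coroot b) = representation B \<alpha> b * ((b \<bullet> b) / (\<alpha> \<bullet> \<alpha>))"
proof -
  have *: "representation (coroot ` B) (coroot b') (coroot b) = (if b' = b then 1 else 0)" if "b' \<in> B" for b'
    using independent_coroot_B that assms
    by (auto simp: real_vector.representation_basis dest: inj_onD[OF inj_coroot[of UNIV]])
  have "coroot \<alpha> = (\<Sum>b\<in>B. (representation B \<alpha> b * ((b \<bullet> b) / (\<alpha> \<bullet> \<alpha>))) *\<^sub>R coroot b)"
  proof -
    have "coroot \<alpha> = (2 / (\<alpha> \<bullet> \<alpha>)) *\<^sub>R (\<Sum>b\<in>B. representation B \<alpha> b *\<^sub>R b)"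
      by (simp add: expand_B coroot_def)
    also have "\<dots> = (\<Sum>b\<in>B. (representation B \<alpha> b * ((b \<bullet> b) / (\<alpha> \<bullet> \<alpha>))) *\<^sub>R coroot b)"
      unfolding scaleR_sum_right
      by (intro sum.cong) (use B_R R_nonzero in \<open>auto simp: coroot_def\<close>)
    finally show ?thesis .
  qed
  then have "representation (coroot ` B) (coroot \<alpha>) (coroot b) =
      (\<Sum>b'\<in>B. (representation B \<alpha> b' * ((b' \<bullet> b') / (\<alpha> \<bullet> \<alpha>))) * (if b' = b then 1 else 0))"
    using independent_coroot_B span_coroot_B *
    by (simp add: real_vector.representation_sum real_vector.representation_scale)
  also have "\<dots> = (\<Sum>b'\<in>B. if b' = b then (representation B \<alpha> b' * ((b' \<bullet> b') / (\<alpha> \<bullet> \<alpha>))) else 0)"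
    by (intro sum.cong) auto
  finally show ?thesis using assms finite_B by simp
qed

lemma sgn_representation_coroot:
  assumes "\<alpha> \<in> R" "b \<in> B"
  shows "0 \<le> representation (coroot ` B) (coroot \<alpha>) (coroot b) \<longleftrightarrow> 0 \<le> representation B \<alpha> b"
    and "representation (coroot ` B) (coroot \<alpha>) (coroot b) \<le> 0 \<longleftrightarrow> representation B \<alpha> b \<le> 0"
proof -
  have "(b \<bullet> b) / (\<alpha> \<bullet> \<alpha>) > 0"
    using inner_self_pos[OF assms(1)] inner_self_pos[OF B_R[OF assms(2)]] by (rule divide_pos_pos[rotated])
  then show "0 \<le> representation (coroot ` B) (coroot \<alpha>) (coroot b) \<longleftrightarrow> 0 \<le> representation B \<alpha> b"
    "representation (coroot ` B) (coroot \<alpha>) (coroot b) \<le> 0 \<longleftrightarrow> representation B \<alpha> b \<le> 0"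
    unfolding representation_coroot[OF assms(2)]
    by (simp_all only: zero_le_mult_iff mult_le_0_iff) linarith+
qed

lemma root_system_coroot: "root_system (coroot ` R) (coroot ` B)"
proof
  have mult: "c *\<^sub>R coroot \<alpha> \<in> coroot ` R \<longleftrightarrow> c = 1 \<or> c = - 1" if a: "\<alpha> \<in> R" for \<alpha> c
  proof
    assume "c *\<^sub>R coroot \<alpha> \<in> coroot ` R"
    then obtain \<beta> where b: "\<beta> \<in> R" "c *\<^sub>R coroot \<alpha> = coroot \<beta>" by blast
    have "\<beta> = ((\<beta> \<bullet> \<beta>) / 2) *\<^sub>R coroot \<beta>" using inner_self_pos[OF b(1)] by (simp add: coroot_def)
    also have "\<dots> = ((\<beta> \<bullet> \<beta>) / 2 * c * (2 / (\<alpha> \<bullet> \<alpha>))) *\<^sub>R \<alpha>"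
      unfolding b(2)[symmetric] by (simp add: coroot_def)
    finally have "\<beta> = \<alpha> \<or> \<beta> = - \<alpha>" using R_parallel[OF a b(1)] by blast
    then have "c *\<^sub>R coroot \<alpha> = 1 *\<^sub>R coroot \<alpha> \<or> c *\<^sub>R coroot \<alpha> = (-1) *\<^sub>R coroot \<alpha>" using b by auto
    then show "c = 1 \<or> c = - 1" using R_nonzero[OF a] by (metis coroot_eq_0_iff scaleR_right_imp_eq)
  next
    assume "c = 1 \<or> c = - 1"
    then have "c *\<^sub>R coroot \<alpha> = coroot (c *\<^sub>R \<alpha>)" by auto
    moreover have "c *\<^sub>R \<alpha> \<in> R" using a multiples \<open>c = 1 \<or> c = - 1\<close> by blast
    ultimately show "c *\<^sub>R coroot \<alpha> \<in> coroot ` R" by simp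
  qed
  have refl_im: "affine_reflection \<alpha> 0 ` coroot ` R = coroot ` R" if "\<alpha> \<in> coroot ` R" for \<alpha>
  proof -
    from that obtain \<beta> where b: "\<beta> \<in> R" "\<alpha> = coroot \<beta>" by blast
    have "affine_reflection \<alpha> 0 ` coroot ` R = coroot ` reflect \<beta> ` R"
      unfolding reflect_eq_affine_reflection[symmetric] b reflect_coroot image_image coroot_reflect ..
    then show ?thesis using reflect_image b by simp
  qed
  have ints: "2 * (\<alpha> \<bullet> \<beta>) / (\<alpha> \<bullet> \<alpha>) \<in> \<int>" if "\<alpha> \<in> coroot ` R" "\<beta> \<in> coroot ` R" for \<alpha> \<beta>
  proof -
    from that obtain a b where "a \<in> R" "b \<in> R" "\<alpha> = coroot a" "\<beta> = coroot b" by blast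
    then show ?thesis
      using inner_coroot_Ints[of b a] unfolding inner_coroot[symmetric]
      by (simp add: inner_commute[of "coroot b"])
  qed
  show "crystallographic_root_system (coroot ` R)"
    unfolding crystallographic_root_system_def
  proof (intro conjI)
    show "0 \<notin> coroot ` R" using zero_notin by (metis coroot_coroot coroot_0 imageE)
    show "\<forall>\<alpha>\<in>coroot ` R. \<forall>c. c *\<^sub>R \<alpha> \<in> coroot ` R \<longleftrightarrow> c = 1 \<or> c = - 1"
      using mult by blast
    show "\<forall>\<alpha>\<in>coroot ` R. \<forall>\<beta>\<in>coroot ` R. 2 * (\<alpha> \<bullet> \<beta>) / (\<alpha> \<bullet> \<alpha>) \<in> \<int>"
      using ints by blast
  qed (use finite_R span_coroot[OF subset_refl span_R] refl_im in auto)
  show "simple_system (coroot ` R) (coroot ` B)"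
    unfolding simple_system_def
  proof (intro conjI ballI)
    fix \<alpha> assume "\<alpha> \<in> coroot ` R"
    then obtain \<beta> where b: "\<beta> \<in> R" "\<alpha> = coroot \<beta>" by blast
    from b(1) show "(\<forall>\<delta>\<in>coroot ` B. 0 \<le> representation (coroot ` B) \<alpha> \<delta>) \<or>
        (\<forall>\<delta>\<in>coroot ` B. representation (coroot ` B) \<alpha> \<delta> \<le> 0)"
      by (cases rule: representation_cases) (use b sgn_representation_coroot in auto)
  qed (use B_R independent_coroot_B span_coroot_B in auto)
qed

lemma positive_roots_coroot: "positive_roots (coroot ` R) (coroot ` B) = coroot ` P"
proof -
  have "coroot \<alpha> \<in> positive_roots (coroot ` R) (coroot ` B) \<longleftrightarrow> \<alpha> \<in> P" if "\<alpha> \<in> R" for \<alpha>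
    unfolding positive_roots_def using that sgn_representation_coroot(1)[OF that] by simp
  moreover have "positive_roots (coroot ` R) (coroot ` B) \<subseteq> coroot ` R" "P \<subseteq> R"
    by (simp_all add: positive_roots_def)
  ultimately show ?thesis by blast
qed

end

section \<open>Affine roots and alcoves\<close>

text \<open>The affine root \<open>(\<alpha>, m)\<close> is the affine function \<open>x \<mapsto> x \<bullet> \<alpha> - m\<close>.\<close>

definition aval :: "'v::euclidean_space \<times> int \<Rightarrow> 'v \<Rightarrow> real" where
  "aval f x = x \<bullet> fst f - of_int (snd f)"

definition arefl :: "'v::euclidean_space \<times> int \<Rightarrow> 'v \<Rightarrow> 'v" where
  "arefl f x = x - aval f x *\<^sub>R coroot (fst f)"

text \<open>For roots the pairing is an integer, so rounding only changes the type.\<close>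

definition cartan_int :: "'v::euclidean_space \<Rightarrow> 'v \<Rightarrow> int" where
  "cartan_int \<beta> \<alpha> = \<lfloor>\<beta> \<bullet> coroot \<alpha>\<rfloor>"

text \<open>Chosen so that the affine function of \<open>act a f\<close> is that of \<open>f\<close>
  composed with the reflection \<open>arefl a\<close>, see \<open>aval_act\<close>.\<close>

definition act :: "'v::euclidean_space \<times> int \<Rightarrow> 'v \<times> int \<Rightarrow> 'v \<times> int" where
  "act a f = (reflect (fst a) (fst f), snd f - snd a * cartan_int (fst f) (fst a))"

text \<open>Chosen so that the alcove with coordinates \<open>kact a k\<close> is the image under
  \<open>arefl a\<close> of the alcove with coordinates \<open>k\<close>, see
  \<open>region_kact_image\<close>.\<close>

definition kact :: "'v::euclidean_space \<times> int \<Rightarrow> ('v \<Rightarrow> int) \<Rightarrow> 'v \<Rightarrow> int" where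
  "kact a k \<beta> = k (reflect (fst a) \<beta>) + snd a * cartan_int \<beta> (fst a)"

text \<open>The affine root \<open>f\<close> is positive on the alcove with coordinates \<open>k\<close>.\<close>

definition positive_on :: "('v \<Rightarrow> int) \<Rightarrow> 'v \<times> int \<Rightarrow> bool" where
  "positive_on k f \<longleftrightarrow> snd f \<le> k (fst f)"

primrec word :: "('v::euclidean_space \<times> int) list \<Rightarrow> 'v \<Rightarrow> 'v" where
  "word [] = id"
| "word (a # as) = arefl a \<circ> word as"

lemma word_append: "word (as @ bs) = word as \<circ> word bs"
  by (induction as) (auto simp: fun_eq_iff)

lemma aval_arefl_self: "fst a \<noteq> 0 \<Longrightarrow> aval a (arefl a x) = - aval a x"
  by (simp add: arefl_def aval_def inner_diff_left inner_diff_right inner_commute[of "coroot _"] inner_coroot_self)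

lemma arefl_arefl [simp]: "arefl a (arefl a x) = x"
proof (cases "fst a = 0")
  case False
  have "arefl a (arefl a x) = arefl a x - aval a (arefl a x) *\<^sub>R coroot (fst a)"
    by (rule arefl_def)
  then show ?thesis using False by (simp add: aval_arefl_self) (simp add: arefl_def)
qed (simp add: arefl_def)

lemma arefl_diff: "arefl a (x - v) = arefl a x - reflect (fst a) v"
  by (simp add: arefl_def aval_def reflect_alt algebra_simps)

lemma word_rev: "word (rev as) (word as x) = x" "word as (word (rev as) x) = x"
  by (induction as arbitrary: x) (auto simp: word_append)

lemma bij_word: "bij (word as)"
  by (rule o_bij[of "word (rev as)"]) (auto simp: word_rev)

lemma arefl_uminus: "arefl (- \<alpha>, - m) = arefl (\<alpha>, m)"
  by (simp add: fun_eq_iff arefl_def aval_def flip: scaleR_minus_left)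

section \<open>Affine roots acting on alcove coordinates\<close>

context root_system
begin

definition affine_roots :: "('v \<times> int) set" where "affine_roots = R \<times> UNIV"

text \<open>Coordinates are kept on all roots, so that reflections act on them without sign
  distinctions. On the fundamental alcove a negative root takes values between -1 and 0, whence the
  -1.\<close>

definition base_coords :: "'v \<Rightarrow> int" where "base_coords \<alpha> = (if \<alpha> \<in> P then 0 else - 1)"

text \<open>The pair \<open>(- \<gamma>, - 1)\<close> is the affine function
  \<open>1 - x \<bullet> \<gamma>\<close>; these functions describe the walls of the fundamental
  alcove.\<close>

definition simple_affine_roots :: "('v \<times> int) set" where
  "simple_affine_roots = (\<lambda>b. (b, 0)) ` B \<union> (\<lambda>\<gamma>. (- \<gamma>, - 1)) ` maximal_roots"

text \<open>The first condition is the rule for floors of non-integral numbers t: the floor of -t is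
  minus the floor of t, minus 1.\<close>

definition shi :: "('v \<Rightarrow> int) \<Rightarrow> bool" where
  "shi k \<longleftrightarrow> (\<forall>\<alpha>\<in>R. k (- \<alpha>) = - k \<alpha> - 1) \<and>
     (\<forall>\<alpha>\<in>R. \<forall>\<beta>\<in>R. \<alpha> + \<beta> \<in> R \<longrightarrow> k \<alpha> + k \<beta> \<le> k (\<alpha> + \<beta>) \<and> k (\<alpha> + \<beta>) \<le> k \<alpha> + k \<beta> + 1)"

definition region :: "('v \<Rightarrow> int) \<Rightarrow> 'v set" where
  "region k = {x. \<forall>\<alpha>\<in>R. of_int (k \<alpha>) < x \<bullet> \<alpha> \<and> x \<bullet> \<alpha> < of_int (k \<alpha>) + 1}"

abbreviation "A0 \<equiv> region base_coords"

definition inversions :: "('v \<Rightarrow> int) \<Rightarrow> ('v \<times> int) set" where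
  "inversions k = {f \<in> affine_roots. positive_on base_coords f \<and> \<not> positive_on k f}"

lemma cartan_int: "\<alpha> \<in> R \<Longrightarrow> \<beta> \<in> R \<Longrightarrow> of_int (cartan_int \<beta> \<alpha>) = \<beta> \<bullet> coroot \<alpha>"
  using inner_coroot_Ints by (auto simp: cartan_int_def elim!: Ints_cases)

lemma cartan_int_eqI: "\<alpha> \<in> R \<Longrightarrow> \<beta> \<in> R \<Longrightarrow> \<beta> \<bullet> coroot \<alpha> = of_int c \<Longrightarrow> cartan_int \<beta> \<alpha> = c"
  using cartan_int[of \<alpha> \<beta>] by simp

lemma cartan_int_self: "\<alpha> \<in> R \<Longrightarrow> cartan_int \<alpha> \<alpha> = 2"
  by (intro cartan_int_eqI) (simp_all add: inner_coroot_self R_nonzero)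

lemma cartan_int_uminus: "\<alpha> \<in> R \<Longrightarrow> \<beta> \<in> R \<Longrightarrow> cartan_int (- \<beta>) \<alpha> = - cartan_int \<beta> \<alpha>"
  by (intro cartan_int_eqI) (simp_all add: cartan_int)

lemma cartan_int_uminus_right: "\<alpha> \<in> R \<Longrightarrow> \<beta> \<in> R \<Longrightarrow> cartan_int \<beta> (- \<alpha>) = - cartan_int \<beta> \<alpha>"
  by (intro cartan_int_eqI) (simp_all add: cartan_int)

lemma cartan_int_reflect: "\<alpha> \<in> R \<Longrightarrow> \<beta> \<in> R \<Longrightarrow> cartan_int (reflect \<alpha> \<beta>) \<alpha> = - cartan_int \<beta> \<alpha>"
  by (intro cartan_int_eqI) (simp_all add: cartan_int reflect_in_R inner_reflect reflect_self R_nonzero flip: coroot_reflect)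

lemma affine_roots_iff [simp]: "f \<in> affine_roots \<longleftrightarrow> fst f \<in> R"
  by (auto simp: affine_roots_def mem_Times_iff)

lemma act_in: "fst a \<in> R \<Longrightarrow> fst f \<in> R \<Longrightarrow> fst (act a f) \<in> R"
  by (simp add: act_def reflect_in_R)

lemma aval_act:
  assumes "fst a \<in> R" "fst f \<in> R"
  shows "aval (act a f) x = aval f (arefl a x)"
proof -
  have "of_int (cartan_int (fst f) (fst a)) = fst f \<bullet> coroot (fst a)" using assms cartan_int by blast
  then show ?thesis
    by (simp add: aval_def act_def arefl_def reflect_def algebra_simps inner_diff_right inner_diff_left inner_commute)
qed

lemma act_act:
  assumes "fst a \<in> R" "fst f \<in> R"
  shows "act a (act a f) = f"
  using assms by (simp add: act_def cartan_int_reflect prod_eq_iff)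

lemma act_self: "fst a \<in> R \<Longrightarrow> act a a = (- fst a, - snd a)"
  by (simp add: act_def reflect_self R_nonzero cartan_int_self)

text \<open>A conjugate of a reflection is the reflection in the moved hyperplane; this is what lets
  letters be deleted from words and reflections be expressed by simple ones.\<close>

lemma arefl_act:
  assumes "fst a \<in> R" "fst f \<in> R"
  shows "arefl (act a f) = arefl a \<circ> arefl f \<circ> arefl a"
proof
  fix x
  have "arefl a (arefl f (arefl a x)) = arefl a (arefl a x) - aval f (arefl a x) *\<^sub>R reflect (fst a) (coroot (fst f))"
    by (subst (2) arefl_def) (simp add: arefl_diff reflect_scaleR)
  also have "\<dots> = arefl (act a f) x"
    by (simp add: arefl_def[of "act a f"] aval_act assms) (simp add: act_def coroot_reflect)
  finally show "arefl (act a f) x = (arefl a \<circ> arefl f \<circ> arefl a) x" by simp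
qed

lemma positive_on_kact: "positive_on (kact a k) f \<longleftrightarrow> positive_on k (act a f)"
  by (auto simp: positive_on_def kact_def act_def)

lemma shi_uminus: "shi k \<Longrightarrow> \<alpha> \<in> R \<Longrightarrow> k (- \<alpha>) = - k \<alpha> - 1"
  by (simp add: shi_def)

lemma positive_on_uminus:
  "shi k \<Longrightarrow> fst f \<in> R \<Longrightarrow> positive_on k (- fst f, - snd f) \<longleftrightarrow> \<not> positive_on k f"
  by (auto simp: positive_on_def shi_uminus)

lemma kact_kact: "fst a \<in> R \<Longrightarrow> \<beta> \<in> R \<Longrightarrow> kact a (kact a k) \<beta> = k \<beta>"
  by (simp add: kact_def cartan_int_reflect)

lemma shi_base: "shi base_coords"
  unfolding shi_def
proof (intro conjI ballI impI)
  fix \<alpha> assume "\<alpha> \<in> R"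
  then show "base_coords (- \<alpha>) = - base_coords \<alpha> - 1" by (simp add: base_coords_def uminus_P_iff)
next
  fix \<alpha> \<beta> assume h: "\<alpha> \<in> R" "\<beta> \<in> R" "\<alpha> + \<beta> \<in> R"
  have "\<alpha> + \<beta> \<notin> P" if "\<alpha> \<notin> P" "\<beta> \<notin> P"
    using P_add[of "- \<alpha>" "- \<beta>"] that h uminus_P_iff[OF h(1)] uminus_P_iff[OF h(2)] uminus_P_iff[OF h(3)]
      R_uminus[of "\<alpha> + \<beta>"] by simp
  then show "base_coords \<alpha> + base_coords \<beta> \<le> base_coords (\<alpha> + \<beta>)"
    "base_coords (\<alpha> + \<beta>) \<le> base_coords \<alpha> + base_coords \<beta> + 1"
    using P_add[of \<alpha> \<beta>] h by (auto simp: base_coords_def)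
qed

lemma shi_kact:
  assumes a: "fst a \<in> R" and k: "shi k" shows "shi (kact a k)"
  unfolding shi_def
proof (intro conjI ballI impI)
  fix \<alpha> assume "\<alpha> \<in> R"
  then show "kact a k (- \<alpha>) = - kact a k \<alpha> - 1"
    using a by (simp add: kact_def cartan_int_uminus shi_uminus[OF k] reflect_in_R)
next
  fix \<alpha> \<beta> assume h: "\<alpha> \<in> R" "\<beta> \<in> R" "\<alpha> + \<beta> \<in> R"
  have "cartan_int (\<alpha> + \<beta>) (fst a) = cartan_int \<alpha> (fst a) + cartan_int \<beta> (fst a)"
    using a h by (intro cartan_int_eqI) (simp_all add: cartan_int inner_add_left)
  moreover have "k (reflect (fst a) \<alpha>) + k (reflect (fst a) \<beta>) \<le> k (reflect (fst a) (\<alpha> + \<beta>)) \<and>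
      k (reflect (fst a) (\<alpha> + \<beta>)) \<le> k (reflect (fst a) \<alpha>) + k (reflect (fst a) \<beta>) + 1"
    using k reflect_in_R[OF a h(1)] reflect_in_R[OF a h(2)] reflect_in_R[OF a h(3)]
    unfolding shi_def reflect_add by blast
  ultimately show "kact a k \<alpha> + kact a k \<beta> \<le> kact a k (\<alpha> + \<beta>)"
    "kact a k (\<alpha> + \<beta>) \<le> kact a k \<alpha> + kact a k \<beta> + 1"
    by (simp_all add: kact_def algebra_simps)
qed

lemma positive_on_region:
  assumes "x \<in> region k" "fst f \<in> R"
  shows "positive_on k f \<Longrightarrow> aval f x > 0" and "\<not> positive_on k f \<Longrightarrow> aval f x < 0"
proof -
  have h: "of_int (k (fst f)) < x \<bullet> fst f" "x \<bullet> fst f < of_int (k (fst f) + 1)"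
    using assms by (auto simp: region_def)
  show "aval f x > 0" if "positive_on k f"
    using h(1) that unfolding positive_on_def aval_def
    by (smt (verit) of_int_le_iff)
  show "aval f x < 0" if "\<not> positive_on k f"
  proof -
    have "k (fst f) + 1 \<le> snd f" using that by (simp add: positive_on_def)
    then have "real_of_int (k (fst f) + 1) \<le> of_int (snd f)" by (simp only: of_int_le_iff)
    then show ?thesis using h(2) unfolding aval_def by linarith
  qed
qed

lemma region_kact:
  assumes a: "fst a \<in> R" shows "x \<in> region (kact a k) \<longleftrightarrow> arefl a x \<in> region k"
proof -
  have *: "arefl a x \<bullet> reflect (fst a) \<beta> = x \<bullet> \<beta> - of_int (snd a * cartan_int \<beta> (fst a))" if b: "\<beta> \<in> R" for \<beta>
    using aval_act[of a "(reflect (fst a) \<beta>, 0)" x] a b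
    by (simp add: reflect_in_R) (simp add: act_def aval_def cartan_int_reflect)
  have "x \<in> region (kact a k) \<longleftrightarrow> (\<forall>\<beta>\<in>R. of_int (k (reflect (fst a) \<beta>)) < arefl a x \<bullet> reflect (fst a) \<beta> \<and>
      arefl a x \<bullet> reflect (fst a) \<beta> < of_int (k (reflect (fst a) \<beta>)) + 1)"
    unfolding region_def mem_Collect_eq by (intro ball_cong refl) (auto simp: * kact_def)
  also have "\<dots> \<longleftrightarrow> (\<forall>\<beta>\<in>reflect (fst a) ` R. of_int (k \<beta>) < arefl a x \<bullet> \<beta> \<and> arefl a x \<bullet> \<beta> < of_int (k \<beta>) + 1)"
    by blast
  finally show ?thesis using reflect_image[OF a] by (simp add: region_def)
qed

lemma region_kact_image:
  assumes a: "fst a \<in> R" shows "region (kact a k) = arefl a ` region k"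
proof -
  have "x \<in> region (kact a k) \<longleftrightarrow> x \<in> arefl a ` region k" for x
    unfolding region_kact[OF a] by (metis arefl_arefl image_iff)
  then show ?thesis by blast
qed

lemma region_unique:
  assumes "x \<in> region k" "x \<in> region l" "\<alpha> \<in> R" shows "k \<alpha> = l \<alpha>"
proof -
  have "of_int (k \<alpha>) < x \<bullet> \<alpha>" "x \<bullet> \<alpha> < of_int (k \<alpha>) + 1" "of_int (l \<alpha>) < x \<bullet> \<alpha>" "x \<bullet> \<alpha> < of_int (l \<alpha>) + 1"
    using assms by (auto simp: region_def)
  then show ?thesis by linarith
qed

lemma region_cong: "(\<And>\<alpha>. \<alpha> \<in> R \<Longrightarrow> k \<alpha> = l \<alpha>) \<Longrightarrow> region k = region l"
  by (simp add: region_def)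

lemma simple_affine_in: "a \<in> simple_affine_roots \<Longrightarrow> fst a \<in> R"
  by (auto simp: simple_affine_roots_def B_R maximal_roots_def P_R)

lemma simple_affine_positive: "a \<in> simple_affine_roots \<Longrightarrow> positive_on base_coords a"
  using B_P uminus_P_iff maximal_P P_R
  by (auto simp: simple_affine_roots_def positive_on_def base_coords_def)

text \<open>For a simple root this is \<open>reflect_simple_P\<close>, with levels unchanged. For
  \<open>(- \<gamma>, - 1)\<close>, \<open>maximal_pairing\<close> leaves two cases: the root is
  fixed, or its direction changes sign while its level moves by one, exactly matching the change of
  \<open>base_coords\<close> between 0 and -1.\<close>

lemma act_simple_affine:
  assumes "a \<in> simple_affine_roots" and f: "fst f \<in> R" "positive_on base_coords f" "f \<noteq> a"
  shows "positive_on base_coords (act a f)"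
  using assms(1) unfolding simple_affine_roots_def
proof
  obtain \<beta> j where [simp]: "f = (\<beta>, j)" by (cases f)
  have b: "\<beta> \<in> R" using f by simp
  {
    assume "a \<in> (\<lambda>b. (b, 0)) ` B"
    then obtain b where ab [simp]: "a = (b, 0)" and bB: "b \<in> B" by blast
    have P': "reflect b \<alpha> \<in> P" if "\<alpha> \<in> P" "\<alpha> \<noteq> b" for \<alpha> using reflect_simple_P bB that by blast
    consider "\<beta> = b" | "\<beta> = - b" | "\<beta> \<in> P" "\<beta> \<noteq> b" | "- \<beta> \<in> P" "- \<beta> \<noteq> b" "\<beta> \<notin> P"
      using uminus_P_iff[OF b] by fastforce
    then show ?thesis
    proof cases
      case 1
      then show ?thesis using f bB B_P uminus_P_iff[of b] B_R R_nonzero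
        by (auto simp: positive_on_def act_def base_coords_def reflect_self)
    next
      case 2
      then show ?thesis using f bB B_P uminus_P_iff[of b] B_R R_nonzero
        by (auto simp: positive_on_def act_def base_coords_def reflect_self)
    next
      case 3
      then show ?thesis using f P' by (auto simp: positive_on_def act_def base_coords_def)
    next
      case 4
      then have "reflect b \<beta> \<notin> P" using P'[of "- \<beta>"] uminus_P_iff[of "reflect b \<beta>"] reflect_in_R[OF B_R[OF bB] b] by simp
      then show ?thesis using 4 f by (auto simp: positive_on_def act_def base_coords_def)
    qed
  }
  {
    assume "a \<in> (\<lambda>\<gamma>. (- \<gamma>, - 1)) ` maximal_roots"
    then obtain \<gamma> where ab [simp]: "a = (- \<gamma>, - 1)" and gm: "\<gamma> \<in> maximal_roots" by blast
    have g: "\<gamma> \<in> P" "\<gamma> \<in> R" using gm by (auto simp: maximal_P P_R)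
    have key: "cartan_int \<alpha> \<gamma> = 0 \<and> reflect \<gamma> \<alpha> = \<alpha> \<or> cartan_int \<alpha> \<gamma> = 1 \<and> reflect \<gamma> \<alpha> = - (\<gamma> - \<alpha>) \<and> \<gamma> - \<alpha> \<in> P"
      if "\<alpha> \<in> P" "\<alpha> \<noteq> \<gamma>" for \<alpha>
      using maximal_pairing[OF gm that] that g P_R by (auto simp: reflect_def intro!: cartan_int_eqI)
    have ng: "- \<gamma> \<notin> P" using g uminus_P_iff by blast
    consider "\<beta> = \<gamma>" | "\<beta> = - \<gamma>" | "\<beta> \<in> P" "\<beta> \<noteq> \<gamma>" | "- \<beta> \<in> P" "- \<beta> \<noteq> \<gamma>" "\<beta> \<notin> P"
      using uminus_P_iff[OF b] by fastforce
    then show ?thesis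
    proof cases
      case 1
      then show ?thesis using f g ng
        by (auto simp: positive_on_def act_def base_coords_def reflect_self R_nonzero cartan_int_self cartan_int_uminus_right)
    next
      case 2
      then show ?thesis using f g ng
        by (auto simp: positive_on_def act_def base_coords_def reflect_self R_nonzero cartan_int_self
            cartan_int_uminus_right cartan_int_uminus)
    next
      case 3
      have "\<gamma> - \<beta> \<in> P \<Longrightarrow> - (\<gamma> - \<beta>) \<notin> P" using uminus_P_iff P_R by blast
      then show ?thesis using key[OF 3] f 3 b g
        by (auto simp: positive_on_def act_def base_coords_def cartan_int_uminus_right)
    next
      case 4
      have "cartan_int \<beta> (- \<gamma>) = cartan_int (- \<beta>) \<gamma>" "reflect (- \<gamma>) \<beta> = - reflect \<gamma> (- \<beta>)"
        using b g by (simp_all add: cartan_int_uminus_right cartan_int_uminus)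
      then consider "cartan_int \<beta> (- \<gamma>) = 0" "reflect (- \<gamma>) \<beta> = \<beta>"
        | "cartan_int \<beta> (- \<gamma>) = 1" "reflect (- \<gamma>) \<beta> = \<gamma> - - \<beta>" "\<gamma> - - \<beta> \<in> P"
        using key[OF 4(1,2)] by (metis minus_minus)
      then show ?thesis using f 4(3)
        by cases (auto simp: positive_on_def act_def base_coords_def simp del: reflect_uminus)
    qed
  }
qed

text \<open>Lower bounds spread upwards from the simple roots by superadditivity. Upper bounds
  spread downwards from the maximal roots, where positivity of \<open>(- \<gamma>, - 1)\<close> says
  k \<gamma> \<le> 0.\<close>

lemma shi_base_unique:
  assumes k: "shi k" and pos: "\<And>a. a \<in> simple_affine_roots \<Longrightarrow> positive_on k a" and b: "\<beta> \<in> R"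
  shows "k \<beta> = base_coords \<beta>"
proof -
  have nonneg: "k \<alpha> \<ge> 0" if "\<alpha> \<in> P" for \<alpha>
    using that
  proof (induction rule: P_induct)
    case (simple b)
    then show ?case using pos[of "(b, 0)"] by (auto simp: simple_affine_roots_def positive_on_def)
  next
    case (step \<alpha> b)
    moreover have "k b \<ge> 0" using pos[of "(b, 0)"] step by (auto simp: simple_affine_roots_def positive_on_def)
    ultimately show ?case using k P_R[of \<alpha>] B_R[of b] P_R[of "\<alpha> + b"] unfolding shi_def
      by (smt (verit, best))
  qed
  have nonpos: "k \<alpha> \<le> 0" if "\<alpha> \<in> P" for \<alpha>
    using that
  proof (induction "card {\<beta> \<in> P. \<beta> \<bullet> rho > \<alpha> \<bullet> rho}" arbitrary: \<alpha> rule: less_induct)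
    case less
    show ?case
    proof (cases "\<alpha> \<in> maximal_roots")
      case True
      then have "positive_on k (- \<alpha>, - 1)" by (intro pos) (auto simp: simple_affine_roots_def)
      then show ?thesis using shi_uminus[OF k P_R[OF less.prems]] by (simp add: positive_on_def)
    next
      case False
      then obtain \<gamma> where g: "\<gamma> \<in> P" "\<alpha> + \<gamma> \<in> R" using less.prems by (auto simp: maximal_roots_def)
      have "\<alpha> + \<gamma> \<in> P" using P_add less.prems g by blast
      moreover have "\<gamma> \<bullet> rho > 0" using g P_iff P_R by blast
      then have "card {\<beta> \<in> P. \<beta> \<bullet> rho > (\<alpha> + \<gamma>) \<bullet> rho} < card {\<beta> \<in> P. \<beta> \<bullet> rho > \<alpha> \<bullet> rho}"
      proof (intro psubset_card_mono psubsetI)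
        have "\<alpha> + \<gamma> \<in> {\<beta> \<in> P. \<beta> \<bullet> rho > \<alpha> \<bullet> rho}"
          using \<open>\<alpha> + \<gamma> \<in> P\<close> \<open>\<gamma> \<bullet> rho > 0\<close> by (simp add: inner_add_left)
        then show "{\<beta> \<in> P. \<beta> \<bullet> rho > (\<alpha> + \<gamma>) \<bullet> rho} \<noteq> {\<beta> \<in> P. \<beta> \<bullet> rho > \<alpha> \<bullet> rho}" by blast
      qed (use finite_P \<open>\<gamma> \<bullet> rho > 0\<close> in \<open>auto simp: inner_add_left\<close>)
      ultimately have "k (\<alpha> + \<gamma>) \<le> 0" using less.hyps by blast
      moreover have "k \<alpha> + k \<gamma> \<le> k (\<alpha> + \<gamma>)"
        using k g P_R less.prems unfolding shi_def by blast
      ultimately show ?thesis using nonneg[OF g(1)] by linarith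
    qed
  qed
  show ?thesis
  proof (cases "\<beta> \<in> P")
    case True
    then show ?thesis using nonneg nonpos by (force simp: base_coords_def)
  next
    case False
    then have "k (- \<beta>) = 0" using uminus_P_iff[OF b] nonneg nonpos by (meson antisym)
    then show ?thesis using False shi_uminus[OF k b] by (simp add: base_coords_def)
  qed
qed

section \<open>Inversions and Shi's theorem\<close>

lemma finite_inversions: "finite (inversions k)"
proof (rule finite_subset)
  show "inversions k \<subseteq> (SIGMA \<alpha>:R. {k \<alpha>..base_coords \<alpha>})"
    by (auto simp: inversions_def positive_on_def)
qed (use finite_R in auto)

text \<open>\<open>act a\<close> injects the new inversions into the old ones. It misses
  \<open>a\<close>, which is an old inversion, because \<open>a\<close> is the only positive affine
  root that it makes negative.\<close>

lemma inversions_kact: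
  assumes k: "shi k" and a: "a \<in> simple_affine_roots" and neg: "\<not> positive_on k a"
  shows "card (inversions (kact a k)) < card (inversions k)"
proof -
  have aR: "fst a \<in> R" using a simple_affine_in by blast
  have "act a ` inversions (kact a k) \<subseteq> inversions k - {a}"
  proof
    fix h assume "h \<in> act a ` inversions (kact a k)"
    then obtain g where g: "h = act a g" "fst g \<in> R" "positive_on base_coords g" "\<not> positive_on k h"
      by (auto simp: inversions_def positive_on_kact)
    have "g \<noteq> a" using g neg positive_on_uminus[OF k aR] act_self[OF aR] by auto
    then have "positive_on base_coords h" using act_simple_affine a g by blast
    moreover have "h \<noteq> a"
    proof
      assume "h = a"
      then have "g = (- fst a, - snd a)" using act_act[OF aR g(2)] g(1) act_self[OF aR] by simp
      then show False using positive_on_uminus[OF shi_base aR] g(3) simple_affine_positive[OF a] by simp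
    qed
    ultimately show "h \<in> inversions k - {a}" using g act_in[OF aR g(2)] by (simp add: inversions_def)
  qed
  then have "card (act a ` inversions (kact a k)) \<le> card (inversions k - {a})"
    by (intro card_mono) (auto simp: finite_inversions)
  moreover have "inj_on (act a) (inversions (kact a k))"
    by (rule inj_on_inverseI[of _ "act a"]) (use act_act[OF aR] in \<open>auto simp: inversions_def\<close>)
  moreover have "a \<in> inversions k" using neg aR simple_affine_positive[OF a] by (simp add: inversions_def)
  then have "card (inversions k - {a}) < card (inversions k)" by (intro card_Diff1_less finite_inversions)
  ultimately show ?thesis by (simp add: card_image)
qed

text \<open>Shi's theorem: reflecting in a simple affine root that is negative on \<open>k\<close> removes an
  inversion, and only the coordinates of the fundamental alcove have no such root.\<close>

lemma shi_imp_word: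
  assumes "shi k"
  shows "\<exists>as. set as \<subseteq> simple_affine_roots \<and> region k = word as ` A0"
  using assms
proof (induction "card (inversions k)" arbitrary: k rule: less_induct)
  case less
  show ?case
  proof (cases "\<exists>a\<in>simple_affine_roots. \<not> positive_on k a")
    case True
    then obtain a where a: "a \<in> simple_affine_roots" "\<not> positive_on k a" by blast
    then have aR: "fst a \<in> R" using simple_affine_in by blast
    obtain as where as: "set as \<subseteq> simple_affine_roots" "region (kact a k) = word as ` A0"
      using less.hyps[OF inversions_kact] shi_kact[OF aR] less.prems a by blast
    have "region k = region (kact a (kact a k))" by (rule region_cong) (simp add: kact_kact aR)
    also have "\<dots> = word (a # as) ` A0" using region_kact_image[OF aR] as by (simp add: image_comp)
    finally show ?thesis using as a by (intro exI[of _ "a # as"]) simp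
  next
    case False
    then have "region k = A0" using shi_base_unique[OF less.prems] by (intro region_cong) blast
    then show ?thesis by (intro exI[of _ "[]"]) simp
  qed
qed

lemma word_imp_shi: "set as \<subseteq> affine_roots \<Longrightarrow> \<exists>k. shi k \<and> word as ` A0 = region k"
proof (induction as)
  case (Cons a as)
  then obtain k where "shi k" "word as ` A0 = region k" by auto
  moreover have "word (a # as) ` A0 = arefl a ` (word as ` A0)" by auto
  ultimately have "shi (kact a k)" "word (a # as) ` A0 = region (kact a k)"
    using Cons.prems shi_kact region_kact_image[of a k] by simp_all
  then show ?case by blast
qed (use shi_base in auto)

text \<open>Every point off the hyperplanes lies in a region, which is how regions cover space up to
  a null set.\<close>

lemma generic_shi:
  assumes "\<And>\<alpha>. \<alpha> \<in> R \<Longrightarrow> x \<bullet> \<alpha> \<notin> \<int>"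
  shows "shi (\<lambda>\<alpha>. \<lfloor>x \<bullet> \<alpha>\<rfloor>)" "x \<in> region (\<lambda>\<alpha>. \<lfloor>x \<bullet> \<alpha>\<rfloor>)"
proof -
  show "shi (\<lambda>\<alpha>. \<lfloor>x \<bullet> \<alpha>\<rfloor>)"
    unfolding shi_def
  proof (intro conjI ballI impI)
    fix \<alpha> assume "\<alpha> \<in> R"
    then have "x \<bullet> \<alpha> \<noteq> of_int \<lfloor>x \<bullet> \<alpha>\<rfloor>" using assms by (metis Ints_of_int)
    then show "\<lfloor>x \<bullet> - \<alpha>\<rfloor> = - \<lfloor>x \<bullet> \<alpha>\<rfloor> - 1" by simp linarith
  qed (simp_all add: inner_add_right, linarith+)
  show "x \<in> region (\<lambda>\<alpha>. \<lfloor>x \<bullet> \<alpha>\<rfloor>)"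
    unfolding region_def
  proof (intro CollectI ballI)
    fix \<alpha> assume "\<alpha> \<in> R"
    then have "x \<bullet> \<alpha> \<noteq> of_int \<lfloor>x \<bullet> \<alpha>\<rfloor>" using assms by (metis Ints_of_int)
    then show "real_of_int \<lfloor>x \<bullet> \<alpha>\<rfloor> < x \<bullet> \<alpha> \<and> x \<bullet> \<alpha> < real_of_int \<lfloor>x \<bullet> \<alpha>\<rfloor> + 1" by linarith
  qed
qed

definition scale :: nat where "scale = Suc (nat \<lceil>\<Sum>\<alpha>\<in>R. \<bar>\<alpha> \<bullet> rho\<bar>\<rceil>)"
lemma scale_pos: "scale > 0" by (simp only: scale_def zero_less_Suc)

text \<open>Since \<open>scale\<close> exceeds all heights, this point lies in the fundamental
  alcove. Since heights are integers, \<open>scale\<close> times any affine root is an integer at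
  \<open>x0\<close>, which later serves as an induction measure.\<close>

definition x0 :: 'v where "x0 = (1 / real scale) *\<^sub>R rho"

lemma height_less_scale: "\<alpha> \<in> R \<Longrightarrow> \<bar>\<alpha> \<bullet> rho\<bar> < scale"
proof -
  assume "\<alpha> \<in> R"
  then have "\<bar>\<alpha> \<bullet> rho\<bar> \<le> (\<Sum>\<alpha>\<in>R. \<bar>\<alpha> \<bullet> rho\<bar>)" using finite_R by (intro member_le_sum) auto
  also have "\<dots> < scale" unfolding scale_def by linarith
  finally show ?thesis .
qed

lemma x0_A0: "x0 \<in> A0"
  unfolding region_def
proof (intro CollectI ballI)
  fix \<alpha> assume a: "\<alpha> \<in> R"
  have s: "real scale > 0" using scale_pos by simp
  have "\<bar>\<alpha> \<bullet> rho\<bar> < scale" using height_less_scale a by blast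
  then show "of_int (base_coords \<alpha>) < x0 \<bullet> \<alpha> \<and> x0 \<bullet> \<alpha> < of_int (base_coords \<alpha>) + 1"
    using s P_iff[OF a] height_nonzero[OF a]
    by (auto simp: x0_def base_coords_def inner_commute field_simps)
qed

text \<open>The deletion property: a word whose gallery crosses the wall \<open>f\<close> can be shortened by the
  letter \<open>a\<close> after composing it with the reflection in \<open>f\<close>.\<close>

lemma word_crossing:
  assumes "fst f \<in> R" "positive_on base_coords f" "set bs \<subseteq> simple_affine_roots"
    and "aval f (word bs x0) < 0"
  shows "\<exists>us a vs. bs = us @ a # vs \<and> arefl f \<circ> word us \<circ> arefl a = word us"
  using assms
proof (induction bs arbitrary: f)
  case Nil
  then show ?case using positive_on_region(1)[OF x0_A0] by fastforce
next
  case (Cons b bs)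
  have bR: "fst b \<in> R" using Cons.prems simple_affine_in by auto
  show ?case
  proof (cases "f = b")
    case True
    then show ?thesis by (intro exI[of _ "[]"]) (auto simp: fun_eq_iff)
  next
    case False
    \<comment> \<open>The first letter is undone on the wall instead of on the point. As
      \<open>f\<close> differs from \<open>b\<close>, the transported affine root stays positive and
      the induction hypothesis applies to it.\<close>
    have "positive_on base_coords (act b f)" using Cons.prems False act_simple_affine by auto
    moreover have "aval (act b f) (word bs x0) < 0" using Cons.prems aval_act[OF bR Cons.prems(1)] by simp
    moreover have "fst (act b f) \<in> R" "set bs \<subseteq> simple_affine_roots" using Cons.prems act_in[OF bR] by auto
    ultimately obtain us a vs where *: "bs = us @ a # vs" "arefl (act b f) \<circ> word us \<circ> arefl a = word us"
      using Cons.IH[of "act b f"] by blast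
    have "arefl f (arefl b (word us (arefl a y))) = arefl b (word us y)" for y
      using fun_cong[OF *(2), of y] arefl_act[OF bR Cons.prems(1)] by (metis arefl_arefl comp_apply)
    then show ?thesis using *(1) by (intro exI[of _ "b # us"]) (auto simp: fun_eq_iff)
  qed
qed

lemma stabilizer_trivial_aux:
  assumes "set as \<subseteq> simple_affine_roots" "word as x0 \<in> A0"
  shows "word as = id"
  using assms
proof (induction "length as" arbitrary: as rule: less_induct)
  case less
  show ?case
  proof (cases as)
    case (Cons a bs)
    have a: "a \<in> simple_affine_roots" "fst a \<in> R" "set bs \<subseteq> simple_affine_roots"
      using less.prems Cons simple_affine_in by auto
    have "aval a (word as x0) > 0"
      using positive_on_region(1)[OF less.prems(2) a(2) simple_affine_positive] a by blast
    then have "aval a (word bs x0) < 0" using Cons aval_arefl_self[of a] R_nonzero a by simp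
    then obtain us c vs where *: "bs = us @ c # vs" "arefl a \<circ> word us \<circ> arefl c = word us"
      using word_crossing simple_affine_positive a by blast
    have "word as = (arefl a \<circ> word us \<circ> arefl c) \<circ> word vs"
      by (simp add: Cons *(1) word_append comp_assoc)
    also have "\<dots> = word (us @ vs)" by (simp only: *(2) word_append)
    finally have eq: "word as = word (us @ vs)" .
    moreover have "word (us @ vs) = id"
    proof (rule less.hyps)
      show "length (us @ vs) < length as" by (simp add: Cons *(1))
      show "word (us @ vs) x0 \<in> A0" using less.prems(2) unfolding eq .
      show "set (us @ vs) \<subseteq> simple_affine_roots" using a(3) *(1) by simp
    qed
    ultimately show ?thesis by simp
  qed simp
qed

text \<open>Some simple affine root \<open>a\<close> is negative on the reflected alcove.
  Conjugating by \<open>arefl a\<close> strictly lowers the positive value of \<open>f\<close> at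
  \<open>x0\<close>, and by the choice of \<open>scale\<close> this can happen only finitely
  often.\<close>

lemma arefl_simple_word:
  assumes "fst f \<in> R" "positive_on base_coords f"
  shows "\<exists>as. set as \<subseteq> simple_affine_roots \<and> arefl f = word as"
  using assms
proof (induction "nat \<lfloor>scale * aval f x0\<rfloor>" arbitrary: f rule: less_induct)
  case less
  note f = less.prems
  have s: "real scale > 0" using scale_pos by simp
  have int: "scale * aval g x0 \<in> \<int>" if "fst g \<in> R" for g
    using s height_Ints[OF that] by (simp add: aval_def x0_def algebra_simps inner_commute)
  have fpos: "aval f x0 > 0" using positive_on_region(1)[OF x0_A0] f by blast
  show ?case
  proof (cases "f \<in> simple_affine_roots")
    case True
    then show ?thesis by (intro exI[of _ "[f]"]) auto
  next
    case False
    obtain k where k: "shi k" "arefl f ` A0 = region k"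
      using word_imp_shi[of "[f]"] f by auto
    have xk: "arefl f x0 \<in> region k" using k x0_A0 by auto
    have "\<exists>a\<in>simple_affine_roots. \<not> positive_on k a"
    proof (rule ccontr)
      assume "\<not> ?thesis"
      then have "region k = A0" using shi_base_unique[OF k(1)] by (intro region_cong) blast
      then have "aval f (arefl f x0) > 0" using positive_on_region(1) xk f by blast
      then show False using fpos aval_arefl_self[of f] R_nonzero f by simp
    qed
    then obtain a where a: "a \<in> simple_affine_roots" "\<not> positive_on k a" by blast
    have aR: "fst a \<in> R" using a simple_affine_in by blast
    have apos: "aval a x0 > 0" using positive_on_region(1)[OF x0_A0 aR] simple_affine_positive a by blast
    have "aval a (arefl f x0) < 0" using positive_on_region(2)[OF xk aR] a by blast
    \<comment> \<open>Both values at \<open>x0\<close> are positive, so this inequality forces a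
      positive pairing of the two directions; hence the value drops in passing from \<open>f\<close>
      to \<open>act a f\<close>.\<close>
    then have "aval a x0 < aval f x0 * (coroot (fst f) \<bullet> fst a)"
      by (simp add: arefl_def aval_def inner_diff_left)
    then have "coroot (fst f) \<bullet> fst a > 0" using apos fpos by (smt (verit) mult_pos_neg zero_less_mult_iff)
    then have "fst f \<bullet> fst a > 0" using inner_self_pos[OF f(1)]
      by (simp add: coroot_def zero_less_divide_iff zero_less_mult_iff)
    then have ip: "coroot (fst a) \<bullet> fst f > 0" using inner_self_pos[OF aR]
      by (simp add: coroot_def inner_commute)
    define g where "g = act a f"
    have g: "fst g \<in> R" "positive_on base_coords g" 
      using act_in[OF aR f(1)] act_simple_affine[OF a(1) f] False a by (auto simp: g_def)
    have gpos: "aval g x0 > 0" using positive_on_region(1)[OF x0_A0] g by blast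
    have "aval g x0 = aval f x0 - aval a x0 * (coroot (fst a) \<bullet> fst f)"
      unfolding g_def aval_act[OF aR f(1)] by (simp add: arefl_def aval_def inner_diff_left)
    then have "aval g x0 < aval f x0" using apos ip by simp
    then have "scale * aval g x0 < scale * aval f x0" using s by simp
    moreover obtain i j where "scale * aval g x0 = of_int i" "scale * aval f x0 = of_int j"
      using int g(1) f(1) by (meson Ints_cases)
    moreover have "scale * aval g x0 > 0" using gpos s by simp
    ultimately have "nat \<lfloor>scale * aval g x0\<rfloor> < nat \<lfloor>scale * aval f x0\<rfloor>" by simp
    then obtain as where as: "set as \<subseteq> simple_affine_roots" "arefl g = word as"
      using less.hyps g by blast
    have "act a g = f" by (simp add: g_def act_act aR f)
    then have "arefl f = arefl a \<circ> arefl g \<circ> arefl a" using arefl_act[OF aR g(1)] by simp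
    also have "\<dots> = word (a # as @ [a])" by (simp add: as word_append comp_assoc)
    finally show ?thesis using as a by (intro exI[of _ "a # as @ [a]"]) auto
  qed
qed

lemma word_simple:
  assumes "set as \<subseteq> affine_roots"
  shows "\<exists>bs. set bs \<subseteq> simple_affine_roots \<and> word as = word bs"
  using assms
proof (induction as)
  case Nil
  then show ?case by (intro exI[of _ "[]"]) simp
next
  case (Cons a as)
  then obtain bs where bs: "set bs \<subseteq> simple_affine_roots" "word as = word bs" by auto
  have aR: "fst a \<in> R" using Cons.prems by simp
  obtain cs where cs: "set cs \<subseteq> simple_affine_roots" "arefl a = word cs"
  proof (cases "positive_on base_coords a")
    case True
    then show ?thesis using that arefl_simple_word aR by blast
  next
    case False
    then have "positive_on base_coords (- fst a, - snd a)" using positive_on_uminus[OF shi_base aR] by blast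
    then show ?thesis using that arefl_simple_word[of "(- fst a, - snd a)"] aR by (auto simp: arefl_uminus)
  qed
  have "word (a # as) = word (cs @ bs)" by (simp add: word_append bs cs)
  then show ?case using bs cs by (intro exI[of _ "cs @ bs"]) auto
qed

lemma word_stabilizer:
  assumes "set as \<subseteq> affine_roots" "word as ` A0 = A0" shows "word as = id"
proof -
  obtain bs where "set bs \<subseteq> simple_affine_roots" "word as = word bs" using word_simple assms by blast
  then show ?thesis using stabilizer_trivial_aux[of bs] assms x0_A0 by auto
qed

text \<open>A point determines the coordinates of its region, so two alcoves that meet coincide. The
  quotient of the two words then stabilizes the fundamental alcove.\<close>

lemma word_free:
  assumes as: "set as \<subseteq> affine_roots" and bs: "set bs \<subseteq> affine_roots"
    and x: "x \<in> word as ` A0" "x \<in> word bs ` A0"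
  shows "word as = word bs"
proof -
  obtain k l where kl: "word as ` A0 = region k" "word bs ` A0 = region l"
    using word_imp_shi as bs by metis
  then have "region k = region l" using region_unique x by (metis region_cong)
  then have "word (rev bs @ as) ` A0 = word (rev bs) ` word bs ` A0"
    using kl by (metis image_comp word_append)
  also have "\<dots> = A0" by (simp add: image_image word_rev)
  finally have "word (rev bs @ as) = id" using word_stabilizer[of "rev bs @ as"] as bs by auto
  then have "word bs (word (rev bs) (word as y)) = word bs y" for y
    by (simp add: word_append fun_eq_iff)
  then show ?thesis by (simp add: word_rev fun_eq_iff)
qed

end

section \<open>Volumes under linear maps and tilings\<close>

lemma nn_integral_lborel_translate:
  fixes f :: "'a::euclidean_space \<Rightarrow> ennreal"
  assumes [measurable]: "f \<in> borel_measurable borel"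
  shows "(\<integral>\<^sup>+x. f (c + x) \<partial>lborel) = (\<integral>\<^sup>+x. f x \<partial>lborel)"
proof -
  have "(\<integral>\<^sup>+x. f x \<partial>lborel) = (\<integral>\<^sup>+x. f x \<partial>distr lborel borel ((+) c))"
    by (simp add: lborel_distr_plus)
  also have "\<dots> = (\<integral>\<^sup>+x. f (c + x) \<partial>lborel)"
    by (rule nn_integral_distr) auto
  finally show ?thesis ..
qed

lemma emeasure_lborel_translate:
  fixes S :: "'a::euclidean_space set"
  assumes [measurable]: "S \<in> sets borel"
  shows "emeasure lborel {x. c + x \<in> S} = emeasure lborel S"
proof -
  have "emeasure lborel S = emeasure (distr lborel borel ((+) c)) S" by (simp add: lborel_distr_plus)
  also have "\<dots> = emeasure lborel {x. c + x \<in> S}" by (subst emeasure_distr) (auto simp: vimage_def)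
  finally show ?thesis ..
qed

text \<open>Uniqueness of the translation invariant measure, by exchanging the order of integration in
  \<open>\<integral>\<integral> 1\<^sub>E(g x) 1\<^sub>D(y - g x) dy dx\<close> for the unit ball \<open>D\<close>.\<close>

lemma linear_vimage_scaling:
  fixes g :: "'a::euclidean_space \<Rightarrow> 'a"
  assumes "linear g" "inj g"
  obtains c :: real where "c > 0"
    and "\<And>S. S \<in> sets borel \<Longrightarrow> emeasure lborel {x. g x \<in> S} = ennreal c * emeasure lborel S"
proof -
  have main: "\<exists>c::real. c \<ge> 0 \<and> (\<forall>E\<in>sets borel. emeasure lborel {x. g x \<in> E} = ennreal c * emeasure lborel E)"
    if lin: "linear g" and inv: "linear h" "\<And>x. g (h x) = x" "\<And>x. h (g x) = x" for g h :: "'a \<Rightarrow> 'a"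
  proof -
    define D where "D = ball (0::'a) 1"
    have [measurable]: "g \<in> borel_measurable borel" "h \<in> borel_measurable borel" "D \<in> sets borel"
      using lin inv by (auto intro!: borel_measurable_continuous_onI linear_continuous_on linear_linear[THEN iffD2] simp: D_def)
    have Dpos: "emeasure lborel D > 0" "emeasure lborel D < \<infinity>"
      using content_ball_pos[of 1 "0::'a"] emeasure_lborel_ball_finite[of "0::'a" 1]
      by (auto simp: D_def measure_def enn2real_positive_iff)
    \<comment> \<open>The candidate factor is this volume divided by that of \<open>D\<close>. It is
      finite because the set lies in the image of a ball under the inverse map.\<close>
    define d where "d = emeasure lborel {x. - g x \<in> D}"
    have "bounded (h ` uminus ` D)"
      unfolding D_def by (intro bounded_linear_image linear_linear[THEN iffD2] inv) (simp_all add: linear_iff)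
    moreover have "{x. - g x \<in> D} \<subseteq> h ` uminus ` D" 
      using inv by (auto simp: image_iff) (metis minus_minus)
    ultimately have "bounded {x. - g x \<in> D}" by (rule bounded_subset)
    then have dfin: "d < \<infinity>" unfolding d_def by (rule emeasure_bounded_finite)
    have key: "emeasure lborel {x. g x \<in> E} * emeasure lborel D = d * emeasure lborel E" if [measurable]: "E \<in> sets borel" for E
    proof -
      have "emeasure lborel {x. g x \<in> E} * emeasure lborel D
          = (\<integral>\<^sup>+x. indicator E (g x) * (\<integral>\<^sup>+y. indicator D (- g x + y) \<partial>lborel) \<partial>lborel)"
      proof -
        have "(\<integral>\<^sup>+y. indicator D (- g x + y) \<partial>lborel) = emeasure lborel D" for x
          by (subst nn_integral_lborel_translate) auto
        then have "(\<integral>\<^sup>+x. indicator E (g x) * (\<integral>\<^sup>+y. indicator D (- g x + y) \<partial>lborel) \<partial>lborel)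
            = (\<integral>\<^sup>+x. indicator {x. g x \<in> E} x \<partial>lborel) * emeasure lborel D"
          by (subst nn_integral_multc[symmetric]) (auto intro!: nn_integral_cong simp: indicator_def)
        then show ?thesis by simp
      qed
      also have "\<dots> = (\<integral>\<^sup>+x. \<integral>\<^sup>+y. indicator E (g x) * indicator D (- g x + y) \<partial>lborel \<partial>lborel)"
        by (intro nn_integral_cong nn_integral_cmult[symmetric]) auto
      also have "\<dots> = (\<integral>\<^sup>+y. \<integral>\<^sup>+x. indicator E (g x) * indicator D (- g x + y) \<partial>lborel \<partial>lborel)"
        by (rule lborel_pair.Fubini') simp
      also have "\<dots> = (\<integral>\<^sup>+y. \<integral>\<^sup>+x. indicator E (g x + y) * indicator D (- g x) \<partial>lborel \<partial>lborel)"
      proof (rule nn_integral_cong)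
        \<comment> \<open>Substituting h y + x for x replaces g x by y + g x, which moves y from the
          factor of D to the factor of E.\<close>
        fix y
        have "(\<integral>\<^sup>+x. indicator E (g x) * indicator D (- g x + y) \<partial>lborel)
            = (\<integral>\<^sup>+x. indicator E (g (h y + x)) * indicator D (- g (h y + x) + y) \<partial>lborel)"
          by (rule nn_integral_lborel_translate[symmetric]) measurable
        then show "(\<integral>\<^sup>+x. indicator E (g x) * indicator D (- g x + y) \<partial>lborel)
            = (\<integral>\<^sup>+x. indicator E (g x + y) * indicator D (- g x) \<partial>lborel)"
          using inv by (simp add: linear_add[OF lin] add.commute)
      qed
      also have "\<dots> = (\<integral>\<^sup>+x. \<integral>\<^sup>+y. indicator E (g x + y) * indicator D (- g x) \<partial>lborel \<partial>lborel)"
        by (rule lborel_pair.Fubini') simp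
      also have "\<dots> = (\<integral>\<^sup>+x. (\<integral>\<^sup>+y. indicator E (g x + y) \<partial>lborel) * indicator D (- g x) \<partial>lborel)"
        by (intro nn_integral_cong nn_integral_multc) auto
      also have "\<dots> = (\<integral>\<^sup>+x. emeasure lborel E * indicator {x. - g x \<in> D} x \<partial>lborel)"
        by (intro nn_integral_cong) (subst nn_integral_lborel_translate, auto simp: indicator_def)
      also have "\<dots> = d * emeasure lborel E"
        by (simp add: nn_integral_cmult d_def mult.commute)
      finally show ?thesis .
    qed
    define c where "c = enn2real d / measure lborel D"
    have "emeasure lborel {x. g x \<in> E} = ennreal c * emeasure lborel E" if "E \<in> sets borel" for E
    proof -
      obtain r where r: "emeasure lborel D = ennreal r" "r > 0"
        using Dpos by (cases "emeasure lborel D") auto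
      obtain s where s: "d = ennreal s" "s \<ge> 0" using dfin by (cases d) auto
      have c: "c = s / r" using r s by (simp add: c_def measure_def)
      have "emeasure lborel {x. g x \<in> E} * ennreal r = (ennreal c * ennreal r) * emeasure lborel E"
        using key[OF that] r s by (simp add: c flip: ennreal_mult)
      then have "emeasure lborel {x. g x \<in> E} * ennreal r = (ennreal c * emeasure lborel E) * ennreal r"
        by (simp add: ac_simps)
      then have "ennreal r * emeasure lborel {x. g x \<in> E} = ennreal r * (ennreal c * emeasure lborel E)"
        by (simp add: ac_simps)
      then show ?thesis using r(2) unfolding ennreal_mult_cancel_left by auto
    qed
    moreover have "c \<ge> 0" by (simp add: c_def)
    ultimately show ?thesis by blast
  qed
  obtain h where h: "linear h" "h \<circ> g = id" using linear_injective_left_inverse[OF assms] by blast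
  then have hg: "h (g x) = x" for x by (simp add: fun_eq_iff)
  have gh: "g (h x) = x" for x
    using h assms linear_injective_imp_surjective[OF assms] by (metis hg surjD)
  obtain c where c: "c \<ge> 0" "\<forall>E\<in>sets borel. emeasure lborel {x. g x \<in> E} = ennreal c * emeasure lborel E"
    using main[OF assms(1) h(1) gh hg] by blast
  obtain d where d: "d \<ge> 0" "\<forall>E\<in>sets borel. emeasure lborel {x. h x \<in> E} = ennreal d * emeasure lborel E"
    using main[OF h(1) assms(1) hg gh] by blast
  \<comment> \<open>The preimage under \<open>g\<close> of this set is the unit ball, of positive
    volume, so the factor \<open>c\<close> cannot vanish.\<close>
  have "emeasure lborel {x. g x \<in> {y. h y \<in> ball 0 1}} = emeasure lborel (ball (0::'a) 1)"
    by (simp only: hg mem_Collect_eq Collect_mem_eq)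
  moreover have [measurable]: "h \<in> borel_measurable borel"
    using h by (auto intro!: borel_measurable_continuous_onI linear_continuous_on linear_linear[THEN iffD2])
  have "h -` ball 0 1 \<inter> space borel \<in> sets borel"
    by (rule measurable_sets[where A = borel]) auto
  then have "{y. h y \<in> ball 0 1} \<in> sets borel" by (simp add: vimage_def)
  moreover have "emeasure lborel (ball (0::'a) 1) > 0"
    using content_ball_pos[of 1 "0::'a"] by (auto simp: measure_def enn2real_positive_iff)
  ultimately have "c \<noteq> 0" using c by force
  then show ?thesis using c that[of c] by auto
qed

text \<open>Countably many hyperplanes form a null set, so walls of alcoves may be ignored in volume
  comparisons.\<close>

lemma emeasure_eq_hyperplanes:
  fixes X Y :: "'a::euclidean_space set"
  assumes X: "X \<in> sets borel" and Y: "Y \<in> sets borel" and I: "countable I"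
    and a: "\<And>i. i \<in> I \<Longrightarrow> a i \<noteq> 0"
    and eq: "\<And>x. (\<And>i. i \<in> I \<Longrightarrow> x \<bullet> a i \<noteq> c i) \<Longrightarrow> x \<in> X \<longleftrightarrow> x \<in> Y"
  shows "emeasure lborel X = emeasure lborel Y"
proof (rule emeasure_eq_AE)
  have "AE x in lborel. x \<bullet> a i \<noteq> c i" if "i \<in> I" for i
  proof (rule AE_I)
    have "{x. x \<bullet> a i = c i} \<in> null_sets lebesgue"
      using negligible_hyperplane[of "a i" "c i"] a[OF that]
      by (simp add: negligible_iff_null_sets inner_commute)
    moreover have *: "{x. x \<bullet> a i = c i} \<in> sets lborel" by measurable
    ultimately show "emeasure lborel {x. x \<bullet> a i = c i} = 0"
      by (auto simp: null_sets_completion_iff)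
    show "{x. x \<bullet> a i = c i} \<in> sets lborel" by (rule *)
  qed auto
  then have "AE x in lborel. \<forall>i\<in>I. x \<bullet> a i \<noteq> c i" using I by (simp add: AE_ball_countable)
  then show "AE x in lborel. x \<in> X \<longleftrightarrow> x \<in> Y" by eventually_elim (use eq in blast)
qed (use X Y in auto)

text \<open>\<open>D\<close> and \<open>E\<close> are fundamental domains for the translations
  \<open>T\<close>, the second one only up to hyperplanes. Cutting \<open>D\<close> along the
  translates of \<open>E\<close> and shifting each piece back reassembles \<open>E\<close>.\<close>

lemma tile_volume_eq:
  fixes D E T :: "'a::euclidean_space set"
  assumes [measurable]: "D \<in> sets borel" "E \<in> sets borel"
    and T: "countable T"
    and D: "\<And>x. \<exists>!t. t \<in> T \<and> t + x \<in> D"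
    and E: "\<And>x s t. s \<in> T \<Longrightarrow> t \<in> T \<Longrightarrow> x - s \<in> E \<Longrightarrow> x - t \<in> E \<Longrightarrow> s = t"
    and I: "countable I" "\<And>i. i \<in> I \<Longrightarrow> a i \<noteq> 0"
    and cov: "\<And>x. (\<And>i. i \<in> I \<Longrightarrow> x \<bullet> a i \<noteq> c i) \<Longrightarrow> \<exists>t\<in>T. x - t \<in> E"
  shows "emeasure lborel D = emeasure lborel E"
proof -
  have "emeasure lborel D = emeasure lborel (\<Union>t\<in>T. {x \<in> D. x - t \<in> E})"
    by (rule emeasure_eq_hyperplanes[OF _ _ I, where c = c]) (use cov T in auto)
  also have "\<dots> = (\<integral>\<^sup>+t. emeasure lborel {x \<in> D. x - t \<in> E} \<partial>count_space T)"
    by (rule emeasure_UN_countable) (use T E in \<open>auto simp: disjoint_family_on_def\<close>)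
  also have "\<dots> = (\<integral>\<^sup>+t. emeasure lborel {x \<in> E. t + x \<in> D} \<partial>count_space T)"
  proof (rule nn_integral_cong)
    fix t
    have "emeasure lborel {x \<in> D. x - t \<in> E} = emeasure lborel {x. t + x \<in> {x \<in> D. x - t \<in> E}}"
      by (rule emeasure_lborel_translate[symmetric]) measurable
    then show "emeasure lborel {x \<in> D. x - t \<in> E} = emeasure lborel {x \<in> E. t + x \<in> D}"
      by (simp add: conj_commute)
  qed
  also have "\<dots> = emeasure lborel (\<Union>t\<in>T. {x \<in> E. t + x \<in> D})"
    by (rule emeasure_UN_countable[symmetric]) (use T D in \<open>auto simp: disjoint_family_on_def\<close>)
  also have "(\<Union>t\<in>T. {x \<in> E. t + x \<in> D}) = E" using D by blast
  finally show ?thesis .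
qed

section \<open>Volumes of boxes and simplices in a linear frame\<close>

lemma emeasure_between_box:
  fixes S :: "'a::euclidean_space set"
  assumes "S \<in> sets borel" "box a b \<subseteq> S" "S \<subseteq> cbox a b"
  shows "emeasure lborel S = emeasure lborel (box a b)"
proof (rule antisym)
  have "emeasure lborel S \<le> emeasure lborel (cbox a b)" using assms by (intro emeasure_mono) auto
  then show "emeasure lborel S \<le> emeasure lborel (box a b)"
    by (simp add: emeasure_lborel_box_eq emeasure_lborel_cbox_eq)
qed (use assms in \<open>auto intro: emeasure_mono\<close>)

text \<open>The frontier of a convex set is null, so the open simplex has the volume of the closed
  one.\<close>

lemma emeasure_open_simplex:
  "emeasure lborel {x::'a::euclidean_space. (\<forall>i\<in>Basis. 0 < x \<bullet> i) \<and> (\<Sum>i\<in>Basis. x \<bullet> i) < 1} =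
     ennreal (1 / fact DIM('a))"
proof -
  let ?S = "convex hull (insert 0 (Basis::'a set))"
  have cl: "closed ?S" by (intro compact_imp_closed finite_imp_compact_convex_hull) simp
  have "negligible (frontier ?S)" by (intro negligible_convex_frontier convex_convex_hull)
  then have "frontier ?S \<in> null_sets lborel"
    by (simp add: negligible_iff_null_sets null_sets_completion_iff)
  then have "AE x in lborel. x \<notin> frontier ?S" by (rule AE_not_in)
  then have "AE x in lborel. x \<in> interior ?S \<longleftrightarrow> x \<in> ?S"
    by eventually_elim (use cl interior_subset in \<open>auto simp: frontier_def\<close>)
  then have "emeasure lborel (interior ?S) = emeasure lborel ?S"
    by (intro emeasure_eq_AE) (use cl in auto)
  then show ?thesis unfolding interior_std_simplex emeasure_std_simplex .
qed

text \<open>The point is that one constant \<kappa> serves open boxes, half-open boxes and simplices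
  alike; it is the inverse absolute determinant of the frame, but only ratios in which it cancels
  are used.\<close>

lemma linear_frame_volume:
  fixes d :: "'b \<Rightarrow> 'a::euclidean_space"
  assumes fin: "finite B" and card: "card B = DIM('a)" and sep: "\<And>y. (\<And>b. b \<in> B \<Longrightarrow> y \<bullet> d b = 0) \<Longrightarrow> y = 0"
  obtains \<kappa> :: real where "\<kappa> > 0"
    and "\<And>r. (\<And>b. b \<in> B \<Longrightarrow> r b > 0) \<Longrightarrow>
      emeasure lborel {y. \<forall>b\<in>B. 0 < y \<bullet> d b \<and> y \<bullet> d b < r b} = ennreal (\<kappa> * (\<Prod>b\<in>B. r b))"
    and "\<And>r. (\<And>b. b \<in> B \<Longrightarrow> r b > 0) \<Longrightarrow>
      emeasure lborel {y. \<forall>b\<in>B. 0 \<le> y \<bullet> d b \<and> y \<bullet> d b < r b} = ennreal (\<kappa> * (\<Prod>b\<in>B. r b))"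
    and "\<And>c. (\<And>b. b \<in> B \<Longrightarrow> c b > 0) \<Longrightarrow>
      emeasure lborel {y. (\<forall>b\<in>B. 0 < y \<bullet> d b) \<and> (\<Sum>b\<in>B. c b * (y \<bullet> d b)) < 1} =
        ennreal (\<kappa> * (1 / (fact (card B) * (\<Prod>b\<in>B. c b))))"
proof -
  obtain \<sigma> where \<sigma>: "bij_betw \<sigma> B (Basis::'a set)"
    using fin card finite_same_card_bij[of B "Basis::'a set"] by auto
  have \<sigma>B: "\<sigma> b \<in> Basis" if "b \<in> B" for b using \<sigma> that by (auto simp: bij_betw_def)
  have \<sigma>eq: "\<sigma> b \<bullet> \<sigma> b' = (if b = b' then 1 else 0)" if "b \<in> B" "b' \<in> B" for b b'
    using \<sigma> \<sigma>B that by (auto simp: inner_Basis bij_betw_def inj_on_def)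
  have allB: "(\<forall>b\<in>B. Q (\<sigma> b)) \<longleftrightarrow> (\<forall>i\<in>Basis. Q i)" for Q
    using \<sigma> unfolding bij_betw_def by (metis imageE image_eqI)
  \<comment> \<open>The scaled functionals become the standard coordinates, so that all shapes are
    preimages of standard ones.\<close>
  define G where "G s y = (\<Sum>b\<in>B. (s b * (y \<bullet> d b)) *\<^sub>R \<sigma> b)" for s :: "'b \<Rightarrow> real" and y
  have G: "G s y \<bullet> \<sigma> b = s b * (y \<bullet> d b)" if "b \<in> B" for s y b
  proof -
    have "G s y \<bullet> \<sigma> b = (\<Sum>b'\<in>B. if b' = b then s b' * (y \<bullet> d b') else 0)"
      unfolding G_def inner_sum_left by (intro sum.cong) (use \<sigma>eq that in auto)
    then show ?thesis using fin that by simp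
  qed
  have linG: "linear (G s)" for s
    unfolding G_def by (intro linearI) (simp_all add: algebra_simps inner_add_left sum.distrib scaleR_sum_right)
  have injG: "inj (G s)" if "\<And>b. b \<in> B \<Longrightarrow> s b > 0" for s
    unfolding linear_injective_0[OF linG]
  proof (intro allI impI sep)
    fix y b assume "G s y = 0" "b \<in> B"
    then have "s b * (y \<bullet> d b) = 0" using G[of b s y] by simp
    then show "y \<bullet> d b = 0" using that[OF \<open>b \<in> B\<close>] by simp
  qed
  obtain \<kappa> where \<kappa>: "\<kappa> > 0" "\<And>S. S \<in> sets borel \<Longrightarrow> emeasure lborel {y. G (\<lambda>_. 1) y \<in> S} = ennreal \<kappa> * emeasure lborel S"
    by (rule linear_vimage_scaling[OF linG injG[of "\<lambda>_. 1"]]) auto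
  have scaled: "emeasure lborel {y. G s y \<in> S} = ennreal (\<kappa> * (\<Prod>b\<in>B. 1 / s b)) * emeasure lborel S"
    if s: "\<And>b. b \<in> B \<Longrightarrow> s b > 0" and S: "S \<in> sets borel" for s S
  proof -
    obtain \<mu> where \<mu>: "\<mu> > 0" "\<And>S. S \<in> sets borel \<Longrightarrow> emeasure lborel {y. G s y \<in> S} = ennreal \<mu> * emeasure lborel S"
      by (rule linear_vimage_scaling[OF linG injG[OF s]]) auto
    define v where "v = (\<Sum>b\<in>B. (1 / s b) *\<^sub>R \<sigma> b)"
    have v: "v \<bullet> \<sigma> b = 1 / s b" if "b \<in> B" for b
    proof -
      have "v \<bullet> \<sigma> b = (\<Sum>b'\<in>B. if b' = b then 1 / s b' else 0)"
        unfolding v_def inner_sum_left by (intro sum.cong) (use \<sigma>eq that in auto)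
      then show ?thesis using fin that by simp
    qed
    \<comment> \<open>Evaluating both maps on this one set determines the factor \<mu> in terms of
      \<kappa>: the preimage of the unit box under \<open>G s\<close> is the preimage under the
      unscaled map of a box with sides 1 / s b.\<close>
    have "G s y \<in> box 0 One \<longleftrightarrow> G (\<lambda>_. 1) y \<in> box 0 v" for y
      unfolding mem_box allB[symmetric]
    proof (intro ball_cong refl)
      fix b assume b: "b \<in> B"
      show "0 \<bullet> \<sigma> b < G s y \<bullet> \<sigma> b \<and> G s y \<bullet> \<sigma> b < One \<bullet> \<sigma> b \<longleftrightarrow>
          0 \<bullet> \<sigma> b < G (\<lambda>_. 1) y \<bullet> \<sigma> b \<and> G (\<lambda>_. 1) y \<bullet> \<sigma> b < v \<bullet> \<sigma> b"
        using s[OF b] b by (auto simp: v G \<sigma>B zero_less_mult_iff field_simps)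
    qed
    then have "emeasure lborel {y. G s y \<in> box 0 One} = emeasure lborel {y. G (\<lambda>_. 1) y \<in> box 0 v}" by simp
    then have "ennreal \<mu> * emeasure lborel (box (0::'a) One) = ennreal \<kappa> * emeasure lborel (box 0 v)"
      using \<mu>(2)[of "box 0 One"] \<kappa>(2)[of "box 0 v"] by simp
    moreover have "emeasure lborel (box 0 v) = ennreal (\<Prod>b\<in>B. 1 / s b)"
    proof -
      have "\<forall>i\<in>Basis. 0 \<le> v \<bullet> i" unfolding allB[symmetric] using v s by (simp add: less_imp_le)
      then have "emeasure lborel (box 0 v) = ennreal (\<Prod>i\<in>Basis. v \<bullet> i)"
        by (subst emeasure_lborel_box) auto
      also have "(\<Prod>i\<in>Basis. v \<bullet> i) = (\<Prod>b\<in>B. v \<bullet> \<sigma> b)" by (rule prod.reindex_bij_betw[OF \<sigma>, symmetric])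
      finally show ?thesis using v by simp
    qed
    moreover have "emeasure lborel (box (0::'a) One) = 1" by (subst emeasure_lborel_box) auto
    ultimately have "ennreal \<mu> = ennreal (\<kappa> * (\<Prod>b\<in>B. 1 / s b))"
      using \<kappa>(1) s by (simp add: ennreal_mult prod_nonneg less_imp_le)
    then show ?thesis using \<mu>(2)[OF S] by simp
  qed
  show ?thesis
  proof (rule that[OF \<kappa>(1)])
    fix r :: "'b \<Rightarrow> real" assume r: "\<And>b. b \<in> B \<Longrightarrow> r b > 0"
    have r': "1 / r b > 0" if "b \<in> B" for b using r that by simp
    have "y \<in> {y. \<forall>b\<in>B. 0 < y \<bullet> d b \<and> y \<bullet> d b < r b} \<longleftrightarrow> G (\<lambda>b. 1 / r b) y \<in> box 0 One" for y
      unfolding mem_box allB[symmetric] mem_Collect_eq using r by (intro ball_cong refl) (simp add: G \<sigma>B field_simps)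
    then have "{y. \<forall>b\<in>B. 0 < y \<bullet> d b \<and> y \<bullet> d b < r b} = {y. G (\<lambda>b. 1 / r b) y \<in> box 0 One}" by blast
    then show "emeasure lborel {y. \<forall>b\<in>B. 0 < y \<bullet> d b \<and> y \<bullet> d b < r b} = ennreal (\<kappa> * (\<Prod>b\<in>B. r b))"
      using scaled[where s = "\<lambda>b. 1 / r b" and S = "box 0 One"] r' by (simp add: emeasure_lborel_box_eq)
    let ?H = "{z::'a. \<forall>i\<in>Basis. 0 \<le> z \<bullet> i \<and> z \<bullet> i < 1}"
    have H: "?H \<in> sets borel" by measurable
    have "y \<in> {y. \<forall>b\<in>B. 0 \<le> y \<bullet> d b \<and> y \<bullet> d b < r b} \<longleftrightarrow> G (\<lambda>b. 1 / r b) y \<in> ?H" for y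
      unfolding mem_Collect_eq allB[symmetric] using r by (intro ball_cong refl) (simp add: G field_simps)
    then have "{y. \<forall>b\<in>B. 0 \<le> y \<bullet> d b \<and> y \<bullet> d b < r b} = {y. G (\<lambda>b. 1 / r b) y \<in> ?H}" by blast
    moreover have "emeasure lborel ?H = emeasure lborel (box (0::'a) One)"
      by (rule emeasure_between_box[OF H]) (auto simp: mem_box less_imp_le)
    ultimately show "emeasure lborel {y. \<forall>b\<in>B. 0 \<le> y \<bullet> d b \<and> y \<bullet> d b < r b} = ennreal (\<kappa> * (\<Prod>b\<in>B. r b))"
      using scaled[where s = "\<lambda>b. 1 / r b", OF _ H] r' by (simp add: emeasure_lborel_box_eq)
  next
    fix c :: "'b \<Rightarrow> real" assume c: "\<And>b. b \<in> B \<Longrightarrow> c b > 0"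
    let ?S = "{x::'a. (\<forall>i\<in>Basis. 0 < x \<bullet> i) \<and> (\<Sum>i\<in>Basis. x \<bullet> i) < 1}"
    have S: "?S \<in> sets borel" by measurable
    have sum: "(\<Sum>i\<in>Basis. G c y \<bullet> i) = (\<Sum>b\<in>B. c b * (y \<bullet> d b))" for y
      by (simp add: G flip: sum.reindex_bij_betw[OF \<sigma>])
    have "y \<in> {y. (\<forall>b\<in>B. 0 < y \<bullet> d b) \<and> (\<Sum>b\<in>B. c b * (y \<bullet> d b)) < 1} \<longleftrightarrow> G c y \<in> ?S" for y
    proof -
      have "0 < y \<bullet> d b \<longleftrightarrow> 0 < G c y \<bullet> \<sigma> b" if "b \<in> B" for b
        using c[OF that] that by (auto simp: G zero_less_mult_iff)
      then show ?thesis unfolding mem_Collect_eq sum allB[symmetric] by simp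
    qed
    then have "{y. (\<forall>b\<in>B. 0 < y \<bullet> d b) \<and> (\<Sum>b\<in>B. c b * (y \<bullet> d b)) < 1} = {y. G c y \<in> ?S}" by blast
    then show "emeasure lborel {y. (\<forall>b\<in>B. 0 < y \<bullet> d b) \<and> (\<Sum>b\<in>B. c b * (y \<bullet> d b)) < 1} =
        ennreal (\<kappa> * (1 / (fact (card B) * (\<Prod>b\<in>B. c b))))"
      using scaled[OF c S] \<kappa>(1) c
      by (simp add: emeasure_open_simplex card prod_dividef prod_nonneg less_imp_le flip: ennreal_mult)
  qed
qed

section \<open>Counting alcoves\<close>

text \<open>The finite Weyl group, encoded by words in affine roots of level 0 so that all results
  on words apply to it.\<close>

definition weyl :: "'v::euclidean_space set \<Rightarrow> ('v \<Rightarrow> 'v) set" where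
  "weyl R = {word (map (\<lambda>\<alpha>. (\<alpha>, 0)) as) | as. set as \<subseteq> R}"

lemma arefl_linear_part: "arefl (\<alpha>, m) x = reflect \<alpha> x + of_int m *\<^sub>R coroot \<alpha>"
  by (simp add: arefl_def aval_def reflect_alt algebra_simps)

lemma arefl_0: "arefl (\<alpha>, 0) = reflect \<alpha>"
  by (simp add: fun_eq_iff arefl_linear_part)

lemma weyl_coroot: "weyl (coroot ` R) = weyl R"
proof -
  have eq: "word (map (\<lambda>\<alpha>. (\<alpha>, 0)) (map coroot as)) = word (map (\<lambda>\<alpha>. (\<alpha>, 0)) as)" for as :: "'a list"
    by (induction as) (simp_all add: arefl_0 reflect_coroot)
  have sub: "weyl (coroot ` S) \<subseteq> weyl S" for S :: "'a set"
  proof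
    fix w assume "w \<in> weyl (coroot ` S)"
    then obtain as where as: "set as \<subseteq> coroot ` S" "w = word (map (\<lambda>\<alpha>. (\<alpha>, 0)) as)" by (auto simp: weyl_def)
    then have "w = word (map (\<lambda>\<alpha>. (\<alpha>, 0)) (map coroot as))" by (simp only: eq)
    moreover have "set (map coroot as) \<subseteq> S" using as(1) by auto
    ultimately show "w \<in> weyl S" unfolding weyl_def by blast
  qed
  show ?thesis using sub[of R] sub[of "coroot ` R"] by (simp add: image_image)
qed

lemma linear_weyl: "w \<in> weyl R \<Longrightarrow> linear w"
proof -
  have "linear (word (map (\<lambda>\<alpha>. (\<alpha>, 0)) as))" for as :: "'a list"
  proof (induction as)
    case (Cons \<alpha> as)
    then show ?case using linear_compose[OF Cons linear_reflect] by (simp add: arefl_0 o_def)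
  qed (simp add: linear_iff)
  then show "w \<in> weyl R \<Longrightarrow> linear w" by (auto simp: weyl_def)
qed

text \<open>A reflection is an involution, so its scaling factor has square 1 and, being positive,
  equals 1; the remaining translation preserves volume.\<close>

lemma emeasure_arefl_image:
  assumes "S \<in> sets borel"
  shows "emeasure lborel (arefl a ` S) = emeasure lborel S"
proof -
  obtain \<alpha> m where a: "a = (\<alpha>, m)" by (cases a)
  have inj: "inj (reflect \<alpha>)" by (rule inj_on_inverseI[of _ "reflect \<alpha>"]) simp
  obtain c where c: "c > 0"
    "\<And>S. S \<in> sets borel \<Longrightarrow> emeasure lborel {x. reflect \<alpha> x \<in> S} = ennreal c * emeasure lborel S"
    by (rule linear_vimage_scaling[OF linear_reflect inj]) auto
  have [measurable]: "reflect \<alpha> \<in> borel_measurable borel"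
    using linear_reflect by (auto intro!: borel_measurable_continuous_onI linear_continuous_on linear_linear[THEN iffD2])
  let ?U = "ball (0::'a) 1"
  have "reflect \<alpha> -` ?U \<inter> space borel \<in> sets borel" by (rule measurable_sets[where A = borel]) auto
  then have U: "{x. reflect \<alpha> x \<in> ?U} \<in> sets borel" by (simp add: vimage_def)
  have "emeasure lborel {x. reflect \<alpha> x \<in> {x. reflect \<alpha> x \<in> ?U}} = ennreal c * (ennreal c * emeasure lborel ?U)"
    using c(2)[OF U] c(2)[of ?U] by simp
  then have "ennreal (c * c) * emeasure lborel ?U = emeasure lborel ?U"
    using c(1) by (simp only: mem_Collect_eq reflect_reflect Collect_mem_eq ennreal_mult' less_imp_le mult.assoc)
  moreover obtain u where u: "emeasure lborel ?U = ennreal u" "u > 0"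
    using content_ball_pos[of 1 "0::'a"] emeasure_lborel_ball_finite[of "0::'a" 1]
    by (cases "emeasure lborel ?U") (auto simp: measure_def)
  ultimately have "c * c = 1" using c(1) by (simp flip: ennreal_mult)
  then have c1: "c = 1" using c(1) by (metis abs_of_pos abs_square_eq_1 power2_eq_square)
  have S': "{y. of_int m *\<^sub>R coroot \<alpha> + y \<in> S} \<in> sets borel"
  proof -
    have "(\<lambda>y. of_int m *\<^sub>R coroot \<alpha> + y) -` S \<inter> space borel \<in> sets borel"
      by (rule measurable_sets[where A = borel]) (use assms in auto)
    then show ?thesis by (simp add: vimage_def)
  qed
  have "x \<in> arefl a ` S \<longleftrightarrow> reflect \<alpha> x \<in> {y. of_int m *\<^sub>R coroot \<alpha> + y \<in> S}" for x
  proof -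
    have "x \<in> arefl a ` S \<longleftrightarrow> arefl a x \<in> S" by (metis arefl_arefl image_iff)
    then show ?thesis by (simp add: a arefl_linear_part add.commute)
  qed
  then have "arefl a ` S = {x. reflect \<alpha> x \<in> {y. of_int m *\<^sub>R coroot \<alpha> + y \<in> S}}" by blast
  then show ?thesis using c(2)[OF S'] c1 emeasure_lborel_translate[OF assms] by simp
qed

section \<open>Alcoves in a parallelepiped\<close>

context root_system
begin

lemma region_borel: "region k \<in> sets borel"
proof -
  have "region k = (\<Inter>\<alpha>\<in>R. {x. of_int (k \<alpha>) < x \<bullet> \<alpha> \<and> x \<bullet> \<alpha> < of_int (k \<alpha>) + 1})"
    by (auto simp: region_def)
  moreover have "open \<dots>"
    using finite_R by (intro open_INT ballI open_Collect_conj open_Collect_less) (auto intro!: continuous_intros)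
  ultimately show ?thesis by simp
qed

lemma word_A0:
  assumes "set as \<subseteq> affine_roots"
  shows "word as ` A0 \<in> sets borel" and "emeasure lborel (word as ` A0) = emeasure lborel A0"
  using assms
proof (induction as)
  case (Cons a as)
  have *: "word (a # as) ` A0 = arefl a ` (word as ` A0)" by auto
  {
    case 1
    then show ?case using word_imp_shi[of "a # as"] region_borel by metis
  next
    case 2
    then show ?case unfolding * using Cons by (simp add: emeasure_arefl_image)
  }
qed (simp_all add: region_borel)

lemma simple_affine_subset: "set as \<subseteq> simple_affine_roots \<Longrightarrow> set as \<subseteq> affine_roots"
  using simple_affine_in by auto

lemma emeasure_region: "shi k \<Longrightarrow> emeasure lborel (region k) = emeasure lborel A0"
  using shi_imp_word word_A0 simple_affine_subset by metis

lemma inner_expand: "x \<bullet> \<beta> = (\<Sum>b\<in>B. representation B \<beta> b * (x \<bullet> b))"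
proof -
  have "x \<bullet> \<beta> = x \<bullet> (\<Sum>b\<in>B. representation B \<beta> b *\<^sub>R b)" by (simp add: expand_B)
  then show ?thesis by (simp add: inner_sum_right)
qed

lemma eq_0_if_inner_simple: "(\<And>b. b \<in> B \<Longrightarrow> y \<bullet> b = 0) \<Longrightarrow> y = 0"
  using inner_expand[of y y] by simp

text \<open>Regions are counted, not tuples, because the values of a tuple outside \<open>R\<close>
  are arbitrary.\<close>

definition base_regions :: "'v set set" where
  "base_regions = region ` {k. shi k \<and> (\<forall>b\<in>B. k b = 0)}"

text \<open>Along a chain of positive roots starting at a simple root with value 0, each added
  simple root raises the value by at most 1, and the chain has height minus 1 such
  additions.\<close>

lemma shi_bounds:
  assumes k: "shi k" "\<And>b. b \<in> B \<Longrightarrow> k b = 0" and "\<beta> \<in> P"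
  shows "0 \<le> k \<beta> \<and> real_of_int (k \<beta>) \<le> \<beta> \<bullet> rho - 1"
  using assms(3)
proof (induction rule: P_induct)
  case (simple b)
  then show ?case using k by (simp add: inner_rho)
next
  case (step \<alpha> b)
  have "k \<alpha> + k b \<le> k (\<alpha> + b)" "k (\<alpha> + b) \<le> k \<alpha> + k b + 1"
    using k(1) P_R[OF step(1)] P_R[OF step(3)] B_R[OF step(2)] unfolding shi_def by blast+
  then show ?case using step k(2)[OF step(2)] by (auto simp: inner_add_left inner_rho)
qed

lemma finite_base_regions: "finite base_regions"
proof (rule finite_subset)
  let ?M = "int scale"
  show "base_regions \<subseteq> region ` (R \<rightarrow>\<^sub>E {- ?M..?M})"
  proof
    fix S assume "S \<in> base_regions"
    then obtain k where k: "shi k" "\<forall>b\<in>B. k b = 0" "S = region k" by (auto simp: base_regions_def)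
    have bd: "0 \<le> k \<beta> \<and> k \<beta> < ?M" if "\<beta> \<in> P" for \<beta>
      using shi_bounds[OF k(1) _ that] k(2) height_less_scale[OF P_R[OF that]] by force
    have "k \<beta> \<in> {- ?M..?M}" if "\<beta> \<in> R" for \<beta>
    proof (cases "\<beta> \<in> P")
      case True
      then show ?thesis using bd[of \<beta>] by simp
    next
      case False
      then show ?thesis using bd[of "- \<beta>"] uminus_P_iff[OF that] shi_uminus[OF k(1) that] by auto
    qed
    then have "restrict k R \<in> R \<rightarrow>\<^sub>E {- ?M..?M}" by auto
    moreover have "region k = region (restrict k R)" by (rule region_cong) simp
    ultimately show "S \<in> region ` (R \<rightarrow>\<^sub>E {- ?M..?M})" using k by blast
  qed
  show "finite (region ` (R \<rightarrow>\<^sub>E {- ?M..?M}))" using finite_R by (intro finite_imageI finite_PiE) auto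
qed

lemma countable_affine_roots: "countable affine_roots"
  unfolding affine_roots_def using finite_R by (intro countable_SIGMA) (auto intro: countable_finite)

lemma generic_region:
  assumes "\<And>f. f \<in> affine_roots \<Longrightarrow> x \<bullet> fst f \<noteq> of_int (snd f)"
  shows "shi (\<lambda>\<alpha>. \<lfloor>x \<bullet> \<alpha>\<rfloor>) \<and> x \<in> region (\<lambda>\<alpha>. \<lfloor>x \<bullet> \<alpha>\<rfloor>)"
proof -
  have "x \<bullet> \<alpha> \<notin> \<int>" if "\<alpha> \<in> R" for \<alpha>
    using assms[of "(\<alpha>, _)"] that by (auto elim!: Ints_cases)
  then show ?thesis using generic_shi by blast
qed

text \<open>A point off the hyperplanes lies in the box exactly when the floors of its pairings with
  the simple roots are 0. So these alcoves, all of equal volume, tile the box up to a null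
  set.\<close>

lemma parallelepiped_volume:
  "of_nat (card base_regions) * emeasure lborel A0 = emeasure lborel {y. \<forall>b\<in>B. 0 < y \<bullet> b \<and> y \<bullet> b < 1}"
proof -
  have disj: "disjoint_family_on id base_regions"
    unfolding disjoint_family_on_def
  proof (intro ballI impI)
    fix S T assume h: "S \<in> base_regions" "T \<in> base_regions" "S \<noteq> T"
    then obtain k l where kl: "S = region k" "T = region l" by (auto simp: base_regions_def)
    show "id S \<inter> id T = {}"
    proof (rule ccontr)
      assume "\<not> ?thesis"
      then obtain x where "x \<in> region k" "x \<in> region l" using kl by auto
      then have "region k = region l" by (intro region_cong region_unique)
      with h kl show False by simp
    qed
  qed
  have "of_nat (card base_regions) * emeasure lborel A0 = (\<Sum>S\<in>base_regions. emeasure lborel (id S))"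
  proof -
    have "emeasure lborel S = emeasure lborel A0" if "S \<in> base_regions" for S
      using that emeasure_region by (auto simp: base_regions_def)
    then show ?thesis by simp
  qed
  also have "\<dots> = emeasure lborel (\<Union>S\<in>base_regions. id S)"
    by (rule sum_emeasure[OF _ disj finite_base_regions]) (auto simp: base_regions_def region_borel)
  also have "\<dots> = emeasure lborel {y. \<forall>b\<in>B. 0 < y \<bullet> b \<and> y \<bullet> b < 1}"
  proof (rule emeasure_eq_hyperplanes[where I = affine_roots and a = fst and c = "\<lambda>f. of_int (snd f)"])
    show "(\<Union>S\<in>base_regions. id S) \<in> sets borel"
      using finite_base_regions by (intro sets.finite_UN) (auto simp: base_regions_def region_borel)
    have "{y. \<forall>b\<in>B. 0 < y \<bullet> b \<and> y \<bullet> b < 1} = (\<Inter>b\<in>B. {y. 0 < y \<bullet> b \<and> y \<bullet> b < 1})" by auto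
    moreover have "open \<dots>"
      using finite_B by (intro open_INT ballI open_Collect_conj open_Collect_less) (auto intro!: continuous_intros)
    ultimately show "{y. \<forall>b\<in>B. 0 < y \<bullet> b \<and> y \<bullet> b < 1} \<in> sets borel" by simp
    show "fst f \<noteq> 0" if "f \<in> affine_roots" for f using that R_nonzero by simp
    fix x assume gen: "\<And>f. f \<in> affine_roots \<Longrightarrow> x \<bullet> fst f \<noteq> of_int (snd f)"
    show "x \<in> (\<Union>S\<in>base_regions. id S) \<longleftrightarrow> x \<in> {y. \<forall>b\<in>B. 0 < y \<bullet> b \<and> y \<bullet> b < 1}"
    proof
      assume "x \<in> (\<Union>S\<in>base_regions. id S)"
      then obtain k where k: "\<forall>b\<in>B. k b = 0" "x \<in> region k" by (auto simp: base_regions_def)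
      show "x \<in> {y. \<forall>b\<in>B. 0 < y \<bullet> b \<and> y \<bullet> b < 1}"
      proof (intro CollectI ballI)
        fix b assume "b \<in> B"
        then show "0 < x \<bullet> b \<and> x \<bullet> b < 1" using k B_R[of b] by (force simp: region_def)
      qed
    next
      assume x: "x \<in> {y. \<forall>b\<in>B. 0 < y \<bullet> b \<and> y \<bullet> b < 1}"
      then have "\<lfloor>x \<bullet> b\<rfloor> = 0" if "b \<in> B" for b using that by (simp add: floor_eq_iff less_imp_le)
      then have "region (\<lambda>\<alpha>. \<lfloor>x \<bullet> \<alpha>\<rfloor>) \<in> base_regions"
        unfolding base_regions_def using generic_region[OF gen] by blast
      then show "x \<in> (\<Union>S\<in>base_regions. id S)" using generic_region[OF gen] by auto
    qed
  qed (rule countable_affine_roots)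
  finally show ?thesis .
qed

section \<open>The finite Weyl group and the translation lattice\<close>

lemma weyl_word: "w \<in> weyl R \<Longrightarrow> \<exists>as. set as \<subseteq> affine_roots \<and> w = word as"
  unfolding weyl_def by force

lemma weyl_maps_R: "w \<in> weyl R \<Longrightarrow> \<alpha> \<in> R \<Longrightarrow> w \<alpha> \<in> R"
proof -
  have "word (map (\<lambda>\<alpha>. (\<alpha>, 0)) as) \<alpha> \<in> R" if "set as \<subseteq> R" "\<alpha> \<in> R" for as
    using that by (induction as) (auto simp: arefl_0 reflect_in_R)
  then show "w \<in> weyl R \<Longrightarrow> \<alpha> \<in> R \<Longrightarrow> w \<alpha> \<in> R" by (auto simp: weyl_def)
qed

text \<open>An element is linear and maps the finite spanning set \<open>R\<close> into itself, so
  its restriction to \<open>R\<close> determines it.\<close>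

lemma finite_weyl: "finite (weyl R)"
proof (rule inj_on_finite)
  show "(\<lambda>w. restrict w R) ` weyl R \<subseteq> R \<rightarrow>\<^sub>E R" using weyl_maps_R by auto
  show "finite (R \<rightarrow>\<^sub>E R)" using finite_R by (intro finite_PiE) auto
  show "inj_on (\<lambda>w. restrict w R) (weyl R)"
  proof (rule inj_onI)
    fix w w' assume h: "w \<in> weyl R" "w' \<in> weyl R" "restrict w R = restrict w' R"
    have "w x = w' x" for x
    proof (rule linear_eq_on_span[where B = R and f = w and g = w'])
      show "linear w" "linear w'" using h linear_weyl by auto
      show "w x = w' x" if "x \<in> R" for x using fun_cong[OF h(3), of x] that by simp
      show "x \<in> span R" by (simp add: span_R)
    qed
    then show "w = w'" by blast
  qed
qed

lemma weyl_id: "id \<in> weyl R"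
  unfolding weyl_def by (intro CollectI exI[of _ "[]"]) simp

lemma weyl_reflect: "\<alpha> \<in> R \<Longrightarrow> w \<in> weyl R \<Longrightarrow> reflect \<alpha> \<circ> w \<in> weyl R"
proof -
  assume a: "\<alpha> \<in> R" and "w \<in> weyl R"
  then obtain as where "set as \<subseteq> R" "w = word (map (\<lambda>\<alpha>. (\<alpha>, 0)) as)" by (auto simp: weyl_def)
  then show ?thesis using a unfolding weyl_def
    by (intro CollectI exI[of _ "\<alpha> # as"]) (simp add: arefl_0)
qed

definition translation_set :: "'v set" where
  "translation_set = {v. \<exists>as. set as \<subseteq> affine_roots \<and> (\<forall>x. word as x = x + v)}"

lemma translation_set_0: "0 \<in> translation_set"
  unfolding translation_set_def by (intro CollectI exI[of _ "[]"]) simp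

lemma translation_set_add: "u \<in> translation_set \<Longrightarrow> v \<in> translation_set \<Longrightarrow> u + v \<in> translation_set"
proof -
  assume "u \<in> translation_set" "v \<in> translation_set"
  then obtain as bs where "set as \<subseteq> affine_roots" "\<forall>x. word as x = x + u" "set bs \<subseteq> affine_roots" "\<forall>x. word bs x = x + v"
    unfolding translation_set_def by blast
  then show ?thesis unfolding translation_set_def
    by (intro CollectI exI[of _ "as @ bs"]) (auto simp: word_append ac_simps)
qed

lemma translation_set_uminus: "u \<in> translation_set \<Longrightarrow> - u \<in> translation_set"
proof -
  assume "u \<in> translation_set"
  then obtain as where as: "set as \<subseteq> affine_roots" "\<forall>x. word as x = x + u" unfolding translation_set_def by blast
  have "word (rev as) x = x - u" for x using word_rev(1)[of as "x - u"] as(2) by simp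
  then show ?thesis unfolding translation_set_def using as(1) by (intro CollectI exI[of _ "rev as"]) auto
qed

text \<open>Reflecting in two parallel hyperplanes at consecutive levels translates by the
  coroot.\<close>

lemma translation_set_coroot: "\<alpha> \<in> R \<Longrightarrow> coroot \<alpha> \<in> translation_set"
  unfolding translation_set_def
  by (intro CollectI exI[of _ "[(\<alpha>, 1), (\<alpha>, 0)]"]) (simp add: arefl_0, simp add: arefl_linear_part)

lemma translation_set_int: "u \<in> translation_set \<Longrightarrow> of_int n *\<^sub>R u \<in> translation_set"
proof -
  assume u: "u \<in> translation_set"
  have nat: "of_nat k *\<^sub>R u \<in> translation_set" for k
    by (induction k) (auto simp: translation_set_0 scaleR_left_distrib intro: translation_set_add u)
  show ?thesis
  proof (cases "n \<ge> 0")
    case True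
    then show ?thesis using nat[of "nat n"] by simp
  next
    case False
    then show ?thesis using translation_set_uminus[OF nat[of "nat (- n)"]] by simp
  qed
qed

lemma translation_set_sum: "finite A \<Longrightarrow> (\<And>a. a \<in> A \<Longrightarrow> f a \<in> translation_set) \<Longrightarrow> sum f A \<in> translation_set"
  by (induction A rule: finite_induct) (auto simp: translation_set_0 intro: translation_set_add)

text \<open>The affine group is the coroot lattice \<open>T\<close> extended by the finite Weyl
  group. So the union \<open>E\<close> of the Weyl images of the alcove is, up to hyperplanes, a
  fundamental domain of \<open>T\<close>, as is the half-open parallelepiped \<open>D\<close>. The
  vectors \<omega> are the fundamental weights.\<close>

lemma weyl_volume:
  assumes w: "\<And>b b'. b \<in> B \<Longrightarrow> b' \<in> B \<Longrightarrow> coroot b \<bullet> \<omega> b' = (if b = b' then 1 else 0)"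
  shows "of_nat (card (weyl R)) * emeasure lborel A0 = emeasure lborel {y. \<forall>b\<in>B. 0 \<le> y \<bullet> \<omega> b \<and> y \<bullet> \<omega> b < 1}"
proof -
  interpret d: root_system "coroot ` R" "coroot ` B" by (rule root_system_coroot)
  \<comment> \<open>Pairing with \<omega> b reads off the coordinate at \<open>coroot b\<close>, so
    this is the lattice spanned by the simple coroots.\<close>
  define T where "T = {v. \<forall>b\<in>B. v \<bullet> \<omega> b \<in> \<int>}"
  define D where "D = {y. \<forall>b\<in>B. 0 \<le> y \<bullet> \<omega> b \<and> y \<bullet> \<omega> b < 1}"
  define E where "E = (\<Union>w\<in>weyl R. w ` A0)"
  have comb: "(\<Sum>b\<in>B. c b *\<^sub>R coroot b) \<bullet> \<omega> b' = c b'" if "b' \<in> B" for c b'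
  proof -
    have "(\<Sum>b\<in>B. c b *\<^sub>R coroot b) \<bullet> \<omega> b' = (\<Sum>b\<in>B. if b = b' then c b else 0)"
      unfolding inner_sum_left by (intro sum.cong) (use w that in auto)
    then show ?thesis using finite_B that by simp
  qed
  have ex: "\<exists>c. y = (\<Sum>b\<in>B. c b *\<^sub>R coroot b)" for y
    using d.expand_B[of y] by (auto simp: sum.reindex[OF inj_coroot] o_def intro: exI[of _ "\<lambda>b. representation (coroot ` B) y (coroot b)"])
  have expand: "y = (\<Sum>b\<in>B. (y \<bullet> \<omega> b) *\<^sub>R coroot b)" for y
  proof -
    obtain c where c: "y = (\<Sum>b\<in>B. c b *\<^sub>R coroot b)" using ex by blast
    have "(\<Sum>b\<in>B. (y \<bullet> \<omega> b) *\<^sub>R coroot b) = (\<Sum>b\<in>B. c b *\<^sub>R coroot b)"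
      using comb[of _ c] by (intro sum.cong) (simp_all add: c)
    then show ?thesis using c by simp
  qed
  have sep: "y = 0" if "\<And>b. b \<in> B \<Longrightarrow> y \<bullet> \<omega> b = 0" for y
    using expand[of y] that by simp
  have T_coroot: "coroot \<alpha> \<in> T" if "\<alpha> \<in> R" for \<alpha>
  proof -
    have "coroot \<alpha> \<bullet> \<omega> b = representation (coroot ` B) (coroot \<alpha>) (coroot b)" if "b \<in> B" for b
    proof -
      have "coroot \<alpha> = (\<Sum>b\<in>B. representation (coroot ` B) (coroot \<alpha>) (coroot b) *\<^sub>R coroot b)"
        using d.expand_B[of "coroot \<alpha>"] by (simp add: sum.reindex[OF inj_coroot] o_def)
      then show ?thesis using comb[OF that] by metis
    qed
    then show ?thesis using d.representation_Ints[of "coroot \<alpha>"] that by (simp add: T_def)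
  qed
  have T_add: "u + v \<in> T" and T_minus: "- u \<in> T" if "u \<in> T" "v \<in> T" for u v
    using that by (auto simp: T_def inner_add_left)
  have T_int: "of_int n *\<^sub>R u \<in> T" if "u \<in> T" for u n
    using that by (auto simp: T_def)
  have T_trans: "T \<subseteq> translation_set"
  proof
    fix v assume v: "v \<in> T"
    have "(v \<bullet> \<omega> b) *\<^sub>R coroot b \<in> translation_set" if "b \<in> B" for b
    proof -
      have "v \<bullet> \<omega> b \<in> \<int>" using v that by (simp add: T_def)
      then obtain n where n: "v \<bullet> \<omega> b = of_int n" by (auto elim: Ints_cases)
      show ?thesis unfolding n by (intro translation_set_int translation_set_coroot B_R that)
    qed
    then show "v \<in> translation_set" by (subst expand) (intro translation_set_sum finite_B)
  qed
  have T_reflect: "reflect \<alpha> q \<in> T" if "\<alpha> \<in> R" "q \<in> T" for \<alpha> q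
  proof -
    have "q \<bullet> \<alpha> = (\<Sum>b\<in>B. (q \<bullet> \<omega> b) * (coroot b \<bullet> \<alpha>))"
      by (subst expand) (simp add: inner_sum_left)
    also have "\<dots> \<in> \<int>"
      using that inner_coroot_Ints[OF B_R that(1)] by (intro Ints_sum Ints_mult) (auto simp: T_def inner_commute)
    finally obtain n where n: "q \<bullet> \<alpha> = of_int n" by (auto elim: Ints_cases)
    have "reflect \<alpha> q = q + of_int (- n) *\<^sub>R coroot \<alpha>" by (simp add: reflect_alt n)
    then show ?thesis using T_add[OF that(2) T_int[OF T_coroot[OF that(1)]]] by metis
  qed
  \<comment> \<open>A reflection moves past a translation by reflecting the translation vector, and
    \<open>T_reflect\<close> keeps that vector in the lattice.\<close>
  have decomp: "\<exists>w\<in>weyl R. \<exists>q\<in>T. \<forall>x. word as x = w x + q" if "set as \<subseteq> affine_roots" for as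
    using that
  proof (induction as)
    case Nil
    have "0 \<in> T" by (simp add: T_def)
    then show ?case using weyl_id by (intro bexI[of _ id] bexI[of _ 0]) auto
  next
    case (Cons a as)
    then obtain w q where wq: "w \<in> weyl R" "q \<in> T" "\<forall>x. word as x = w x + q" by auto
    obtain \<alpha> m where a: "a = (\<alpha>, m)" "\<alpha> \<in> R" using Cons.prems by (cases a) auto
    have "reflect \<alpha> q + of_int m *\<^sub>R coroot \<alpha> \<in> T"
      using a wq by (intro T_add(1) T_reflect T_int T_coroot) auto
    moreover have "reflect \<alpha> \<circ> w \<in> weyl R" using weyl_reflect a wq by blast
    moreover have "\<forall>x. word (a # as) x = (reflect \<alpha> \<circ> w) x + (reflect \<alpha> q + of_int m *\<^sub>R coroot \<alpha>)"
      using wq by (simp add: a arefl_linear_part reflect_add)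
    ultimately show ?case by blast
  qed
  have shifted: "s = t \<and> w = w'"
    if st: "s \<in> T" "t \<in> T" and ww': "w \<in> weyl R" "w' \<in> weyl R" and x: "x - s \<in> w ` A0" "x - t \<in> w' ` A0"
    for s t w w' x
  proof -
    have "s \<in> translation_set" "t \<in> translation_set" using T_trans st by auto
    then obtain as bs where "set as \<subseteq> affine_roots" "\<forall>x. word as x = x + s"
      "set bs \<subseteq> affine_roots" "\<forall>x. word bs x = x + t"
      unfolding translation_set_def by blast
    moreover obtain cs ds where "set cs \<subseteq> affine_roots" "w = word cs" "set ds \<subseteq> affine_roots" "w' = word ds"
      using weyl_word[OF ww'(1)] weyl_word[OF ww'(2)] by blast
    ultimately have words: "set as \<subseteq> affine_roots" "\<forall>x. word as x = x + s"
      "set bs \<subseteq> affine_roots" "\<forall>x. word bs x = x + t"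
      "set cs \<subseteq> affine_roots" "w = word cs" "set ds \<subseteq> affine_roots" "w' = word ds" by blast+
    have "x \<in> word (as @ cs) ` A0"
    proof -
      obtain y where y: "y \<in> A0" "x - s = w y" using x(1) by blast
      then have "x = word (as @ cs) y" using words y(2) by (simp add: word_append diff_eq_eq)
      then show ?thesis using y by blast
    qed
    moreover have "x \<in> word (bs @ ds) ` A0"
    proof -
      obtain y where y: "y \<in> A0" "x - t = w' y" using x(2) by blast
      then have "x = word (bs @ ds) y" using words y(2) by (simp add: word_append diff_eq_eq)
      then show ?thesis using y by blast
    qed
    ultimately have "word (as @ cs) = word (bs @ ds)"
      using words by (intro word_free) auto
    then have eq: "w y + s = w' y + t" for y using words by (simp add: word_append fun_eq_iff)
    \<comment> \<open>Weyl group elements fix the origin, so evaluation there isolates the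
      translation parts.\<close>
    have "s = t" using eq[of 0] ww'[THEN linear_weyl, THEN linear_0] by simp
    then show ?thesis using eq by (simp add: fun_eq_iff)
  qed
  have "emeasure lborel D = emeasure lborel E"
  proof (rule tile_volume_eq[where T = T and I = affine_roots and a = fst and c = "\<lambda>f. of_int (snd f)"])
    show "D \<in> sets borel"
    proof -
      have "D = (\<Inter>b\<in>B. {y. 0 \<le> y \<bullet> \<omega> b \<and> y \<bullet> \<omega> b < 1} )" by (auto simp: D_def)
      moreover have "B \<noteq> {}" using card_B by (metis DIM_positive card.empty less_numeral_extra(3))
      then have "(\<Inter>b\<in>B. {y. 0 \<le> y \<bullet> \<omega> b \<and> y \<bullet> \<omega> b < 1} ) \<in> sets borel"
        using finite_B by (intro sets.finite_INT) measurable
      ultimately show ?thesis by simp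
    qed
    show "E \<in> sets borel"
      unfolding E_def using finite_weyl weyl_word word_A0(1) by (intro sets.finite_UN) metis+
    show "countable T"
    proof (rule countable_subset)
      show "T \<subseteq> (\<lambda>n. \<Sum>b\<in>B. of_int (n b) *\<^sub>R coroot b) ` (B \<rightarrow>\<^sub>E (UNIV :: int set))"
      proof
        fix v assume v: "v \<in> T"
        have "v = (\<Sum>b\<in>B. of_int ((\<lambda>b\<in>B. \<lfloor>v \<bullet> \<omega> b\<rfloor>) b) *\<^sub>R coroot b)"
          by (subst expand) (rule sum.cong, use v in \<open>auto simp: T_def elim!: Ints_cases\<close>)
        moreover have "(\<lambda>b\<in>B. \<lfloor>v \<bullet> \<omega> b\<rfloor>) \<in> B \<rightarrow>\<^sub>E UNIV" by simp
        ultimately show "v \<in> (\<lambda>n. \<Sum>b\<in>B. of_int (n b) *\<^sub>R coroot b) ` (B \<rightarrow>\<^sub>E (UNIV :: int set))" by (rule image_eqI)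
      qed
      show "countable ((\<lambda>n. \<Sum>b\<in>B. of_int (n b) *\<^sub>R coroot b) ` (B \<rightarrow>\<^sub>E (UNIV :: int set)))"
        using finite_B by (intro countable_image countable_PiE) auto
    qed
    show "\<exists>!t. t \<in> T \<and> t + x \<in> D" for x
    proof (rule ex1I)
      let ?t = "\<Sum>b\<in>B. (- of_int \<lfloor>x \<bullet> \<omega> b\<rfloor>) *\<^sub>R coroot b"
      have t: "?t \<bullet> \<omega> b = - of_int \<lfloor>x \<bullet> \<omega> b\<rfloor>" if "b \<in> B" for b by (rule comb[OF that])
      show "?t \<in> T \<and> ?t + x \<in> D"
      proof
        show "?t \<in> T" unfolding T_def using t by auto
        have "0 \<le> (?t + x) \<bullet> \<omega> b \<and> (?t + x) \<bullet> \<omega> b < 1" if "b \<in> B" for b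
          unfolding inner_add_left t[OF that] by linarith
        then show "?t + x \<in> D" unfolding D_def by blast
      qed
      fix s assume s: "s \<in> T \<and> s + x \<in> D"
      have "(s - ?t) \<bullet> \<omega> b = 0" if "b \<in> B" for b
      proof -
        have "s \<bullet> \<omega> b \<in> \<int>" using s that by (simp add: T_def)
        then obtain n where n: "s \<bullet> \<omega> b = of_int n" by (auto elim: Ints_cases)
        have "0 \<le> of_int n + x \<bullet> \<omega> b" "of_int n + x \<bullet> \<omega> b < 1"
          using s that n by (auto simp: D_def inner_add_left)
        then have "\<lfloor>x \<bullet> \<omega> b\<rfloor> = - n" by linarith
        then show ?thesis unfolding inner_diff_left t[OF that] n by simp
      qed
      then show "s = ?t" using sep[of "s - ?t"] by simp
    qed
    show "s = t" if "s \<in> T" "t \<in> T" "x - s \<in> E" "x - t \<in> E" for x s t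
      using shifted[of s t _ _ x] that unfolding E_def by blast
    show "fst f \<noteq> 0" if "f \<in> affine_roots" for f using that R_nonzero by simp
    fix x assume gen: "\<And>f. f \<in> affine_roots \<Longrightarrow> x \<bullet> fst f \<noteq> of_int (snd f)"
    obtain as where as: "set as \<subseteq> affine_roots" "x \<in> word as ` A0"
      using generic_region[OF gen] shi_imp_word simple_affine_subset by blast
    obtain w q where "w \<in> weyl R" "q \<in> T" "\<forall>x. word as x = w x + q" using decomp[OF as(1)] by blast
    then show "\<exists>t\<in>T. x - t \<in> E" using as(2) unfolding E_def by (intro bexI[of _ q]) auto
  qed (rule countable_affine_roots)
  also have "\<dots> = (\<Sum>w\<in>weyl R. emeasure lborel (w ` A0))"
    unfolding E_def
  proof (rule sum_emeasure[symmetric])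
    show "(\<lambda>w. w ` A0) ` weyl R \<subseteq> sets lborel" using weyl_word word_A0(1) by fastforce
    have "0 \<in> T" by (simp add: T_def)
    then show "disjoint_family_on (\<lambda>w. w ` A0) (weyl R)"
      unfolding disjoint_family_on_def using shifted[of 0 0] by simp blast
  qed (rule finite_weyl)
  also have "\<dots> = (\<Sum>w\<in>weyl R. emeasure lborel A0)"
    using weyl_word word_A0(2) by (intro sum.cong refl) metis
  finally show ?thesis by (simp add: D_def)
qed

section \<open>The highest root and the count\<close>

lemma positive_coeff_exists: "\<beta> \<in> P \<Longrightarrow> \<exists>b\<in>B. representation B \<beta> b > 0"
proof (rule ccontr)
  assume b: "\<beta> \<in> P" and "\<not> ?thesis"
  then have "\<beta> \<bullet> rho \<le> 0" unfolding height_sum by (intro sum_nonpos) (auto simp: not_less)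
  then show False using b P_iff P_R by fastforce
qed

lemma highest_coeff_pos:
  assumes "highest_root R B \<theta>" "b \<in> B" shows "representation B \<theta> b > 0"
proof -
  have "representation B b b \<le> representation B \<theta> b" using assms B_R unfolding highest_root_def by blast
  then show ?thesis using indep_B assms by (simp add: real_vector.representation_basis)
qed

text \<open>Where all simple roots are positive, every positive root is positive and bounded by the
  highest root coefficient by coefficient, so only the listed inequalities matter.\<close>

lemma A0_simplex:
  assumes h: "highest_root R B \<theta>"
  shows "A0 = {y. (\<forall>b\<in>B. 0 < y \<bullet> b) \<and> (\<Sum>b\<in>B. representation B \<theta> b * (y \<bullet> b)) < 1}"
proof (intro subset_antisym subsetI)
  have th: "\<theta> \<in> P" using h highest_coeff_pos[OF h] by (auto simp: highest_root_def positive_roots_def less_imp_le)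
  fix y assume y: "y \<in> A0"
  have "0 < y \<bullet> b" if "b \<in> B" for b
    using y B_P[OF that] B_R[OF that] by (force simp: region_def base_coords_def)
  moreover have "y \<bullet> \<theta> < 1" using y th P_R[OF th] by (force simp: region_def base_coords_def)
  ultimately show "y \<in> {y. (\<forall>b\<in>B. 0 < y \<bullet> b) \<and> (\<Sum>b\<in>B. representation B \<theta> b * (y \<bullet> b)) < 1}"
    by (simp add: inner_expand[of y \<theta>])
next
  fix y assume y: "y \<in> {y. (\<forall>b\<in>B. 0 < y \<bullet> b) \<and> (\<Sum>b\<in>B. representation B \<theta> b * (y \<bullet> b)) < 1}"
  have pos: "0 < y \<bullet> \<beta> \<and> y \<bullet> \<beta> < 1" if b: "\<beta> \<in> P" for \<beta>
  proof
    obtain b0 where b0: "b0 \<in> B" "representation B \<beta> b0 > 0" using positive_coeff_exists[OF b] by blast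
    have nn: "representation B \<beta> b \<ge> 0" if "b \<in> B" for b using b that by (simp add: positive_roots_def)
    have yp: "y \<bullet> b > 0" if "b \<in> B" for b using y that by simp
    show "0 < y \<bullet> \<beta>" unfolding inner_expand[of y \<beta>]
    proof (rule sum_pos2[OF finite_B b0(1)])
      show "0 < representation B \<beta> b0 * (y \<bullet> b0)" using b0 yp by simp
      show "0 \<le> representation B \<beta> b * (y \<bullet> b)" if "b \<in> B" for b
        using nn[OF that] yp[OF that] by simp
    qed
    have "(\<Sum>b\<in>B. representation B \<beta> b * (y \<bullet> b)) \<le> (\<Sum>b\<in>B. representation B \<theta> b * (y \<bullet> b))"
    proof (rule sum_mono)
      fix b assume "b \<in> B"
      then show "representation B \<beta> b * (y \<bullet> b) \<le> representation B \<theta> b * (y \<bullet> b)"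
        using h P_R[OF b] yp[of b] unfolding highest_root_def by (intro mult_right_mono) auto
    qed
    then show "y \<bullet> \<beta> < 1" using y by (simp add: inner_expand[of y \<beta>])
  qed
  show "y \<in> A0" unfolding region_def
  proof (intro CollectI ballI)
    fix \<beta> assume b: "\<beta> \<in> R"
    show "of_int (base_coords \<beta>) < y \<bullet> \<beta> \<and> y \<bullet> \<beta> < of_int (base_coords \<beta>) + 1"
      using pos[of \<beta>] pos[of "- \<beta>"] uminus_P_iff[OF b] by (cases "\<beta> \<in> P") (auto simp: base_coords_def)
  qed
qed

text \<open>Both \<open>base_regions\<close> and the Weyl group measure volumes in units of the fundamental alcove, so
  their ratio is a ratio of parallelepiped volumes, which passing to the coroots does not change.
  Hence the count for the coroots can be read off from the highest root of \<open>R\<close> itself.\<close>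

lemma card_base_regions_coroot:
  assumes h: "highest_root R B \<theta>"
  shows "real (card (root_system.base_regions (coroot ` R) (coroot ` B))) =
    fact (card B) * (\<Prod>b\<in>B. representation B \<theta> b)"
proof -
  interpret d: root_system "coroot ` R" "coroot ` B" by (rule root_system_coroot)
  have "\<exists>v. \<forall>b'\<in>B. coroot b' \<bullet> v = (if b' = b then 1 else 0)" for b
    using dual_vector_exists[OF independent_coroot_B, of "\<lambda>c. if c = coroot b then 1 else 0"]
    by simp
  then obtain \<omega> where om: "\<And>b b'. b' \<in> B \<Longrightarrow> coroot b' \<bullet> \<omega> b = (if b' = b then 1 else 0)" by metis
  have sq: "b \<bullet> b > 0" if "b \<in> B" for b using that inner_self_pos B_R by blast
  have sepw: "y = 0" if z: "\<And>b. b \<in> B \<Longrightarrow> y \<bullet> \<omega> b = 0" for y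
  proof -
    obtain c where c: "y = (\<Sum>b\<in>B. c b *\<^sub>R coroot b)"
    proof
      show "y = (\<Sum>b\<in>B. representation (coroot ` B) y (coroot b) *\<^sub>R coroot b)"
        using d.expand_B[of y] by (simp add: sum.reindex[OF inj_coroot] o_def)
    qed
    have "c b' = 0" if b': "b' \<in> B" for b'
    proof -
      have "y \<bullet> \<omega> b' = (\<Sum>b\<in>B. if b = b' then c b else 0)"
        unfolding c inner_sum_left by (intro sum.cong) (use om b' in auto)
      then show ?thesis using finite_B b' z[OF b'] by simp
    qed
    then show ?thesis using c by simp
  qed
  obtain \<kappa> where k: "\<kappa> > 0"
    "\<And>r. (\<And>b. b \<in> B \<Longrightarrow> r b > 0) \<Longrightarrow>
      emeasure lborel {y. \<forall>b\<in>B. 0 < y \<bullet> b \<and> y \<bullet> b < r b} = ennreal (\<kappa> * (\<Prod>b\<in>B. r b))"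
    "\<And>c. (\<And>b. b \<in> B \<Longrightarrow> c b > 0) \<Longrightarrow>
      emeasure lborel {y. (\<forall>b\<in>B. 0 < y \<bullet> b) \<and> (\<Sum>b\<in>B. c b * (y \<bullet> b)) < 1} =
        ennreal (\<kappa> * (1 / (fact (card B) * (\<Prod>b\<in>B. c b))))"
    by (rule linear_frame_volume[where d = "\<lambda>b. b", OF finite_B card_B eq_0_if_inner_simple]) auto
  obtain \<mu> where m: "\<mu> > 0"
    "\<And>r. (\<And>b. b \<in> B \<Longrightarrow> r b > 0) \<Longrightarrow>
      emeasure lborel {y. \<forall>b\<in>B. 0 \<le> y \<bullet> \<omega> b \<and> y \<bullet> \<omega> b < r b} = ennreal (\<mu> * (\<Prod>b\<in>B. r b))"
    by (rule linear_frame_volume[where d = \<omega>, OF finite_B card_B sepw]) auto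
  define C where "C = fact (card B) * (\<Prod>b\<in>B. representation B \<theta> b)"
  have Cpos: "C > 0" unfolding C_def using highest_coeff_pos[OF h] by (intro mult_pos_pos prod_pos) auto
  \<comment> \<open>Passing from \<open>b\<close> to \<open>coroot b\<close> turns the bound 1 into
    (b \<bullet> b) / 2, in the box of simple roots and in that of weights. Both volumes thus
    acquire this same factor, which cancels.\<close>
  define p where "p = (\<Prod>b\<in>B. (b \<bullet> b) / 2)"
  have Ppos: "p > 0" unfolding p_def using sq by (intro prod_pos) auto
  have vA: "emeasure lborel A0 = ennreal (\<kappa> / C)"
    unfolding A0_simplex[OF h] using k(3)[of "representation B \<theta>"] highest_coeff_pos[OF h] by (simp add: C_def)
  have W: "of_nat (card (weyl R)) * emeasure lborel A0 = ennreal \<mu>"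
    using weyl_volume[of \<omega>] om m(2)[of "\<lambda>_. 1"] by simp
  have "real (card (weyl R)) * (\<kappa> / C) = \<mu>"
    using W vA k(1) m(1) Cpos by (simp add: ennreal_of_nat_eq_real_of_nat flip: ennreal_mult)
  then have 1: "real (card (weyl R)) * \<kappa> = \<mu> * C" using Cpos by (simp add: field_simps)
  have half: "(b \<bullet> b) / 2 > 0" if "b \<in> B" for b using sq[OF that] by simp
  have *: "{y. \<forall>b\<in>coroot ` B. 0 < y \<bullet> b \<and> y \<bullet> b < 1} = {y. \<forall>b\<in>B. 0 < y \<bullet> b \<and> y \<bullet> b < (b \<bullet> b) / 2}"
  proof -
    have "0 < y \<bullet> coroot b \<and> y \<bullet> coroot b < 1 \<longleftrightarrow> 0 < y \<bullet> b \<and> y \<bullet> b < (b \<bullet> b) / 2" if "b \<in> B" for y b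
      using sq[OF that] by (simp add: coroot_def zero_less_divide_iff field_simps del: inner_gt_zero_iff)
    then show ?thesis by auto
  qed
  have N: "of_nat (card d.base_regions) * emeasure lborel d.A0 = ennreal (\<kappa> * p)"
    unfolding d.parallelepiped_volume * p_def using k(2)[of "\<lambda>b. (b \<bullet> b) / 2"] half by simp
  \<comment> \<open>The fundamental weights of the dual system: its coroots are the original roots,
    so \<omega> b is divided by (b \<bullet> b) / 2.\<close>
  define \<omega>' where "\<omega>' c = (2 / (coroot c \<bullet> coroot c)) *\<^sub>R \<omega> (coroot c)" for c
  have om': "coroot c \<bullet> \<omega>' c' = (if c = c' then 1 else 0)" if "c \<in> coroot ` B" "c' \<in> coroot ` B" for c c'
  proof -
    from that obtain b b' where b: "b \<in> B" "b' \<in> B" "c = coroot b" "c' = coroot b'" by blast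
    have "b = ((b \<bullet> b) / 2) *\<^sub>R coroot b" using sq[OF b(1)] by (simp add: coroot_def)
    then have "b \<bullet> \<omega> b' = ((b \<bullet> b) / 2) * (coroot b \<bullet> \<omega> b')" by (metis inner_scaleR_left)
    then show ?thesis using b om[OF b(1), of b'] sq by (auto simp: \<omega>'_def )
  qed
  have **: "{y. \<forall>c\<in>coroot ` B. 0 \<le> y \<bullet> \<omega>' c \<and> y \<bullet> \<omega>' c < 1} = {y. \<forall>b\<in>B. 0 \<le> y \<bullet> \<omega> b \<and> y \<bullet> \<omega> b < (b \<bullet> b) / 2}"
  proof -
    have "0 \<le> y \<bullet> \<omega>' (coroot b) \<and> y \<bullet> \<omega>' (coroot b) < 1 \<longleftrightarrow> 0 \<le> y \<bullet> \<omega> b \<and> y \<bullet> \<omega> b < (b \<bullet> b) / 2" if "b \<in> B" for y b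
      using sq[OF that] by (simp add: \<omega>'_def zero_le_divide_iff field_simps del: inner_gt_zero_iff)
    then show ?thesis by auto
  qed
  have W': "of_nat (card (weyl R)) * emeasure lborel d.A0 = ennreal (\<mu> * p)"
    using d.weyl_volume[OF om'] m(2)[of "\<lambda>b. (b \<bullet> b) / 2"] half unfolding ** weyl_coroot p_def by simp
  \<comment> \<open>The Weyl group is nonempty, so an infinite alcove volume would contradict the
    finite right-hand side of \<open>W'\<close>.\<close>
  obtain a where a: "emeasure lborel d.A0 = ennreal a" "a \<ge> 0"
  proof (cases "emeasure lborel d.A0")
    case top
    then have "of_nat (card (weyl R)) * emeasure lborel d.A0 = \<infinity>"
      using finite_weyl weyl_id by (auto simp: ennreal_mult_top)
    then show ?thesis using W' by simp
  qed (use that in auto)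
  have "real (card d.base_regions) * a = \<kappa> * p" "real (card (weyl R)) * a = \<mu> * p"
    using N W' a k(1) m(1) Ppos by (simp_all add: ennreal_of_nat_eq_real_of_nat flip: ennreal_mult)
  \<comment> \<open>Cross-multiplication eliminates the volume \<open>a\<close> of the dual alcove;
    after cancelling \<open>p\<close>, fact \<open>1\<close> removes the order of the Weyl
    group.\<close>
  then have "real (card d.base_regions) * (\<mu> * p) = real (card (weyl R)) * (\<kappa> * p)"
    by (metis mult.left_commute)
  then have "real (card d.base_regions) * \<mu> = real (card (weyl R)) * \<kappa>" using Ppos by simp
  then show ?thesis using 1 m(1) unfolding C_def by simp
qed

end

section \<open>Polynomial evaluation and algebraic sets\<close>

definition monom_value :: "('x \<Rightarrow> real) \<Rightarrow> ('x \<Rightarrow>\<^sub>0 nat) \<Rightarrow> real" where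
  "monom_value x m = (\<Prod>i\<in>Poly_Mapping.keys m. x i ^ Poly_Mapping.lookup m i)"

lemma monom_value_superset:
  assumes "finite S" "Poly_Mapping.keys m \<subseteq> S"
  shows "monom_value x m = (\<Prod>i\<in>S. x i ^ Poly_Mapping.lookup m i)"
  unfolding monom_value_def using assms
  by (intro prod.mono_neutral_left) (auto simp: in_keys_iff)

lemma monom_value_add: "monom_value x (m + n) = monom_value x m * monom_value x n"
proof -
  let ?S = "Poly_Mapping.keys m \<union> Poly_Mapping.keys n"
  have "Poly_Mapping.keys (m + n) \<subseteq> ?S" by (rule keys_add)
  then show ?thesis
    using monom_value_superset[of ?S "m + n" x] monom_value_superset[of ?S m x] monom_value_superset[of ?S n x]
    by (simp add: lookup_add power_add prod.distrib)
qed

lemma poly_mapping_sum_single: "(\<Sum>m\<in>Poly_Mapping.keys p. Poly_Mapping.single m (Poly_Mapping.lookup p m)) = p"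
  by (rule poly_mapping_eqI) (simp add: lookup_sum lookup_single when_def in_keys_iff)

text \<open>The coefficient map is a parameter because the ideal has integer coefficients while
  algebraic sets are cut out by real polynomials; both evaluations share the homomorphism laws
  below.\<close>

definition eval_hom :: "('c::comm_ring_1 \<Rightarrow> real) \<Rightarrow> ('x \<Rightarrow> real) \<Rightarrow> ('x, 'c) mpoly \<Rightarrow> real" where
  "eval_hom h x p = (\<Sum>m\<in>Poly_Mapping.keys p. h (Poly_Mapping.lookup p m) * monom_value x m)"

lemma eval_mpoly_eq_eval_hom: "eval_mpoly x p = eval_hom (\<lambda>c. c) x p"
  by (simp add: eval_mpoly_def eval_hom_def monom_value_def)

lemma lookup_real_mpoly: "Poly_Mapping.lookup (real_mpoly p) m = of_int (Poly_Mapping.lookup p m)"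
  by (simp add: real_mpoly_def Poly_Mapping.map.rep_eq when_def)

lemma keys_real_mpoly: "Poly_Mapping.keys (real_mpoly p) = Poly_Mapping.keys p"
  by (auto simp: in_keys_iff lookup_real_mpoly)

lemma eval_real_mpoly: "eval_mpoly x (real_mpoly p) = eval_hom real_of_int x p"
  by (simp add: eval_mpoly_eq_eval_hom eval_hom_def keys_real_mpoly lookup_real_mpoly)

lemma real_mpoly_polys_in: "p \<in> polys_in A \<Longrightarrow> real_mpoly p \<in> polys_in A"
  by (simp add: polys_in_def keys_real_mpoly)

locale coefficient_hom =
  fixes h :: "'c::comm_ring_1 \<Rightarrow> real"
  assumes h_add: "h (a + b) = h a + h b" and h_mult: "h (a * b) = h a * h b" and h_1: "h 1 = 1"
begin

lemma h_0: "h 0 = 0"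
  using h_add[of 0 0] by simp

lemma eval_superset:
  assumes "finite S" "Poly_Mapping.keys p \<subseteq> S"
  shows "eval_hom h x p = (\<Sum>m\<in>S. h (Poly_Mapping.lookup p m) * monom_value x m)"
  unfolding eval_hom_def using assms
  by (intro sum.mono_neutral_left) (auto simp: in_keys_iff h_0)

lemma eval_add: "eval_hom h x (p + q) = eval_hom h x p + eval_hom h x q"
proof -
  let ?S = "Poly_Mapping.keys p \<union> Poly_Mapping.keys q"
  have "Poly_Mapping.keys (p + q) \<subseteq> ?S" by (rule keys_add)
  then show ?thesis
    using eval_superset[of ?S "p + q" x] eval_superset[of ?S p x] eval_superset[of ?S q x]
    by (simp add: lookup_add h_add distrib_right sum.distrib)
qed

lemma eval_0: "eval_hom h x 0 = 0"
  by (simp add: eval_hom_def)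

lemma eval_sum: "eval_hom h x (sum f I) = (\<Sum>i\<in>I. eval_hom h x (f i))"
  by (induction I rule: infinite_finite_induct) (simp_all add: eval_0 eval_add)

lemma eval_single: "eval_hom h x (Poly_Mapping.single m c) = h c * monom_value x m"
  using eval_superset[of "{m}" "Poly_Mapping.single m c" x] by simp

lemma eval_mult: "eval_hom h x (p * q) = eval_hom h x p * eval_hom h x q"
proof -
  let ?s = "\<lambda>p m. Poly_Mapping.single m (Poly_Mapping.lookup p m)"
  have "p * q = (\<Sum>m\<in>Poly_Mapping.keys p. ?s p m) * (\<Sum>n\<in>Poly_Mapping.keys q. ?s q n)"
    by (simp only: poly_mapping_sum_single)
  also have "\<dots> = (\<Sum>m\<in>Poly_Mapping.keys p. \<Sum>n\<in>Poly_Mapping.keys q.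
      Poly_Mapping.single (m + n) (Poly_Mapping.lookup p m * Poly_Mapping.lookup q n))"
    by (simp add: sum_product mult_single)
  finally have "eval_hom h x (p * q) = (\<Sum>m\<in>Poly_Mapping.keys p. \<Sum>n\<in>Poly_Mapping.keys q.
      (h (Poly_Mapping.lookup p m) * monom_value x m) * (h (Poly_Mapping.lookup q n) * monom_value x n))"
    by (simp only: eval_sum eval_single h_mult monom_value_add mult_ac)
  then show ?thesis by (simp only: eval_hom_def sum_product)
qed

lemma eval_1: "eval_hom h x 1 = 1"
  using eval_single[of x 0 1] by (simp add: h_1 monom_value_def)

lemma eval_prod: "eval_hom h x (prod f I) = (\<Prod>i\<in>I. eval_hom h x (f i))"
  by (induction I rule: infinite_finite_induct) (simp_all add: eval_1 eval_mult)

lemma eval_uminus: "eval_hom h x (- p) = - eval_hom h x p"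
  using eval_add[of x p "- p"] eval_0[of x] by simp

lemma eval_diff: "eval_hom h x (p - q) = eval_hom h x p - eval_hom h x q"
  using eval_add[of x p "- q"] eval_uminus[of x q] by simp

lemma eval_of_nat: "eval_hom h x (of_nat n) = of_nat n"
  by (induction n) (simp_all add: eval_0 eval_add eval_1)

lemma eval_of_int: "eval_hom h x (of_int n) = of_int n"
  by (cases n rule: int_cases2) (simp_all add: eval_of_nat eval_uminus)

lemma eval_var: "eval_hom h x (var i) = x i"
  by (simp add: var_def eval_single h_1 monom_value_def)

end

interpretation real_eval: coefficient_hom "\<lambda>c::real. c"
  by unfold_locales auto

interpretation int_eval: coefficient_hom real_of_int
  by unfold_locales auto

lemma polys_in_add: "p \<in> polys_in A \<Longrightarrow> q \<in> polys_in A \<Longrightarrow> p + q \<in> polys_in A"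
  unfolding polys_in_def using keys_add[of p q] by blast

lemma polys_in_uminus: "p \<in> polys_in A \<Longrightarrow> - p \<in> polys_in A"
  by (simp add: polys_in_def in_keys_iff)

lemma polys_in_diff: "p \<in> polys_in A \<Longrightarrow> q \<in> polys_in A \<Longrightarrow> p - q \<in> polys_in A"
  using polys_in_add[of p A "- q"] polys_in_uminus[of q A] by simp

lemma polys_in_mult: 
  fixes p q :: "('x, 'c::comm_ring_1) mpoly"
  assumes "p \<in> polys_in A" "q \<in> polys_in A" shows "p * q \<in> polys_in A"
  unfolding polys_in_def
proof (intro CollectI ballI)
  fix m assume "m \<in> Poly_Mapping.keys (p * q)"
  then obtain a b where "m = a + b" "a \<in> Poly_Mapping.keys p" "b \<in> Poly_Mapping.keys q"
    using keys_mult[of p q] by blast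
  then show "Poly_Mapping.keys m \<subseteq> A"
    using assms keys_add[of a b] by (fastforce simp: polys_in_def)
qed

lemma polys_in_0: "0 \<in> polys_in A" and polys_in_1: "1 \<in> polys_in A"
  by (simp_all add: polys_in_def)

lemma polys_in_sum: "(\<And>i. i \<in> I \<Longrightarrow> f i \<in> polys_in A) \<Longrightarrow> sum f I \<in> polys_in A"
  by (induction I rule: infinite_finite_induct) (simp_all add: polys_in_0 polys_in_add)

lemma polys_in_of_nat: "of_nat n \<in> polys_in A"
  by (induction n) (simp_all add: polys_in_0 polys_in_1 polys_in_add)

lemma polys_in_of_int: "of_int n \<in> polys_in A"
  by (cases n rule: int_cases2) (simp_all add: polys_in_of_nat polys_in_uminus)

lemma polys_in_var: "i \<in> A \<Longrightarrow> var i \<in> polys_in A"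
  by (simp add: polys_in_def var_def)

section \<open>Algebraic sets and irreducible components\<close>

lemma algebraic_Int:
  assumes "algebraic_set A Y" "algebraic_set A Z" shows "algebraic_set A (Y \<inter> Z)"
proof -
  obtain S T where "S \<subseteq> polys_in A" "T \<subseteq> polys_in A" "Y = zero_locus A S" "Z = zero_locus A T"
    using assms unfolding algebraic_set_def by blast
  then show ?thesis
    unfolding algebraic_set_def by (intro exI[of _ "S \<union> T"]) (auto simp: zero_locus_def)
qed

lemma algebraic_empty: "algebraic_set A {}"
  unfolding algebraic_set_def
  by (intro exI[of _ "{1}"]) (auto simp: zero_locus_def polys_in_1 eval_mpoly_eq_eval_hom real_eval.eval_1)

text \<open>Products of one equation from each side cut out the union, since the reals have no zero
  divisors.\<close>

lemma algebraic_Un: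
  assumes "algebraic_set A Y" "algebraic_set A Z" shows "algebraic_set A (Y \<union> Z)"
proof -
  obtain S T where *: "S \<subseteq> polys_in A" "T \<subseteq> polys_in A" "Y = zero_locus A S" "Z = zero_locus A T"
    using assms unfolding algebraic_set_def by blast
  let ?U = "{p * q | p q. p \<in> S \<and> q \<in> T}"
  have "Y \<union> Z = zero_locus A ?U"
    unfolding * zero_locus_def
    by (auto simp: eval_mpoly_eq_eval_hom real_eval.eval_mult) (metis mult_eq_0_iff real_eval.eval_mult)
  moreover have "?U \<subseteq> polys_in A" using * polys_in_mult by blast
  ultimately show ?thesis unfolding algebraic_set_def by blast
qed

lemma algebraic_UN:
  assumes "finite L" "\<And>l. l \<in> L \<Longrightarrow> algebraic_set A (Z l)"
  shows "algebraic_set A (\<Union>l\<in>L. Z l)"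
  using assms by (induction L rule: finite_induct) (simp_all add: algebraic_empty algebraic_Un)

definition line_point :: "'x set \<Rightarrow> ('x \<Rightarrow> real) \<Rightarrow> ('x \<Rightarrow> real) \<Rightarrow> real \<Rightarrow> 'x \<Rightarrow> real" where
  "line_point A y z t = (\<lambda>i\<in>A. y i + t * (z i - y i))"

lemma eval_line_point: "\<exists>P. \<forall>t. eval_mpoly (line_point A y z t) p = poly P t"
proof -
  \<comment> \<open>Outside \<open>A\<close> the points of the line have the default value
    \<open>undefined\<close>, which is a constant polynomial in the parameter.\<close>
  define L where "L i = (if i \<in> A then [:y i, z i - y i:] else [:undefined:])" for i
  have L: "line_point A y z t i = poly (L i) t" for t i
    by (simp add: line_point_def L_def)
  let ?P = "\<Sum>m\<in>Poly_Mapping.keys p. smult (Poly_Mapping.lookup p m)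
         (\<Prod>i\<in>Poly_Mapping.keys m. L i ^ Poly_Mapping.lookup m i)"
  have "eval_mpoly (line_point A y z t) p = poly ?P t" for t
    by (simp add: eval_mpoly_def L poly_sum poly_prod)
  then show ?thesis by blast
qed

text \<open>A set containing the line through any two of its points is irreducible: if two polynomials
  do not vanish at two points, their restrictions to the line are nonzero univariate polynomials.\<close>

lemma irreducible_affine:
  assumes alg: "algebraic_set A Z" and ne: "Z \<noteq> {}"
    and line: "\<And>y z t. y \<in> Z \<Longrightarrow> z \<in> Z \<Longrightarrow> line_point A y z t \<in> Z"
  shows "irreducible_algebraic_set A Z"
  unfolding irreducible_algebraic_set_def
proof (intro conjI allI impI alg ne)
  fix Y1 Y2 assume h: "algebraic_set A Y1 \<and> algebraic_set A Y2 \<and> Z = Y1 \<union> Y2"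
  then obtain S1 S2 where S: "Y1 = zero_locus A S1" "Y2 = zero_locus A S2"
    unfolding algebraic_set_def by blast
  have ext: "x \<in> A \<rightarrow>\<^sub>E UNIV" if "x \<in> Z" for x using that h S by (auto simp: zero_locus_def)
  show "Z = Y1 \<or> Z = Y2"
  proof (rule ccontr)
    assume "\<not> ?thesis"
    then obtain y z where yz: "y \<in> Z" "y \<notin> Y1" "z \<in> Z" "z \<notin> Y2" using h by blast
    obtain p where p: "p \<in> S1" "eval_mpoly y p \<noteq> 0" using yz ext S by (auto simp: zero_locus_def)
    obtain q where q: "q \<in> S2" "eval_mpoly z q \<noteq> 0" using yz ext S by (auto simp: zero_locus_def)
    obtain P Q where PQ: "\<And>t. eval_mpoly (line_point A y z t) p = poly P t"
      "\<And>t. eval_mpoly (line_point A y z t) q = poly Q t"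
      using eval_line_point by metis
    have ends: "line_point A y z 0 = y" "line_point A y z 1 = z"
      using ext[OF yz(1)] ext[OF yz(3)] by (auto simp: line_point_def fun_eq_iff PiE_def extensional_def)
    have "poly P 0 \<noteq> 0" "poly Q 1 \<noteq> 0" using p q PQ(1)[of 0] PQ(2)[of 1] ends by auto
    then have "P * Q \<noteq> 0" by auto
    then obtain t where t: "poly (P * Q) t \<noteq> 0" using poly_all_0_iff_0 by blast
    have "line_point A y z t \<in> Y1 \<union> Y2" using line yz h by blast
    then have "eval_mpoly (line_point A y z t) p = 0 \<or> eval_mpoly (line_point A y z t) q = 0"
      using S p q by (auto simp: zero_locus_def)
    then show False using t PQ by auto
  qed
qed

text \<open>Intersecting with one of the sets and with the union of the others gives a decomposition
  into two algebraic sets; irreducibility selects one of them.\<close>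

lemma irreducible_subset_UN:
  assumes "finite L" "\<And>l. l \<in> L \<Longrightarrow> algebraic_set A (Z l)"
    and "irreducible_algebraic_set A Y" "Y \<subseteq> (\<Union>l\<in>L. Z l)"
  shows "\<exists>l\<in>L. Y \<subseteq> Z l"
  using assms
proof (induction L rule: finite_induct)
  case empty
  then show ?case by (auto simp: irreducible_algebraic_set_def)
next
  case (insert a L)
  have Y: "algebraic_set A Y" using insert.prems by (simp add: irreducible_algebraic_set_def)
  have "Y = (Y \<inter> Z a) \<union> (Y \<inter> (\<Union>l\<in>L. Z l))" using insert.prems by auto
  moreover have "algebraic_set A (Y \<inter> Z a)" "algebraic_set A (Y \<inter> (\<Union>l\<in>L. Z l))"
    using insert Y by (auto intro!: algebraic_Int algebraic_UN)
  ultimately have "Y = Y \<inter> Z a \<or> Y = Y \<inter> (\<Union>l\<in>L. Z l)"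
    using insert.prems(2) unfolding irreducible_algebraic_set_def by metis
  then show ?case
  proof
    assume "Y = Y \<inter> (\<Union>l\<in>L. Z l)"
    then have "Y \<subseteq> (\<Union>l\<in>L. Z l)" by blast
    then show ?thesis using insert by blast
  qed blast
qed

text \<open>Every irreducible subset lies in one of the pieces, so components are pieces. Conversely
  each piece is maximal, since disjoint nonempty pieces cannot contain one another.\<close>

lemma irreducible_components_disjoint_UN:
  assumes fin: "finite L" and irr: "\<And>l. l \<in> L \<Longrightarrow> irreducible_algebraic_set A (Z l)"
    and disj: "disjoint_family_on Z L"
  shows "irreducible_components A (\<Union>l\<in>L. Z l) = Z ` L"
proof
  have alg: "\<And>l. l \<in> L \<Longrightarrow> algebraic_set A (Z l)" and ne: "\<And>l. l \<in> L \<Longrightarrow> Z l \<noteq> {}"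
    using irr by (auto simp: irreducible_algebraic_set_def)
  show "irreducible_components A (\<Union>l\<in>L. Z l) \<subseteq> Z ` L"
  proof
    fix Y assume Y: "Y \<in> irreducible_components A (\<Union>l\<in>L. Z l)"
    then have Y': "irreducible_algebraic_set A Y" "Y \<subseteq> (\<Union>l\<in>L. Z l)"
      "\<And>Z'. irreducible_algebraic_set A Z' \<Longrightarrow> Y \<subseteq> Z' \<Longrightarrow> Z' \<subseteq> (\<Union>l\<in>L. Z l) \<Longrightarrow> Z' = Y"
      by (auto simp: irreducible_components_def)
    obtain l where l: "l \<in> L" "Y \<subseteq> Z l" using irreducible_subset_UN[OF fin alg Y'(1,2)] by blast
    then have "Z l = Y" using Y'(3)[of "Z l"] irr by blast
    then show "Y \<in> Z ` L" using l by blast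
  qed
  show "Z ` L \<subseteq> irreducible_components A (\<Union>l\<in>L. Z l)"
  proof
    fix Y assume "Y \<in> Z ` L"
    then obtain l where l: "l \<in> L" "Y = Z l" by blast
    have "Y' = Y" if Y': "irreducible_algebraic_set A Y'" "Y \<subseteq> Y'" "Y' \<subseteq> (\<Union>l\<in>L. Z l)" for Y'
    proof -
      obtain l' where l': "l' \<in> L" "Y' \<subseteq> Z l'" using irreducible_subset_UN[OF fin alg Y'(1,3)] by blast
      then have "l' = l" using disj l ne[OF l(1)] Y'(2) unfolding disjoint_family_on_def by blast
      then show ?thesis using l l' Y'(2) by blast
    qed
    then show "Y \<in> irreducible_components A (\<Union>l\<in>L. Z l)"
      using l irr by (auto simp: irreducible_components_def)
  qed
qed

section \<open>The Shi variety\<close>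

text \<open>The reflections of the theorem belong to the affine roots of the dual system, because
  taking coroots twice returns \<alpha>.\<close>

lemma affine_reflection_eq_arefl: "affine_reflection \<alpha> m = arefl (coroot \<alpha>, m)"
  by (simp add: fun_eq_iff affine_reflection_def arefl_def aval_def inner_coroot)

lemma word_Bij: "word as \<in> Bij UNIV"
  using bij_word by (simp add: Bij_def)

lemma BijGroup_mult_word: "word as \<otimes>\<^bsub>BijGroup UNIV\<^esub> word bs = word (as @ bs)"
  using word_Bij[of as] word_Bij[of bs]
  by (simp add: BijGroup_def compose_def word_append fun_eq_iff)

lemma BijGroup_one_word: "\<one>\<^bsub>BijGroup UNIV\<^esub> = word []"
  by (simp add: BijGroup_def fun_eq_iff)

text \<open>Each generator is its own inverse, so the generated group consists of the words in the
  generators.\<close>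

lemma affine_weyl_group_words:
  "affine_weyl_group R = {word as | as. fst ` set as \<subseteq> coroot ` R}"
proof
  let ?G = "BijGroup UNIV :: ('a \<Rightarrow> 'a) monoid"
  interpret group ?G by (rule group_BijGroup)
  have carrier: "word as \<in> carrier ?G" for as using word_Bij by (simp add: BijGroup_def)
  have gen: "affine_reflection \<alpha> m = word [(coroot \<alpha>, m)]" for \<alpha> :: 'a and m
    by (simp add: affine_reflection_eq_arefl)
  have inv: "inv\<^bsub>?G\<^esub> word [a] = word [a]" for a
  proof (rule inv_equality)
    show "word [a] \<otimes>\<^bsub>?G\<^esub> word [a] = \<one>\<^bsub>?G\<^esub>"
      unfolding BijGroup_mult_word BijGroup_one_word by (simp add: fun_eq_iff)
  qed (rule carrier)+
  show "affine_weyl_group R \<subseteq> {word as | as. fst ` set as \<subseteq> coroot ` R}"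
  proof
    fix w assume "w \<in> affine_weyl_group R"
    then show "w \<in> {word as | as. fst ` set as \<subseteq> coroot ` R}"
      unfolding affine_weyl_group_def
    proof (induction rule: generate.induct)
      case one
      show ?case unfolding BijGroup_one_word by (intro CollectI exI[of _ "[]"]) simp
    next
      case (incl h)
      then obtain \<alpha> m where "\<alpha> \<in> R" "h = word [(coroot \<alpha>, m)]" using gen by auto
      then show ?case by (intro CollectI exI[of _ "[(coroot \<alpha>, m)]"]) auto
    next
      case (inv h)
      then obtain \<alpha> m where "\<alpha> \<in> R" "h = word [(coroot \<alpha>, m)]" using gen by auto
      then show ?case using inv by (intro CollectI exI[of _ "[(coroot \<alpha>, m)]"]) (simp only: \<open>\<And>a. inv\<^bsub>?G\<^esub> word [a] = word [a]\<close>, auto)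
    next
      case (eng h1 h2)
      then obtain as bs where "fst ` set as \<subseteq> coroot ` R" "h1 = word as" "fst ` set bs \<subseteq> coroot ` R" "h2 = word bs"
        by blast
      then show ?case by (intro CollectI exI[of _ "as @ bs"]) (auto simp only: BijGroup_mult_word set_append image_Un)
    qed
  qed
  have "word as \<in> affine_weyl_group R" if "fst ` set as \<subseteq> coroot ` R" for as
    using that
  proof (induction as)
    case Nil
    show ?case unfolding affine_weyl_group_def BijGroup_one_word[symmetric] by (rule generate.one)
  next
    case (Cons a as)
    then obtain \<alpha> where "\<alpha> \<in> R" "a = (coroot \<alpha>, snd a)" by (metis fst_conv image_eqI image_iff list.set_intros(1) prod.collapse subsetD)
    then have "word [a] \<in> affine_weyl_group R"
      unfolding affine_weyl_group_def by (intro generate.incl) (metis (mono_tags, lifting) gen mem_Collect_eq)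
    then have "word [a] \<otimes>\<^bsub>?G\<^esub> word as \<in> affine_weyl_group R"
      using Cons unfolding affine_weyl_group_def by (intro generate.eng) auto
    then show ?case unfolding BijGroup_mult_word by (simp add: o_def)
  qed
  then show "{word as | as. fst ` set as \<subseteq> coroot ` R} \<subseteq> affine_weyl_group R" by blast
qed

section \<open>Shi coordinates through the dual system\<close>

context root_system
begin

interpretation dual: root_system "coroot ` R" "coroot ` B"
  by (rule root_system_coroot)

text \<open>Transports a tuple on the positive roots to all coroots; the rule at negative coroots is
  the one demanded by the first condition of \<open>shi\<close>.\<close>

definition extend :: "('v \<Rightarrow> int) \<Rightarrow> 'v \<Rightarrow> int" where
  "extend k \<gamma> = (if \<gamma> \<in> coroot ` P then k (coroot \<gamma>) else - k (- coroot \<gamma>) - 1)"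

lemma extend_coroot: "\<alpha> \<in> P \<Longrightarrow> extend k (coroot \<alpha>) = k \<alpha>"
  by (simp add: extend_def)

lemma extend_uminus:
  assumes "\<gamma> \<in> coroot ` R" shows "extend k (- \<gamma>) = - extend k \<gamma> - 1"
  using assms dual.uminus_P_iff[OF assms] by (simp add: extend_def positive_roots_coroot)

lemma dual_P_cases:
  assumes "\<gamma> \<in> coroot ` R" obtains \<alpha> where "\<alpha> \<in> P" "\<gamma> = coroot \<alpha>" | \<alpha> where "\<alpha> \<in> P" "\<gamma> = - coroot \<alpha>"
  using dual.uminus_P_iff[OF assms] unfolding positive_roots_coroot
  by (metis add.inverse_inverse imageE)

text \<open>The strip of a negative coroot at level -k - 1 is the strip of its negative at level k,
  so the added coordinates impose no new condition.\<close>

lemma region_extend: "dual.region (extend k) = (\<Inter>\<alpha>\<in>P. strip \<alpha> (k \<alpha>))"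
proof (intro subset_antisym subsetI)
  fix x assume x: "x \<in> dual.region (extend k)"
  show "x \<in> (\<Inter>\<alpha>\<in>P. strip \<alpha> (k \<alpha>))"
  proof
    fix \<alpha> assume a: "\<alpha> \<in> P"
    then have "coroot \<alpha> \<in> coroot ` R" using P_R by blast
    then show "x \<in> strip \<alpha> (k \<alpha>)"
      using x extend_coroot[OF a, of k] unfolding dual.region_def strip_def by force
  qed
next
  fix x assume x: "x \<in> (\<Inter>\<alpha>\<in>P. strip \<alpha> (k \<alpha>))"
  show "x \<in> dual.region (extend k)" unfolding dual.region_def
  proof (intro CollectI ballI)
    fix \<gamma> assume g: "\<gamma> \<in> coroot ` R"
    then show "of_int (extend k \<gamma>) < x \<bullet> \<gamma> \<and> x \<bullet> \<gamma> < of_int (extend k \<gamma>) + 1"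
    proof (cases rule: dual_P_cases)
      case (1 \<alpha>)
      then show ?thesis using x extend_coroot[OF 1(1), of k] by (auto simp: strip_def)
    next
      case (2 \<alpha>)
      then have "coroot \<alpha> \<in> coroot ` R" using P_R by blast
      then have "extend k \<gamma> = - k \<alpha> - 1" using extend_coroot[OF 2(1), of k] extend_uminus 2 by simp
      then show ?thesis using x 2 by (auto simp: strip_def)
    qed
  qed
qed

lemma fundamental_alcove_eq: "fundamental_alcove R B = dual.A0"
proof -
  have "dual.region (extend (\<lambda>_. 0)) = dual.A0"
    by (rule dual.region_cong) (simp add: extend_def dual.base_coords_def positive_roots_coroot)
  then show ?thesis by (simp add: fundamental_alcove_def region_extend)
qed

text \<open>Every relation is rewritten as a sum of positive coroots, for instance a = (a + b) +
  (-b) when b is negative. The -1 in the sign rule turns the window from 0 to 1 into itself, so the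
  inequalities keep their form.\<close>

lemma shi_extend:
  assumes "shi_system R B k" shows "dual.shi (extend k)"
proof -
  let ?K = "extend k"
  have pos: "?K a + ?K b \<le> ?K (a + b) \<and> ?K (a + b) \<le> ?K a + ?K b + 1"
    if "a \<in> dual.P" "b \<in> dual.P" "a + b \<in> dual.P" for a b
  proof -
    from that obtain \<alpha> \<beta> \<gamma> where *: "\<alpha> \<in> P" "\<beta> \<in> P" "\<gamma> \<in> P" "a = coroot \<alpha>" "b = coroot \<beta>" "a + b = coroot \<gamma>"
      unfolding positive_roots_coroot by blast
    then show ?thesis using assms extend_coroot[of _ k] unfolding shi_system_def by metis
  qed
  show ?thesis
    unfolding dual.shi_def
  proof (intro conjI ballI impI)
    fix a b assume ab: "a \<in> coroot ` R" "b \<in> coroot ` R" "a + b \<in> coroot ` R"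
    have odd: "?K (- a) = - ?K a - 1" "?K (- b) = - ?K b - 1" "?K (- (a + b)) = - ?K (a + b) - 1"
      using extend_uminus[of _ k] ab by blast+
    note iff = dual.uminus_P_iff[OF ab(1)] dual.uminus_P_iff[OF ab(2)] dual.uminus_P_iff[OF ab(3)]
    have "?K a + ?K b \<le> ?K (a + b) \<and> ?K (a + b) \<le> ?K a + ?K b + 1"
    proof (cases "a \<in> dual.P"; cases "b \<in> dual.P"; cases "a + b \<in> dual.P")
      assume "a \<in> dual.P" "b \<in> dual.P" "a + b \<in> dual.P"
      then show ?thesis using pos by blast
    next
      assume "a \<in> dual.P" "b \<in> dual.P" "a + b \<notin> dual.P"
      then show ?thesis using dual.P_add ab by blast
    next
      assume "a \<in> dual.P" "b \<notin> dual.P" "a + b \<in> dual.P"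
      then show ?thesis using pos[of "a + b" "- b"] iff odd by simp
    next
      assume "a \<in> dual.P" "b \<notin> dual.P" "a + b \<notin> dual.P"
      then show ?thesis using pos[of a "- (a + b)"] iff odd by simp
    next
      assume "a \<notin> dual.P" "b \<in> dual.P" "a + b \<in> dual.P"
      then show ?thesis using pos[of "a + b" "- a"] iff odd by simp
    next
      assume "a \<notin> dual.P" "b \<in> dual.P" "a + b \<notin> dual.P"
      then show ?thesis using pos[of b "- (a + b)"] iff odd by simp
    next
      assume "a \<notin> dual.P" "b \<notin> dual.P" "a + b \<in> dual.P"
      then show ?thesis using dual.P_add[of "- a" "- b"] iff ab dual.R_uminus[of "a + b"] by auto
    next
      assume "a \<notin> dual.P" "b \<notin> dual.P" "a + b \<notin> dual.P"
      then show ?thesis using pos[of "- a" "- b"] iff odd by simp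
    qed
    then show "?K a + ?K b \<le> ?K (a + b)" "?K (a + b) \<le> ?K a + ?K b + 1" by auto
  qed (rule extend_uminus)
qed

lemma shi_restrict: "dual.shi K \<Longrightarrow> shi_system R B (\<lambda>\<alpha>. K (coroot \<alpha>))"
  unfolding shi_system_def dual.shi_def by (metis P_R image_eqI)

lemma extend_restrict:
  assumes "dual.shi K" "\<gamma> \<in> coroot ` R" shows "extend (\<lambda>\<alpha>. K (coroot \<alpha>)) \<gamma> = K \<gamma>"
  using assms(2)
proof (cases rule: dual_P_cases)
  case (1 \<alpha>)
  then show ?thesis by (simp add: extend_coroot)
next
  case (2 \<alpha>)
  then have "coroot \<alpha> \<in> coroot ` R" using P_R by blast
  then show ?thesis using 2 by (simp add: extend_uminus extend_coroot dual.shi_uminus[OF assms(1)])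
qed

lemma shi_system_cong: "(\<And>\<alpha>. \<alpha> \<in> P \<Longrightarrow> k \<alpha> = l \<alpha>) \<Longrightarrow> shi_system R B k \<longleftrightarrow> shi_system R B l"
  unfolding shi_system_def by (simp cong: ball_cong)

lemma strips_nonempty: "shi_system R B k \<Longrightarrow> (\<Inter>\<alpha>\<in>P. strip \<alpha> (k \<alpha>)) \<noteq> {}"
  using dual.shi_imp_word[OF shi_extend, of k] dual.x0_A0 by (auto simp flip: region_extend)

lemma strip_unique: "x \<in> strip \<alpha> i \<Longrightarrow> x \<in> strip \<alpha> j \<Longrightarrow> i = j"
  by (auto simp: strip_def)

lemma strips_eq_imp:
  assumes "(\<Inter>\<alpha>\<in>P. strip \<alpha> (k \<alpha>)) = (\<Inter>\<alpha>\<in>P. strip \<alpha> (l \<alpha>))" "shi_system R B k" "\<alpha> \<in> P"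
  shows "k \<alpha> = l \<alpha>"
proof -
  obtain x where "x \<in> (\<Inter>\<alpha>\<in>P. strip \<alpha> (k \<alpha>))" using strips_nonempty[OF assms(2)] by blast
  then have "x \<in> strip \<alpha> (k \<alpha>)" "x \<in> strip \<alpha> (l \<alpha>)" using assms by auto
  then show ?thesis by (rule strip_unique)
qed

lemma affine_weyl_group_iff: "w \<in> affine_weyl_group R \<longleftrightarrow> (\<exists>as. set as \<subseteq> dual.affine_roots \<and> w = word as)"
  unfolding affine_weyl_group_words dual.affine_roots_def by force

lemma alcove_coordinates_exist:
  assumes "w \<in> affine_weyl_group R"
  obtains k where "shi_system R B k" "alcove_coordinates R B w k"
proof -
  obtain as where as: "set as \<subseteq> dual.affine_roots" "w = word as" using assms affine_weyl_group_iff by blast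
  obtain K where K: "dual.shi K" "word as ` dual.A0 = dual.region K" using dual.word_imp_shi[OF as(1)] by blast
  define k where "k = (\<lambda>\<alpha>\<in>P. K (coroot \<alpha>))"
  have "(\<Inter>\<alpha>\<in>P. strip \<alpha> (k \<alpha>)) = (\<Inter>\<alpha>\<in>P. strip \<alpha> (K (coroot \<alpha>)))" by (simp add: k_def)
  also have "\<dots> = dual.region (extend (\<lambda>\<alpha>. K (coroot \<alpha>)))" by (simp add: region_extend)
  also have "\<dots> = dual.region K" using extend_restrict[OF K(1)] by (intro dual.region_cong) blast
  finally have "alcove_coordinates R B w k"
    using K as by (simp add: alcove_coordinates_def fundamental_alcove_eq k_def)
  moreover have "shi_system R B k" using shi_restrict[OF K(1)] by (subst shi_system_cong) (auto simp: k_def)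
  ultimately show ?thesis using that by blast
qed

text \<open>Shi's relations for \<open>k\<close> make the common intersection of strips nonempty,
  and a point of it determines all levels. An empty intersection would not determine the
  tuple.\<close>

lemma alcove_coordinates_unique:
  assumes "shi_system R B k" "alcove_coordinates R B w k" "alcove_coordinates R B w l"
  shows "l = k"
proof
  fix \<alpha>
  show "l \<alpha> = k \<alpha>"
  proof (cases "\<alpha> \<in> P")
    case True
    then show ?thesis using strips_eq_imp[of k l \<alpha>] assms unfolding alcove_coordinates_def by simp
  next
    case False
    then show ?thesis using assms unfolding alcove_coordinates_def by (metis PiE_arb)
  qed
qed

lemma shi_coordinates_eq:
  "shi_system R B k \<Longrightarrow> alcove_coordinates R B w k \<Longrightarrow> shi_coordinates R B w = k"
  unfolding shi_coordinates_def using alcove_coordinates_unique by (intro the_equality) blast+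

text \<open>The meeting point of the two halves of the bijection: the image of \<open>iota\<close>
  and the integral points of the Shi variety are both shown to be this set.\<close>

definition shi_points :: "('v \<Rightarrow> real) set" where
  "shi_points = {(\<lambda>\<alpha>\<in>P. real_of_int (k \<alpha>)) | k. shi_system R B k}"

lemma inj_on_iota: "inj_on (iota R B) (affine_weyl_group R)"
proof (rule inj_onI)
  fix w w' assume h: "w \<in> affine_weyl_group R" "w' \<in> affine_weyl_group R" "iota R B w = iota R B w'"
  obtain k where k: "shi_system R B k" "alcove_coordinates R B w k" using alcove_coordinates_exist h by blast
  obtain l where l: "shi_system R B l" "alcove_coordinates R B w' l" using alcove_coordinates_exist h by blast
  have "k \<alpha> = l \<alpha>" if "\<alpha> \<in> P" for \<alpha>
    using fun_cong[OF h(3), of \<alpha>] shi_coordinates_eq[OF k] shi_coordinates_eq[OF l] that by (simp add: iota_def)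
  then have eq: "w ` dual.A0 = w' ` dual.A0"
    using k l by (simp add: alcove_coordinates_def fundamental_alcove_eq)
  obtain as bs where "set as \<subseteq> dual.affine_roots" "w = word as" "set bs \<subseteq> dual.affine_roots" "w' = word bs"
    using h affine_weyl_group_iff by blast
  moreover have "w dual.x0 \<in> w ` dual.A0" using dual.x0_A0 by blast
  moreover have "w dual.x0 \<in> w' ` dual.A0" using dual.x0_A0 eq by blast
  ultimately show "w = w'" using dual.word_free by blast
qed

text \<open>One inclusion is that words carry coordinates to solutions of Shi's relations; the other
  is Shi's theorem \<open>shi_imp_word\<close> in the dual system.\<close>

lemma iota_image: "iota R B ` affine_weyl_group R = shi_points"
proof (intro subset_antisym subsetI)
  fix x assume "x \<in> iota R B ` affine_weyl_group R"
  then obtain w where w: "w \<in> affine_weyl_group R" "x = iota R B w" by blast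
  obtain k where k: "shi_system R B k" "alcove_coordinates R B w k" using alcove_coordinates_exist w by blast
  then have "x = (\<lambda>\<alpha>\<in>P. real_of_int (k \<alpha>))" using w shi_coordinates_eq by (simp add: iota_def)
  then show "x \<in> shi_points" using k unfolding shi_points_def by blast
next
  fix x assume "x \<in> shi_points"
  then obtain k where k: "shi_system R B k" "x = (\<lambda>\<alpha>\<in>P. real_of_int (k \<alpha>))" by (auto simp: shi_points_def)
  obtain as where as: "set as \<subseteq> dual.simple_affine_roots" "dual.region (extend k) = word as ` dual.A0"
    using dual.shi_imp_word[OF shi_extend[OF k(1)]] by blast
  have w: "word as \<in> affine_weyl_group R"
    unfolding affine_weyl_group_iff using dual.simple_affine_subset[OF as(1)] by blast
  have "alcove_coordinates R B (word as) (restrict k P)"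
    using as(2) by (simp add: alcove_coordinates_def fundamental_alcove_eq region_extend)
  moreover have "shi_system R B (restrict k P)" using k(1) by (subst shi_system_cong) auto
  ultimately have "iota R B (word as) = x" using k shi_coordinates_eq by (auto simp: iota_def)
  then show "x \<in> iota R B ` affine_weyl_group R" using w by blast
qed

section \<open>Components of the Shi variety\<close>

lemma coroot_coeff: "\<alpha> \<in> R \<Longrightarrow> b \<in> B \<Longrightarrow>
    real_of_int (coroot_coeff B \<alpha> b) = representation (coroot ` B) (coroot \<alpha>) (coroot b)"
  using dual.representation_Ints[of "coroot \<alpha>" "coroot b"] by (auto simp: coroot_coeff_def elim!: Ints_cases)

lemma coroot_coeff_eqI: "\<alpha> \<in> R \<Longrightarrow> b \<in> B \<Longrightarrow>
    representation (coroot ` B) (coroot \<alpha>) (coroot b) = of_int n \<Longrightarrow> coroot_coeff B \<alpha> b = n"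
  using coroot_coeff[of \<alpha> b] by simp

lemma coroot_coeff_simple: "b \<in> B \<Longrightarrow> b' \<in> B \<Longrightarrow> coroot_coeff B b b' = (if b' = b then 1 else 0)"
  using independent_coroot_B by (intro coroot_coeff_eqI) (auto simp: B_R real_vector.representation_basis)

lemma coroot_coeff_add:
  assumes "\<alpha> \<in> R" "\<beta> \<in> R" "\<gamma> \<in> R" "coroot \<alpha> + coroot \<beta> = coroot \<gamma>" "b \<in> B"
  shows "coroot_coeff B \<gamma> b = coroot_coeff B \<alpha> b + coroot_coeff B \<beta> b"
  using assms independent_coroot_B span_coroot_B
  by (intro coroot_coeff_eqI) (simp_all add: coroot_coeff real_vector.representation_add flip: assms(4))

lemma coroot_height: "\<alpha> \<in> R \<Longrightarrow> real_of_int (coroot_height B \<alpha>) = coroot \<alpha> \<bullet> dual.rho"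
  by (simp add: coroot_height_def dual.height_sum sum.reindex[OF inj_coroot] coroot_coeff)

text \<open>This is the value of \<open>P_poly\<close> at the point \<open>k\<close>. The scalar
  type is left open because it is applied to integer tuples and to real points.\<close>

definition linear_part :: "('v \<Rightarrow> 'c::comm_ring_1) \<Rightarrow> 'v \<Rightarrow> 'c" where
  "linear_part k \<alpha> = (\<Sum>b\<in>B. of_int (coroot_coeff B \<alpha> b) * k b)"

lemma linear_part_simple: "b \<in> B \<Longrightarrow> linear_part k b = k b"
proof -
  assume b: "b \<in> B"
  have "linear_part k b = (\<Sum>b'\<in>B. if b' = b then k b' else 0)"
    unfolding linear_part_def by (intro sum.cong) (auto simp: coroot_coeff_simple b)
  then show ?thesis using b finite_B by simp
qed

lemma linear_part_add:
  assumes "\<alpha> \<in> R" "\<beta> \<in> R" "\<gamma> \<in> R" "coroot \<alpha> + coroot \<beta> = coroot \<gamma>"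
  shows "linear_part k \<gamma> = linear_part k \<alpha> + linear_part k \<beta>"
  unfolding linear_part_def sum.distrib[symmetric]
  by (intro sum.cong) (simp_all add: coroot_coeff_add[OF assms] distrib_right)

lemma linear_part_of_int: "real_of_int (linear_part k \<alpha>) = linear_part (\<lambda>b. real_of_int (k b)) \<alpha>"
  by (simp add: linear_part_def)

text \<open>\<open>linear_part\<close> is additive along sums of coroots, so it cancels in each
  relation. Geometrically the alcove is translated by a vector with integral pairings with the
  coroots.\<close>

lemma shi_system_shift:
  "shi_system R B (\<lambda>\<alpha>. k \<alpha> + linear_part m \<alpha>) \<longleftrightarrow> shi_system R B k"
proof -
  have lin: "linear_part m \<gamma> = linear_part m \<alpha> + linear_part m \<beta>"
    if "\<alpha> \<in> P" "\<beta> \<in> P" "\<gamma> \<in> P" "coroot \<alpha> + coroot \<beta> = coroot \<gamma>" for \<alpha> \<beta> \<gamma>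
    using that P_R linear_part_add by blast
  have "(coroot \<alpha> + coroot \<beta> = coroot \<gamma> \<longrightarrow>
      k \<alpha> + linear_part m \<alpha> + (k \<beta> + linear_part m \<beta>) \<le> k \<gamma> + linear_part m \<gamma> \<and>
      k \<gamma> + linear_part m \<gamma> \<le> k \<alpha> + linear_part m \<alpha> + (k \<beta> + linear_part m \<beta>) + 1) \<longleftrightarrow>
     (coroot \<alpha> + coroot \<beta> = coroot \<gamma> \<longrightarrow> k \<alpha> + k \<beta> \<le> k \<gamma> \<and> k \<gamma> \<le> k \<alpha> + k \<beta> + 1)"
    if "\<alpha> \<in> P" "\<beta> \<in> P" "\<gamma> \<in> P" for \<alpha> \<beta> \<gamma>
    using lin[OF that] by auto
  then show ?thesis unfolding shi_system_def by (intro ball_cong refl) blast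
qed

lemma eval_P_shifted:
  "eval_hom real_of_int x (P_shifted B \<alpha> l) = linear_part x \<alpha> + real l - x \<alpha>"
  by (simp add: P_shifted_def P_poly_def linear_part_def int_eval.eval_diff int_eval.eval_add int_eval.eval_sum
      int_eval.eval_mult int_eval.eval_of_int int_eval.eval_of_nat int_eval.eval_var)

lemma X_component_iff:
  "x \<in> X_component R B l \<longleftrightarrow> x \<in> P \<rightarrow>\<^sub>E UNIV \<and> (\<forall>\<alpha>\<in>P. x \<alpha> = linear_part x \<alpha> + real (l \<alpha>))"
proof -
  have "linear_part x \<alpha> + real (l \<alpha>) - x \<alpha> = 0 \<longleftrightarrow> x \<alpha> = linear_part x \<alpha> + real (l \<alpha>)" for \<alpha> by auto
  then show ?thesis
    by (auto simp: X_component_def zero_locus_def eval_real_mpoly eval_P_shifted)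
qed

lemma algebraic_X_component: "algebraic_set P (X_component R B l)"
proof -
  have "P_shifted B \<alpha> n \<in> polys_in P" if "\<alpha> \<in> P" for \<alpha> n
    unfolding P_shifted_def P_poly_def using that B_P
    by (intro polys_in_diff polys_in_add polys_in_sum polys_in_mult polys_in_of_int polys_in_of_nat polys_in_var) auto
  then show ?thesis
    unfolding algebraic_set_def X_component_def
    by (intro exI[of _ "{real_mpoly (P_shifted B \<alpha> (l \<alpha>)) | \<alpha>. \<alpha> \<in> P}"]) (auto intro: real_mpoly_polys_in)
qed

text \<open>A simple coroot has height 1, so the only admissible entry is 0.\<close>

lemma admitted_simple: "l \<in> admitted_vectors R B \<Longrightarrow> b \<in> B \<Longrightarrow> l b = 0"
proof -
  assume l: "l \<in> admitted_vectors R B" and b: "b \<in> B"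
  have "real_of_int (coroot_height B b) = 1"
    using coroot_height[OF B_R[OF b]] dual.inner_rho[of "coroot b"] b by simp
  moreover have "l b \<in> I_set B b"
    using l B_P[OF b] by (auto simp: admitted_vectors_def admissible_vectors_def)
  ultimately show ?thesis by (simp add: I_set_def)
qed

lemma finite_I_set: "finite (I_set B \<alpha>)"
  by (rule finite_subset[of _ "{..nat (coroot_height B \<alpha>)}"]) (auto simp: I_set_def)

lemma finite_admitted: "finite (admitted_vectors R B)"
proof (rule finite_subset)
  show "admitted_vectors R B \<subseteq> (\<Pi>\<^sub>E \<alpha>\<in>P. I_set B \<alpha>)"
    by (auto simp: admitted_vectors_def admissible_vectors_def)
  show "finite (\<Pi>\<^sub>E \<alpha>\<in>P. I_set B \<alpha>)" using finite_P finite_I_set by (intro finite_PiE) auto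
qed

text \<open>The range of \<open>I_set\<close> is exactly what \<open>shi_bounds\<close> gives in the
  dual system: values from 0 to the coroot height minus 1.\<close>

lemma admittedI:
  assumes k: "shi_system R B k" "\<And>b. b \<in> B \<Longrightarrow> k b = 0"
  shows "(\<lambda>\<alpha>\<in>P. nat (k \<alpha>)) \<in> admitted_vectors R B" and "\<And>\<alpha>. \<alpha> \<in> P \<Longrightarrow> 0 \<le> k \<alpha>"
proof -
  have bounds: "0 \<le> k \<alpha> \<and> real_of_int (k \<alpha>) \<le> coroot_height B \<alpha> - 1" if "\<alpha> \<in> P" for \<alpha>
  proof -
    have "extend k b = 0" if "b \<in> coroot ` B" for b using that k(2) B_P extend_coroot by auto
    moreover have "coroot \<alpha> \<in> dual.P" using that by (simp add: positive_roots_coroot)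
    ultimately show ?thesis
      using dual.shi_bounds[OF shi_extend[OF k(1)], of "coroot \<alpha>"] extend_coroot[OF that, of k]
        coroot_height[OF P_R[OF that]] by simp
  qed
  then show "\<And>\<alpha>. \<alpha> \<in> P \<Longrightarrow> 0 \<le> k \<alpha>" by blast
  have "(\<lambda>\<alpha>\<in>P. nat (k \<alpha>)) \<in> admissible_vectors R B"
  proof -
    have "nat (k \<alpha>) \<in> I_set B \<alpha>" if "\<alpha> \<in> P" for \<alpha>
    proof -
      have "k \<alpha> \<le> coroot_height B \<alpha> - 1" using bounds[OF that] by linarith
      then show ?thesis using bounds[OF that] by (simp add: I_set_def)
    qed
    then show ?thesis by (auto simp: admissible_vectors_def)
  qed
  moreover have "shi_system R B (\<lambda>\<alpha>. int ((\<lambda>\<alpha>\<in>P. nat (k \<alpha>)) \<alpha>))"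
    using k(1) bounds by (subst shi_system_cong[of _ k]) auto
  ultimately show "(\<lambda>\<alpha>\<in>P. nat (k \<alpha>)) \<in> admitted_vectors R B" by (simp add: admitted_vectors_def)
qed

lemma integral_points_shi_variety: "integral_points P (shi_variety R B) = shi_points"
proof (intro subset_antisym subsetI)
  fix x assume "x \<in> integral_points P (shi_variety R B)"
  then obtain l where l: "l \<in> admitted_vectors R B" "x \<in> X_component R B l" and int: "\<And>\<alpha>. \<alpha> \<in> P \<Longrightarrow> x \<alpha> \<in> \<int>"
    by (auto simp: integral_points_def shi_variety_def)
  define k where "k \<alpha> = \<lfloor>x \<alpha>\<rfloor>" for \<alpha>
  have k: "real_of_int (k \<alpha>) = x \<alpha>" if "\<alpha> \<in> P" for \<alpha> using int[OF that] by (auto simp: k_def elim: Ints_cases)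
  have "linear_part x \<alpha> = linear_part (\<lambda>b. real_of_int (k b)) \<alpha>" for \<alpha>
    unfolding linear_part_def using k B_P by (intro sum.cong) auto
  then have "real_of_int (k \<alpha>) = real_of_int (int (l \<alpha>) + linear_part k \<alpha>)" if "\<alpha> \<in> P" for \<alpha>
    using l(2) k[OF that] that unfolding X_component_iff by (simp add: linear_part_of_int)
  then have "k \<alpha> = int (l \<alpha>) + linear_part k \<alpha>" if "\<alpha> \<in> P" for \<alpha>
    using that by (simp only: of_int_eq_iff)
  then have "shi_system R B k \<longleftrightarrow> shi_system R B (\<lambda>\<alpha>. int (l \<alpha>) + linear_part k \<alpha>)"
    by (intro shi_system_cong)
  then have "shi_system R B k" using l(1) by (simp add: shi_system_shift admitted_vectors_def)
  moreover have "x = (\<lambda>\<alpha>\<in>P. real_of_int (k \<alpha>))"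
    using l(2) k unfolding X_component_iff by (auto simp: fun_eq_iff PiE_def extensional_def)
  ultimately show "x \<in> shi_points" unfolding shi_points_def by blast
next
  fix x assume "x \<in> shi_points"
  then obtain k where k: "shi_system R B k" "x = (\<lambda>\<alpha>\<in>P. real_of_int (k \<alpha>))" by (auto simp: shi_points_def)
  define m where "m \<alpha> = k \<alpha> - linear_part k \<alpha>" for \<alpha>
  have "shi_system R B m" using k(1) shi_system_shift[of m k] by (simp add: m_def)
  moreover have "m b = 0" if "b \<in> B" for b using that by (simp add: m_def linear_part_simple)
  ultimately have m: "(\<lambda>\<alpha>\<in>P. nat (m \<alpha>)) \<in> admitted_vectors R B" "\<And>\<alpha>. \<alpha> \<in> P \<Longrightarrow> 0 \<le> m \<alpha>"
    using admittedI by blast+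
  have "linear_part x \<alpha> = linear_part (\<lambda>b. real_of_int (k b)) \<alpha>" for \<alpha>
    unfolding linear_part_def using k B_P by (intro sum.cong) auto
  then have "x \<in> X_component R B (\<lambda>\<alpha>\<in>P. nat (m \<alpha>))"
    unfolding X_component_iff using k m(2) by (auto simp: m_def simp flip: linear_part_of_int)
  then show "x \<in> integral_points P (shi_variety R B)"
    using m(1) k by (auto simp: integral_points_def shi_variety_def)
qed

text \<open>A point recovers its vector: the entry at \<alpha> is x \<alpha> minus the linear part
  at \<alpha>.\<close>

lemma disjoint_X_component: "disjoint_family_on (X_component R B) (admitted_vectors R B)"
  unfolding disjoint_family_on_def
proof (intro ballI impI)
  fix l m assume h: "l \<in> admitted_vectors R B" "m \<in> admitted_vectors R B" "l \<noteq> m"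
  have "l = m" if x: "x \<in> X_component R B l" "x \<in> X_component R B m" for x
  proof (rule PiE_ext)
    show "l \<in> Pi\<^sub>E P (I_set B)" "m \<in> Pi\<^sub>E P (I_set B)"
      using h by (auto simp: admitted_vectors_def admissible_vectors_def)
    show "l \<alpha> = m \<alpha>" if "\<alpha> \<in> P" for \<alpha>
      using x that unfolding X_component_iff by (metis add_left_cancel of_nat_eq_iff)
  qed
  then show "X_component R B l \<inter> X_component R B m = {}" using h by blast
qed

text \<open>At a point of the component of \<open>l\<close>, the factor with index
  \<open>l \<alpha>\<close> of the generator for \<alpha> vanishes, and with it every element of the
  ideal.\<close>

lemma shi_variety_subset: "shi_variety R B \<subseteq> X_variety R B"
proof
  fix x assume "x \<in> shi_variety R B"
  then obtain l where l: "l \<in> admitted_vectors R B" "x \<in> X_component R B l" by (auto simp: shi_variety_def)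
  have zero: "eval_hom real_of_int x (\<Prod>n\<in>I_set B \<alpha>. P_shifted B \<alpha> n) = 0" if "\<alpha> \<in> P" for \<alpha>
  proof -
    have "l \<alpha> \<in> I_set B \<alpha>" using l(1) that by (auto simp: admitted_vectors_def admissible_vectors_def)
    moreover have "eval_hom real_of_int x (P_shifted B \<alpha> (l \<alpha>)) = 0"
      using l(2) that unfolding X_component_iff eval_P_shifted by auto
    ultimately show ?thesis unfolding int_eval.eval_prod using finite_I_set by (intro prod_zero) auto
  qed
  show "x \<in> X_variety R B"
    unfolding X_variety_def zero_locus_def
  proof (intro CollectI conjI ballI)
    show "x \<in> P \<rightarrow>\<^sub>E UNIV" using l(2) X_component_iff by blast
    fix p assume "p \<in> real_mpoly ` J_ideal R B"
    then obtain f where f: "p = real_mpoly (\<Sum>\<alpha>\<in>P. f \<alpha>)"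
      "\<And>\<alpha>. \<alpha> \<in> P \<Longrightarrow> f \<alpha> \<in> principal_ideal_in P (\<Prod>n\<in>I_set B \<alpha>. P_shifted B \<alpha> n)"
      unfolding J_ideal_def by blast
    have "eval_hom real_of_int x (f \<alpha>) = 0" if "\<alpha> \<in> P" for \<alpha>
      using f(2)[OF that] zero[OF that] by (auto simp: principal_ideal_in_def int_eval.eval_mult)
    then show "eval_mpoly x p = 0" by (simp add: f eval_real_mpoly int_eval.eval_sum)
  qed
qed

lemma irreducible_X_component:
  assumes l: "l \<in> admitted_vectors R B" shows "irreducible_algebraic_set P (X_component R B l)"
proof (rule irreducible_affine[OF algebraic_X_component])
  \<comment> \<open>The vector itself is a point of its component: it vanishes at simple roots, and
    the linear part reads only those entries.\<close>
  let ?x = "\<lambda>\<alpha>\<in>P. real (l \<alpha>)"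
  have "linear_part ?x \<alpha> = 0" for \<alpha>
    unfolding linear_part_def using admitted_simple[OF l] B_P by (intro sum.neutral) auto
  then have "?x \<in> X_component R B l" by (simp add: X_component_iff)
  then show "X_component R B l \<noteq> {}" by blast
next
  fix y z t assume yz: "y \<in> X_component R B l" "z \<in> X_component R B l"
  have "linear_part (line_point P y z t) \<alpha> = linear_part y \<alpha> + t * (linear_part z \<alpha> - linear_part y \<alpha>)" for \<alpha>
  proof -
    have "linear_part (line_point P y z t) \<alpha> =
        (\<Sum>b\<in>B. of_int (coroot_coeff B \<alpha> b) * y b + t * (of_int (coroot_coeff B \<alpha> b) * z b - of_int (coroot_coeff B \<alpha> b) * y b))"
      unfolding linear_part_def using B_P by (intro sum.cong) (auto simp: line_point_def algebra_simps)
    then show ?thesis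
      by (simp add: linear_part_def sum.distrib sum_subtractf flip: sum_distrib_left)
  qed
  moreover have "line_point P y z t \<alpha> = y \<alpha> + t * (z \<alpha> - y \<alpha>)" if "\<alpha> \<in> P" for \<alpha>
    using that by (simp add: line_point_def)
  moreover have "line_point P y z t \<in> P \<rightarrow>\<^sub>E UNIV" by (simp add: line_point_def)
  ultimately show "line_point P y z t \<in> X_component R B l"
    using yz unfolding X_component_iff by simp
qed

lemma irreducible_components_shi_variety:
  "irreducible_components P (shi_variety R B) = X_component R B ` admitted_vectors R B"
  unfolding shi_variety_def
  by (rule irreducible_components_disjoint_UN[OF finite_admitted irreducible_X_component disjoint_X_component])

lemma card_components: "card (irreducible_components P (shi_variety R B)) = card (admitted_vectors R B)"
proof -
  have "X_component R B l \<noteq> {}" if "l \<in> admitted_vectors R B" for l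
    using irreducible_X_component[OF that] by (simp add: irreducible_algebraic_set_def)
  then have "inj_on (X_component R B) (admitted_vectors R B)"
    using disjoint_X_component unfolding disjoint_family_on_def by (intro inj_onI) blast
  then show ?thesis unfolding irreducible_components_shi_variety by (rule card_image)
qed

lemma card_admitted: "card (admitted_vectors R B) = card dual.base_regions"
proof (rule bij_betw_same_card)
  let ?f = "\<lambda>l. dual.region (extend (\<lambda>\<alpha>. int (l \<alpha>)))"
  show "bij_betw ?f (admitted_vectors R B) dual.base_regions"
    unfolding bij_betw_def
  proof (intro conjI inj_onI subset_antisym subsetI)
    fix l m assume h: "l \<in> admitted_vectors R B" "m \<in> admitted_vectors R B" "?f l = ?f m"
    show "l = m"
    proof (rule PiE_ext)
      show "l \<in> Pi\<^sub>E P (I_set B)" "m \<in> Pi\<^sub>E P (I_set B)"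
        using h by (auto simp: admitted_vectors_def admissible_vectors_def)
      show "l \<alpha> = m \<alpha>" if "\<alpha> \<in> P" for \<alpha>
        using strips_eq_imp[of "\<lambda>\<alpha>. int (l \<alpha>)" "\<lambda>\<alpha>. int (m \<alpha>)" \<alpha>] h that
        by (simp add: region_extend admitted_vectors_def)
    qed
  next
    fix S assume "S \<in> ?f ` admitted_vectors R B"
    then obtain l where l: "l \<in> admitted_vectors R B" "S = ?f l" by blast
    have "extend (\<lambda>\<alpha>. int (l \<alpha>)) b = 0" if "b \<in> coroot ` B" for b
      using that admitted_simple[OF l(1)] B_P extend_coroot by auto
    moreover have "dual.shi (extend (\<lambda>\<alpha>. int (l \<alpha>)))" using l by (intro shi_extend) (simp add: admitted_vectors_def)
    ultimately show "S \<in> dual.base_regions" unfolding dual.base_regions_def l(2) by blast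
  next
    fix S assume "S \<in> dual.base_regions"
    then obtain K where K: "dual.shi K" "\<forall>b\<in>coroot ` B. K b = 0" "S = dual.region K"
      by (auto simp: dual.base_regions_def)
    let ?k = "\<lambda>\<alpha>. K (coroot \<alpha>)"
    have l: "(\<lambda>\<alpha>\<in>P. nat (?k \<alpha>)) \<in> admitted_vectors R B" "\<And>\<alpha>. \<alpha> \<in> P \<Longrightarrow> 0 \<le> ?k \<alpha>"
      using admittedI[OF shi_restrict[OF K(1)]] K(2) by auto
    have "?f (\<lambda>\<alpha>\<in>P. nat (?k \<alpha>)) = dual.region (extend ?k)"
      using l(2) by (simp add: region_extend)
    also have "\<dots> = S" unfolding K(3) using extend_restrict[OF K(1)] by (intro dual.region_cong) blast
    finally show "S \<in> ?f ` admitted_vectors R B" using l(1) by blast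
  qed
qed

lemma card_components_highest_root:
  assumes "highest_root R B \<theta>" "\<theta> = (\<Sum>\<alpha>\<in>B. c \<alpha> *\<^sub>R \<alpha>)"
  shows "real (card (irreducible_components P (shi_variety R B))) = fact (card B) * (\<Prod>\<alpha>\<in>B. c \<alpha>)"
proof -
  have "(\<Prod>b\<in>B. representation B \<theta> b) = (\<Prod>b\<in>B. c b)"
    unfolding assms(2) by (intro prod.cong) (simp_all add: representation_sum)
  then show ?thesis
    using card_base_regions_coroot[OF assms(1)] by (simp add: card_components card_admitted)
qed

end

theorem theorem4p14:
  fixes \<Phi> \<Delta> :: "'v::euclidean_space set"
  assumes "crystallographic_root_system \<Phi>"
    and "irreducible_roots \<Phi>"
    and "short_roots_normalized \<Phi>"
    and "simple_system \<Phi> \<Delta>"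
  shows
    "(\<forall>w\<in>affine_weyl_group \<Phi>. \<exists>!k. alcove_coordinates \<Phi> \<Delta> w k) \<and>
     iota \<Phi> \<Delta> \<in> affine_weyl_group \<Phi> \<rightarrow> integral_points (positive_roots \<Phi> \<Delta>) (X_variety \<Phi> \<Delta>) \<and>
     inj_on (iota \<Phi> \<Delta>) (affine_weyl_group \<Phi>) \<and>
     disjoint_family_on (X_component \<Phi> \<Delta>) (admitted_vectors \<Phi> \<Delta>) \<and>
     algebraic_set (positive_roots \<Phi> \<Delta>) (shi_variety \<Phi> \<Delta>) \<and>
     shi_variety \<Phi> \<Delta> \<subseteq> X_variety \<Phi> \<Delta> \<and>
     bij_betw (iota \<Phi> \<Delta>) (affine_weyl_group \<Phi>)
       (integral_points (positive_roots \<Phi> \<Delta>) (shi_variety \<Phi> \<Delta>)) \<and>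
     (\<forall>\<theta> c. highest_root \<Phi> \<Delta> \<theta> \<and> \<theta> = (\<Sum>\<alpha>\<in>\<Delta>. c \<alpha> *\<^sub>R \<alpha>) \<longrightarrow>
       finite (irreducible_components (positive_roots \<Phi> \<Delta>) (shi_variety \<Phi> \<Delta>)) \<and>
       real (card (irreducible_components (positive_roots \<Phi> \<Delta>) (shi_variety \<Phi> \<Delta>))) =
         fact (card \<Delta>) * (\<Prod>\<alpha>\<in>\<Delta>. c \<alpha>))"
proof -
  interpret root_system \<Phi> \<Delta> using assms by unfold_locales
  have bij: "bij_betw (iota \<Phi> \<Delta>) (affine_weyl_group \<Phi>) (integral_points P (shi_variety \<Phi> \<Delta>))"
    by (simp add: bij_betw_def inj_on_iota iota_image integral_points_shi_variety)
  moreover have "integral_points P (shi_variety \<Phi> \<Delta>) \<subseteq> integral_points P (X_variety \<Phi> \<Delta>)"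
    using shi_variety_subset by (auto simp: integral_points_def)
  ultimately have "iota \<Phi> \<Delta> \<in> affine_weyl_group \<Phi> \<rightarrow> integral_points P (X_variety \<Phi> \<Delta>)"
    by (auto simp: bij_betw_def)
  moreover have "\<exists>!k. alcove_coordinates \<Phi> \<Delta> w k" if "w \<in> affine_weyl_group \<Phi>" for w
    using alcove_coordinates_exist[OF that] alcove_coordinates_unique by metis
  moreover have "algebraic_set P (shi_variety \<Phi> \<Delta>)"
    unfolding shi_variety_def by (intro algebraic_UN finite_admitted algebraic_X_component)
  moreover have "finite (irreducible_components P (shi_variety \<Phi> \<Delta>))"
    unfolding irreducible_components_shi_variety by (intro finite_imageI finite_admitted)
  ultimately show ?thesis
    using bij inj_on_iota disjoint_X_component shi_variety_subset card_components_highest_root by blast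
qed

end
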